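(* Let $(Q,D(Q))$ be a regular Dirichlet form as in the context, with associated self-adjoint operator $L$. Then the following are equivalent: (i) $Q=Q^{\max}$; (ii) $D(L)=\{u\in D(\mathcal L)\cap L^2(X,m)\mid\mathcal Lu\in L^2(X,m)\}$; (iii) for all $u\in D(\mathcal L)\cap L^2(X,m)$ with $\mathcal Lu\in L^2(X,m)$ and all $v\in\widetilde D(Q)\cap L^2(X,m)$, $$\widetilde Q(u,v)=\int_X(\mathcal Lu)\,v\,dm.$$
   Context: $X$ is a locally compact separable metric space, $m$ a Radon measure of full support, $(Q,D(Q))$ a regular Dirichlet form on $L^2(X,m)$ with Beurling–Deny decomposition $Q(u)=\int_Xd\mu^{(c)}(u)+\iint_{X\times X\setminus\mathrm{diag}}(\tilde u(x)-\tilde u(y))^2J(dx,dy)+\int_X\tilde u^2dk$. $D(Q)_{\rm loc}$ is the set of $u\in L^2_{\rm loc}(X,m)$ such that for every open relatively compact $G$ there is $v\in D(Q)$ with $u=v$ a.e. on $G$; $Q$ extends to $D(Q)_{\rm loc}$ (values in $[0,\infty]$) via the Beurling–Deny formula with locally defined $\mu^{(c)}(u)$. For $u\in L^0(X,m)$ let $u^{(n)}=(u\wedge n)\vee(-n)$; $\widetilde Q(u)=\lim_nQ(u^{(n)})$ if all $u^{(n)}\in D(Q)_{\rm loc}$, else $\infty$; $\widetilde D(Q)=\{\widetilde Q<\infty\}$, a linear space on which $\widetilde Q$ is a quadratic form with bilinear form $\widetilde Q(u,v)$ by polarization. $Q^{\max}$ is the restriction of $\widetilde Q$ to $\widetilde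 D(Q)\cap L^2(X,m)$. $D(\mathcal L)=\{u\in\widetilde D(Q)\mid\exists f\in L^1_{\rm loc}(X,m):\ \widetilde Q(u,v)=\int_Xfv\,dm\ \forall v\in D(Q)\cap C_c(X)\}$, $\mathcal Lu=f$. *)

theory Defs
  imports "HOL-Analysis.Analysis"
begin

text \<open>The space X is the whole type 'a (a separable metric space; local compactness is
an explicit hypothesis).  Elements of L^2(X,m) are represented by functions 'a \<Rightarrow> real;
all sets of functions below are saturated w.r.t. equality m-a.e.\<close>

definition L2 :: "'a measure \<Rightarrow> ('a \<Rightarrow> real) \<Rightarrow> bool" where
  "L2 m u \<longleftrightarrow> u \<in> borel_measurable m \<and> integrable m (\<lambda>x. (u x)\<^sup>2)"

definition L2loc :: "'a::topological_space measure \<Rightarrow> ('a \<Rightarrow> real) \<Rightarrow> bool" where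
  "L2loc m u \<longleftrightarrow> u \<in> borel_measurable m \<and>
     (\<forall>K. compact K \<longrightarrow> integrable m (\<lambda>x. indicator K x * (u x)\<^sup>2))"

definition L1loc :: "'a::topological_space measure \<Rightarrow> ('a \<Rightarrow> real) \<Rightarrow> bool" where
  "L1loc m f \<longleftrightarrow> f \<in> borel_measurable m \<and>
     (\<forall>K. compact K \<longrightarrow> integrable m (\<lambda>x. indicator K x * f x))"

definition Cc :: "('a::topological_space \<Rightarrow> real) set" where
  "Cc = {u. continuous_on UNIV u \<and> compact (closure {x. u x \<noteq> 0})}"

definition radon_full_support :: "'a::topological_space measure \<Rightarrow> bool" where
  "radon_full_support m \<longleftrightarrow> sets m = sets borel \<and>
     (\<forall>K. compact K \<longrightarrow> emeasure m K < \<infinity>) \<and>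
     (\<forall>U. open U \<and> U \<noteq> {} \<longrightarrow> emeasure m U > 0)"

definition Q1 :: "'a measure \<Rightarrow> (('a \<Rightarrow> real) \<Rightarrow> ('a \<Rightarrow> real) \<Rightarrow> real) \<Rightarrow> ('a \<Rightarrow> real) \<Rightarrow> real" where
  "Q1 m Q u = Q u u + (\<integral>x. (u x)\<^sup>2 \<partial>m)"

definition dirichlet_form ::
  "'a measure \<Rightarrow> (('a \<Rightarrow> real) \<Rightarrow> ('a \<Rightarrow> real) \<Rightarrow> real) \<Rightarrow> ('a \<Rightarrow> real) set \<Rightarrow> bool" where
  "dirichlet_form m Q D \<longleftrightarrow>
     D \<subseteq> {u. L2 m u} \<and>
     (\<forall>u\<in>D. \<forall>v. v \<in> borel_measurable m \<and> (AE x in m. u x = v x) \<longrightarrow>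
        v \<in> D \<and> (\<forall>w\<in>D. Q u w = Q v w)) \<and>
     (\<lambda>x. 0) \<in> D \<and>
     (\<forall>u\<in>D. \<forall>v\<in>D. (\<lambda>x. u x + v x) \<in> D) \<and>
     (\<forall>u\<in>D. \<forall>c. (\<lambda>x. c * u x) \<in> D) \<and>
     (\<forall>u\<in>D. \<forall>v\<in>D. Q u v = Q v u) \<and>
     (\<forall>u\<in>D. \<forall>v\<in>D. \<forall>w\<in>D. Q (\<lambda>x. u x + v x) w = Q u w + Q v w) \<and>
     (\<forall>u\<in>D. \<forall>v\<in>D. \<forall>c. Q (\<lambda>x. c * u x) v = c * Q u v) \<and>
     (\<forall>u\<in>D. Q u u \<ge> 0) \<and>
     (\<forall>f. L2 m f \<longrightarrow> (\<forall>e>0. \<exists>u\<in>D. (\<integral>x. (u x - f x)\<^sup>2 \<partial>m) < e)) \<and>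
     (\<forall>us. (\<forall>n. us n \<in> D) \<and>
           (\<forall>e>0. \<exists>N. \<forall>n\<ge>N. \<forall>k\<ge>N. Q1 m Q (\<lambda>x. us n x - us k x) < e) \<longrightarrow>
           (\<exists>u\<in>D. (\<lambda>n. Q1 m Q (\<lambda>x. us n x - u x)) \<longlonglongrightarrow> 0)) \<and>
     (\<forall>u\<in>D. (\<lambda>x. min 1 (max 0 (u x))) \<in> D \<and>
        Q (\<lambda>x. min 1 (max 0 (u x))) (\<lambda>x. min 1 (max 0 (u x))) \<le> Q u u)"

definition regular_dirichlet_form ::
  "'a::topological_space measure \<Rightarrow> (('a \<Rightarrow> real) \<Rightarrow> ('a \<Rightarrow> real) \<Rightarrow> real) \<Rightarrow> ('a \<Rightarrow> real) set \<Rightarrow> bool" where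
  "regular_dirichlet_form m Q D \<longleftrightarrow> dirichlet_form m Q D \<and>
     (\<forall>u\<in>D. \<forall>e>0. \<exists>v\<in>D \<inter> Cc. Q1 m Q (\<lambda>x. u x - v x) < e) \<and>
     (\<forall>g\<in>Cc. \<forall>e>0. \<exists>v\<in>D \<inter> Cc. \<forall>x. \<bar>v x - g x\<bar> < e)"

definition capacity ::
  "'a::topological_space measure \<Rightarrow> (('a \<Rightarrow> real) \<Rightarrow> ('a \<Rightarrow> real) \<Rightarrow> real) \<Rightarrow> ('a \<Rightarrow> real) set
   \<Rightarrow> 'a set \<Rightarrow> ennreal" where
  "capacity m Q D A = (INF U\<in>{U. open U \<and> A \<subseteq> U}.
      INF u\<in>{u\<in>D. AE x in m. x \<in> U \<longrightarrow> u x \<ge> 1}. ennreal (Q1 m Q u))"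

definition quasi_continuous ::
  "'a::topological_space measure \<Rightarrow> (('a \<Rightarrow> real) \<Rightarrow> ('a \<Rightarrow> real) \<Rightarrow> real) \<Rightarrow> ('a \<Rightarrow> real) set
   \<Rightarrow> ('a \<Rightarrow> real) \<Rightarrow> bool" where
  "quasi_continuous m Q D f \<longleftrightarrow>
     (\<forall>e>0. \<exists>G. open G \<and> capacity m Q D G < ennreal e \<and> continuous_on (- G) f)"

definition Qc :: "(('a \<Rightarrow> real) \<Rightarrow> 'a measure) \<Rightarrow> ('a \<Rightarrow> real) \<Rightarrow> ('a \<Rightarrow> real) \<Rightarrow> real" where
  "Qc mu u v = (measure (mu (\<lambda>x. u x + v x)) UNIV - measure (mu (\<lambda>x. u x - v x)) UNIV) / 4"

text \<open>(mu, J, k) is the Beurling--Deny decomposition of the regular Dirichlet form (Q, D):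
  Q(u) = mu(u)(X) + \<integral>\<integral>_{X\<times>X\diag} (u~(x) - u~(y))^2 J(dx,dy) + \<integral> u~^2 dk
for every quasi-continuous m-version u~ of u \<in> D, where J is a symmetric Radon measure
on X\<times>X off the diagonal, k is a Radon measure on X, both not charging sets of zero capacity,
and mu(u) (= mu^(c)(u)) is the (measure valued, quadratic) energy measure of the strongly local
part Q^(c)(u,v) = polarization of mu(.)(X), normalized so that Q^(c)(u) = mu(u)(X).\<close>
definition beurling_deny ::
  "'a::topological_space measure \<Rightarrow> (('a \<Rightarrow> real) \<Rightarrow> ('a \<Rightarrow> real) \<Rightarrow> real) \<Rightarrow> ('a \<Rightarrow> real) set
   \<Rightarrow> (('a \<Rightarrow> real) \<Rightarrow> 'a measure) \<Rightarrow> ('a \<times> 'a) measure \<Rightarrow> 'a measure \<Rightarrow> bool" where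
  "beurling_deny m Q D mu J k \<longleftrightarrow>
     sets J = sets (borel :: ('a \<times> 'a) measure) \<and>
     emeasure J {p. fst p = snd p} = 0 \<and>
     (\<forall>A\<in>sets J. emeasure J ((\<lambda>p. (snd p, fst p)) -` A) = emeasure J A) \<and>
     (\<forall>K. compact K \<and> K \<inter> {p. fst p = snd p} = {} \<longrightarrow> emeasure J K < \<infinity>) \<and>
     sets k = sets borel \<and>
     (\<forall>K. compact K \<longrightarrow> emeasure k K < \<infinity>) \<and>
     (\<forall>N\<in>sets borel. capacity m Q D N = 0 \<longrightarrow> emeasure k N = 0 \<and> emeasure J (N \<times> UNIV) = 0) \<and>
     (\<forall>u\<in>D. sets (mu u) = sets borel \<and> emeasure (mu u) UNIV < \<infinity>) \<and>
     (\<forall>u\<in>D. \<forall>v\<in>D. \<forall>A\<in>sets borel.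
        emeasure (mu (\<lambda>x. u x + v x)) A + emeasure (mu (\<lambda>x. u x - v x)) A
          = 2 * emeasure (mu u) A + 2 * emeasure (mu v) A) \<and>
     (\<forall>u\<in>D. \<forall>c. \<forall>A\<in>sets borel. emeasure (mu (\<lambda>x. c * u x)) A = ennreal (c\<^sup>2) * emeasure (mu u) A) \<and>
     (\<forall>u\<in>D. \<forall>f. quasi_continuous m Q D f \<and> (AE x in m. f x = u x) \<longrightarrow>
        ennreal (Q u u) = emeasure (mu u) UNIV
          + (\<integral>\<^sup>+p. ennreal ((f (fst p) - f (snd p))\<^sup>2) \<partial>J)
          + (\<integral>\<^sup>+x. ennreal ((f x)\<^sup>2) \<partial>k)) \<and>
     (\<forall>u\<in>D \<inter> Cc. \<forall>v\<in>D \<inter> Cc.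
        (\<exists>U c. open U \<and> closure {x. u x \<noteq> 0} \<subseteq> U \<and> (\<forall>x\<in>U. v x = c)) \<longrightarrow> Qc mu u v = 0) \<and>
     (\<forall>u\<in>D. \<forall>phi\<in>D \<inter> Cc. (\<exists>C. AE x in m. \<bar>u x\<bar> \<le> C) \<longrightarrow>
        (\<integral>x. phi x \<partial>mu u) = Qc mu (\<lambda>x. u x * phi x) u - Qc mu (\<lambda>x. (u x)\<^sup>2) phi / 2)"

definition Dloc :: "'a::topological_space measure \<Rightarrow> ('a \<Rightarrow> real) set \<Rightarrow> ('a \<Rightarrow> real) set" where
  "Dloc m D = {u. L2loc m u \<and>
     (\<forall>G. open G \<and> compact (closure G) \<longrightarrow> (\<exists>v\<in>D. AE x in m. x \<in> G \<longrightarrow> u x = v x))}"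

text \<open>Total mass of the locally defined measure mu^(c)(u), u \<in> D(Q)_loc.\<close>
definition mu_loc_mass ::
  "'a::topological_space measure \<Rightarrow> ('a \<Rightarrow> real) set \<Rightarrow> (('a \<Rightarrow> real) \<Rightarrow> 'a measure)
   \<Rightarrow> ('a \<Rightarrow> real) \<Rightarrow> ennreal" where
  "mu_loc_mass m D mu u = (SUP p\<in>{(G, v). open G \<and> compact (closure G) \<and> v \<in> D \<and>
        (AE x in m. x \<in> G \<longrightarrow> u x = v x)}. emeasure (mu (snd p)) (fst p))"

text \<open>Extension of Q to D(Q)_loc via the Beurling--Deny formula (values in [0,\<infinity>]);
the quasi-continuous version is any quasi-continuous m-version of u.\<close>
definition Qloc ::
  "'a::topological_space measure \<Rightarrow> (('a \<Rightarrow> real) \<Rightarrow> ('a \<Rightarrow> real) \<Rightarrow> real) \<Rightarrow> ('a \<Rightarrow> real) set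
   \<Rightarrow> (('a \<Rightarrow> real) \<Rightarrow> 'a measure) \<Rightarrow> ('a \<times> 'a) measure \<Rightarrow> 'a measure
   \<Rightarrow> ('a \<Rightarrow> real) \<Rightarrow> ennreal" where
  "Qloc m Q D mu J k u =
     (let f = (SOME f. quasi_continuous m Q D f \<and> (AE x in m. f x = u x)) in
       mu_loc_mass m D mu u
       + (\<integral>\<^sup>+p. ennreal ((f (fst p) - f (snd p))\<^sup>2) \<partial>J)
       + (\<integral>\<^sup>+x. ennreal ((f x)\<^sup>2) \<partial>k))"

definition trunc :: "nat \<Rightarrow> ('a \<Rightarrow> real) \<Rightarrow> 'a \<Rightarrow> real" where
  "trunc n u x = max (- real n) (min (real n) (u x))"

text \<open>Q~(u) = lim_n Q(u^(n)) (the sequence is nondecreasing, so the limit is the supremum)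
if all u^(n) \<in> D(Q)_loc, and \<infinity> otherwise.\<close>
definition Qtilde ::
  "'a::topological_space measure \<Rightarrow> (('a \<Rightarrow> real) \<Rightarrow> ('a \<Rightarrow> real) \<Rightarrow> real) \<Rightarrow> ('a \<Rightarrow> real) set
   \<Rightarrow> (('a \<Rightarrow> real) \<Rightarrow> 'a measure) \<Rightarrow> ('a \<times> 'a) measure \<Rightarrow> 'a measure
   \<Rightarrow> ('a \<Rightarrow> real) \<Rightarrow> ennreal" where
  "Qtilde m Q D mu J k u =
     (if (\<forall>n. trunc n u \<in> Dloc m D) then (SUP n. Qloc m Q D mu J k (trunc n u)) else \<infinity>)"

definition Dtilde ::
  "'a::topological_space measure \<Rightarrow> (('a \<Rightarrow> real) \<Rightarrow> ('a \<Rightarrow> real) \<Rightarrow> real) \<Rightarrow> ('a \<Rightarrow> real) set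
   \<Rightarrow> (('a \<Rightarrow> real) \<Rightarrow> 'a measure) \<Rightarrow> ('a \<times> 'a) measure \<Rightarrow> 'a measure \<Rightarrow> ('a \<Rightarrow> real) set" where
  "Dtilde m Q D mu J k = {u. u \<in> borel_measurable m \<and> Qtilde m Q D mu J k u < \<infinity>}"

definition Qtilde_bil ::
  "'a::topological_space measure \<Rightarrow> (('a \<Rightarrow> real) \<Rightarrow> ('a \<Rightarrow> real) \<Rightarrow> real) \<Rightarrow> ('a \<Rightarrow> real) set
   \<Rightarrow> (('a \<Rightarrow> real) \<Rightarrow> 'a measure) \<Rightarrow> ('a \<times> 'a) measure \<Rightarrow> 'a measure
   \<Rightarrow> ('a \<Rightarrow> real) \<Rightarrow> ('a \<Rightarrow> real) \<Rightarrow> real" where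
  "Qtilde_bil m Q D mu J k u v =
     (enn2real (Qtilde m Q D mu J k (\<lambda>x. u x + v x))
      - enn2real (Qtilde m Q D mu J k (\<lambda>x. u x - v x))) / 4"

definition Q_eq_Qmax ::
  "'a::topological_space measure \<Rightarrow> (('a \<Rightarrow> real) \<Rightarrow> ('a \<Rightarrow> real) \<Rightarrow> real) \<Rightarrow> ('a \<Rightarrow> real) set
   \<Rightarrow> (('a \<Rightarrow> real) \<Rightarrow> 'a measure) \<Rightarrow> ('a \<times> 'a) measure \<Rightarrow> 'a measure \<Rightarrow> bool" where
  "Q_eq_Qmax m Q D mu J k \<longleftrightarrow>
     D = Dtilde m Q D mu J k \<inter> {u. L2 m u} \<and>
     (\<forall>u\<in>D. ennreal (Q u u) = Qtilde m Q D mu J k u)"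

definition domL ::
  "'a measure \<Rightarrow> (('a \<Rightarrow> real) \<Rightarrow> ('a \<Rightarrow> real) \<Rightarrow> real) \<Rightarrow> ('a \<Rightarrow> real) set \<Rightarrow> ('a \<Rightarrow> real) set" where
  "domL m Q D = {u\<in>D. \<exists>f. L2 m f \<and> (\<forall>v\<in>D. Q u v = (\<integral>x. f x * v x \<partial>m))}"

text \<open>Weak operator: Lcal_rel ... u f means u \<in> D(\<L>) and \<L>u = f (f unique m-a.e.).\<close>
definition Lcal_rel ::
  "'a::topological_space measure \<Rightarrow> (('a \<Rightarrow> real) \<Rightarrow> ('a \<Rightarrow> real) \<Rightarrow> real) \<Rightarrow> ('a \<Rightarrow> real) set
   \<Rightarrow> (('a \<Rightarrow> real) \<Rightarrow> 'a measure) \<Rightarrow> ('a \<times> 'a) measure \<Rightarrow> 'a measure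
   \<Rightarrow> ('a \<Rightarrow> real) \<Rightarrow> ('a \<Rightarrow> real) \<Rightarrow> bool" where
  "Lcal_rel m Q D mu J k u f \<longleftrightarrow> u \<in> Dtilde m Q D mu J k \<and> L1loc m f \<and>
     (\<forall>v\<in>D \<inter> Cc. Qtilde_bil m Q D mu J k u v = (\<integral>x. f x * v x \<partial>m))"

definition domLcal ::
  "'a::topological_space measure \<Rightarrow> (('a \<Rightarrow> real) \<Rightarrow> ('a \<Rightarrow> real) \<Rightarrow> real) \<Rightarrow> ('a \<Rightarrow> real) set
   \<Rightarrow> (('a \<Rightarrow> real) \<Rightarrow> 'a measure) \<Rightarrow> ('a \<times> 'a) measure \<Rightarrow> 'a measure \<Rightarrow> ('a \<Rightarrow> real) set" where
  "domLcal m Q D mu J k = {u. \<exists>f. Lcal_rel m Q D mu J k u f}"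

end

theory Submission
  imports Defs
begin

text \<open>Let v be in the domain of Qmax and project it orthogonally onto D with respect to
  \<open>Qmax + \<langle>_, _\<rangle>\<close>. The difference h satisfies \<open>\<L> h = - h\<close>, and each of (ii) and (iii) turns this into
  \<open>Qmax h = - \<parallel>h\<parallel>\<^sup>2\<close>, so that h = 0 and v lies in D. The substance is that Q~ is a quadratic form
  extending Q. The energy measures are strongly local (first for continuous functions, from the
  integral identity defining them, then on D by approximation) and do not charge zero sets, hence
  they contract under truncation. Consequently the energy of a function in D(Q)loc is the supremum
  of quadratic forms on D over an exhaustion of the space. A lattice cutoff makes this supremum lower
  semicontinuous, which yields one half of the parallelogram law for Q~; the other half follows by
  applying the first to u + v and u - v.\<close>

section \<open>Quadratic forms on function spaces\<close>

text \<open>Truncation is not additive, so the definition of Q~ gives no quadratic form by itself: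
  u^(n) + v^(n) is not the truncation of u + v and only converges to it pointwise. Hence lower
  semicontinuity is needed along general pointwise convergent sequences in D(Q)loc and not just
  along truncations. A Leibniz rule for the energy measures is never established; instead of
  multiplying by cutoffs, functions are compared by max and min with multiples of a cutoff, and this
  works because the energy measures obey lattice bounds with constant 1 on each Borel set. Equality
  m-almost everywhere says nothing about J and k, so every local comparison passes through
  quasi-continuous versions and sets of zero capacity. Finally, the equation for h holds against all
  of D and not merely against continuous test functions; so (ii), which puts h into D, makes h its
  own test function, while (iii) allows this choice directly.\<close>

definition polar :: "(('a \<Rightarrow> real) \<Rightarrow> real) \<Rightarrow> ('a \<Rightarrow> real) \<Rightarrow> ('a \<Rightarrow> real) \<Rightarrow> real" where
  "polar q u v = (q (\<lambda>x. u x + v x) - q (\<lambda>x. u x - v x)) / 4"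

locale fun_space =
  fixes V :: "('a \<Rightarrow> real) set"
  assumes zero_mem: "(\<lambda>x. 0) \<in> V"
    and add_mem: "u \<in> V \<Longrightarrow> v \<in> V \<Longrightarrow> (\<lambda>x. u x + v x) \<in> V"
    and scale_mem: "u \<in> V \<Longrightarrow> (\<lambda>x. c * u x) \<in> V"
begin

lemma minus_mem: "u \<in> V \<Longrightarrow> (\<lambda>x. - u x) \<in> V"
  using scale_mem[of u "-1"] by simp

lemma diff_mem: "u \<in> V \<Longrightarrow> v \<in> V \<Longrightarrow> (\<lambda>x. u x - v x) \<in> V"
  using add_mem[OF _ minus_mem, of u v] by simp

lemma divide_mem: "u \<in> V \<Longrightarrow> (\<lambda>x. u x / c) \<in> V"
  using scale_mem[of u "1/c"] by (simp add: field_simps)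

lemma sum_mem: "(\<And>i. i \<in> I \<Longrightarrow> f i \<in> V) \<Longrightarrow> (\<lambda>x. \<Sum>i\<in>I. f i x) \<in> V"
  by (induction I rule: infinite_finite_induct) (auto simp: zero_mem intro: add_mem)

end

text \<open>Energies are given as values at single functions, for which the parallelogram law and
  homogeneity are the accessible facts. Bilinearity of the polarisation is recovered from these two
  (Jordan and von Neumann), so that measures, integrals and Q~ all fit one interface.\<close>

locale quad_form = fun_space V for V :: "('a \<Rightarrow> real) set" +
  fixes q :: "('a \<Rightarrow> real) \<Rightarrow> real"
  assumes nonneg: "u \<in> V \<Longrightarrow> 0 \<le> q u"
    and par: "u \<in> V \<Longrightarrow> v \<in> V \<Longrightarrow>
      q (\<lambda>x. u x + v x) + q (\<lambda>x. u x - v x) = 2 * q u + 2 * q v"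
    and hom: "u \<in> V \<Longrightarrow> q (\<lambda>x. c * u x) = c\<^sup>2 * q u"
begin

lemma q_zero: "q (\<lambda>x. 0) = 0"
  using hom[of "\<lambda>x. 0" 0] zero_mem by simp

lemma q_minus: "u \<in> V \<Longrightarrow> q (\<lambda>x. - u x) = q u"
  using hom[of u "-1"] by simp

lemma q_diff_commute: "u \<in> V \<Longrightarrow> v \<in> V \<Longrightarrow> q (\<lambda>x. u x - v x) = q (\<lambda>x. v x - u x)"
  using q_minus[OF diff_mem[of u v]] by simp

text \<open>Four instances of the parallelogram law eliminate the terms with a minus sign. Expanded
  with \<open>q_add\<close>, this identity is additivity of the polarisation.\<close>

lemma q_three:
  assumes "x \<in> V" "y \<in> V" "z \<in> V"
  shows "q (\<lambda>t. x t + y t + z t) = q (\<lambda>t. x t + y t) + q (\<lambda>t. y t + z t) + q (\<lambda>t. x t + z t)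
    - q x - q y - q z"
proof -
  have 1: "q (\<lambda>t. x t + y t + z t) + q (\<lambda>t. x t + z t - y t) = 2 * q (\<lambda>t. x t + z t) + 2 * q y"
    using par[OF add_mem[OF assms(1,3)] assms(2)] by (simp add: algebra_simps)
  have 2: "q (\<lambda>t. x t + z t - y t) + q (\<lambda>t. x t + y t - z t) = 2 * q x + 2 * q (\<lambda>t. z t - y t)"
    using par[OF assms(1) diff_mem[OF assms(3,2)]] by (simp add: algebra_simps)
  have 3: "q (\<lambda>t. x t + y t + z t) + q (\<lambda>t. x t + y t - z t) = 2 * q (\<lambda>t. x t + y t) + 2 * q z"
    using par[OF add_mem[OF assms(1,2)] assms(3)] by (simp add: algebra_simps)
  have 4: "q (\<lambda>t. y t + z t) + q (\<lambda>t. z t - y t) = 2 * q y + 2 * q z"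
    using par[OF assms(2,3)] q_diff_commute[OF assms(2,3)] by simp
  show ?thesis using 1 2 3 4 by linarith
qed

lemma q_add: "u \<in> V \<Longrightarrow> v \<in> V \<Longrightarrow> q (\<lambda>x. u x + v x) = q u + 2 * polar q u v + q v"
  using par[of u v] by (simp add: polar_def field_simps)

lemma polar_commute: "u \<in> V \<Longrightarrow> v \<in> V \<Longrightarrow> polar q u v = polar q v u"
  using q_diff_commute[of u v] by (simp add: polar_def add.commute)

lemma polar_self: "u \<in> V \<Longrightarrow> polar q u u = q u"
  using hom[of u 2] q_zero by (simp add: polar_def)

lemma polar_add:
  assumes "u \<in> V" "v \<in> V" "w \<in> V"
  shows "polar q (\<lambda>x. u x + v x) w = polar q u w + polar q v w"
  using q_three[OF assms] q_add[OF add_mem[OF assms(1,2)] assms(3)] q_add[OF assms(1,2)]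
    q_add[OF assms(1,3)] q_add[OF assms(2,3)] by simp

text \<open>Real homogeneity: an additive function of c that is bounded on bounded sets is linear.\<close>

lemma polar_scale:
  assumes u: "u \<in> V" and v: "v \<in> V"
  shows "polar q (\<lambda>x. c * u x) v = c * polar q u v"
proof -
  define f where "f = (\<lambda>c. polar q (\<lambda>x. c * u x) v)"
  have fadd: "f (a + b) = f a + f b" for a b
    using polar_add[OF scale_mem[OF u] scale_mem[OF u] v, of a b]
    by (simp add: f_def algebra_simps)
  have f0: "f 0 = 0" using fadd[of 0 0] by simp
  have fneg: "f (- a) = - f a" for a using fadd[of a "- a"] f0 by simp
  \<comment> \<open>Nonnegativity of \<open>q\<close> at c u + v; replacing c by - c gives the
    two-sided bound.\<close>
  have lower: "- (c\<^sup>2 * q u + q v) \<le> 2 * f c" for c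
    using q_add[OF scale_mem[OF u] v, of c] hom[OF u, of c] nonneg[OF add_mem[OF scale_mem[OF u] v], of c]
    by (simp add: f_def)
  have bd: "\<bar>f c\<bar> \<le> (c\<^sup>2 * q u + q v)" for c
    using lower[of c] lower[of "- c"] nonneg[OF u] nonneg[OF v] mult_nonneg_nonneg[of "c\<^sup>2" "q u"]
    by (simp add: fneg)
  \<comment> \<open>\<open>g\<close> is the defect from linearity. It is additive and vanishes on
    the integers, hence has period 1 and is bounded by its values on [0, 1]; a nonzero value would
    have unbounded multiples.\<close>
  define g where "g = (\<lambda>c. f c - c * f 1)"
  have gadd: "g (a + b) = g a + g b" for a b by (simp add: g_def fadd algebra_simps)
  have g1: "g 1 = 0" and g0: "g 0 = 0" by (simp_all add: g_def f0)
  have gnat: "g (real n * a) = real n * g a" for n a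
    by (induction n) (simp_all add: g0 gadd algebra_simps)
  have gneg: "g (- a) = - g a" for a by (simp add: g_def fneg)
  have gint: "g (of_int k) = 0" for k
    using gnat[of "nat k" 1] gnat[of "nat (- k)" 1] gneg[of "of_int k"] g1
    by (cases "k \<ge> 0") auto
  define M where "M = q u + q v + \<bar>f 1\<bar>"
  have gfrac: "\<bar>g a\<bar> \<le> M" for a
  proof -
    have "g a = g (frac a)"
      using gadd[of "frac a" "of_int \<lfloor>a\<rfloor>"] gint by (simp add: frac_def)
    also have "\<bar>\<dots>\<bar> \<le> \<bar>f (frac a)\<bar> + frac a * \<bar>f 1\<bar>"
      unfolding g_def using abs_triangle_ineq4[of "f (frac a)" "frac a * f 1"] by (simp add: abs_mult)
    also have "\<dots> \<le> M"
    proof -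
      have f01: "0 \<le> frac a" "frac a \<le> 1" by (simp_all add: frac_lt_1 less_imp_le)
      have "(frac a)\<^sup>2 \<le> 1" using f01 by (simp add: power_le_one)
      then have "(frac a)\<^sup>2 * q u \<le> 1 * q u" using nonneg[OF u] by (rule mult_right_mono)
      moreover have "frac a * \<bar>f 1\<bar> \<le> 1 * \<bar>f 1\<bar>" using f01 by (intro mult_right_mono) auto
      ultimately show ?thesis using bd[of "frac a"] by (simp add: M_def)
    qed
    finally show ?thesis .
  qed
  have "g c = 0"
  proof (rule ccontr)
    assume "g c \<noteq> 0"
    then obtain n :: nat where n: "M < real n * \<bar>g c\<bar>"
      using ex_less_of_nat_mult[of "\<bar>g c\<bar>" M] by auto
    with gfrac[of "real n * c"] show False by (simp add: gnat abs_mult)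
  qed
  then show ?thesis by (simp add: g_def f_def)
qed

lemma polar_scale_right:
  assumes "u \<in> V" "v \<in> V"
  shows "polar q v (\<lambda>x. c * u x) = c * polar q v u"
  using polar_scale[OF assms] polar_commute scale_mem assms by metis

lemma cauchy_schwarz:
  assumes u: "u \<in> V" and v: "v \<in> V"
  shows "\<bar>polar q u v\<bar> \<le> sqrt (q u) * sqrt (q v)"
proof -
  let ?b = "polar q u v"
  have pos: "0 \<le> q u + 2 * t * ?b + t\<^sup>2 * q v" for t
    using nonneg[OF add_mem[OF u scale_mem[OF v]], of t] q_add[OF u scale_mem[OF v], of t]
      hom[OF v, of t] polar_scale_right[OF v u, of t] by simp
  have "?b\<^sup>2 \<le> q u * q v"
  proof (cases "q v = 0")
    case True
    have "?b = 0"
    proof (rule ccontr)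
      assume "?b \<noteq> 0"
      \<comment> \<open>With this t the term 2 t b equals - (q u + 1), so the nonnegative expression
        becomes -1.\<close>
      then show False using pos[of "- (q u + 1) / (2 * ?b)"] True by (simp add: field_simps)
    qed
    then show ?thesis using True by simp
  next
    case False
    then have "0 < q v" using nonneg[OF v] by simp
    then show ?thesis using pos[of "- ?b / q v"]
      by (simp add: field_simps power2_eq_square)
  qed
  then have "sqrt (?b\<^sup>2) \<le> sqrt (q u * q v)" by (rule real_sqrt_le_mono)
  then show ?thesis by (simp add: real_sqrt_mult)
qed

lemma triangle:
  assumes u: "u \<in> V" and v: "v \<in> V"
  shows "sqrt (q (\<lambda>x. u x + v x)) \<le> sqrt (q u) + sqrt (q v)"
proof (rule real_le_lsqrt)
  show "0 \<le> sqrt (q u) + sqrt (q v)" using nonneg u v by simp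
  have "q (\<lambda>x. u x + v x) \<le> q u + 2 * (sqrt (q u) * sqrt (q v)) + q v"
    using q_add[OF u v] cauchy_schwarz[OF u v] by simp
  also have "\<dots> = (sqrt (q u) + sqrt (q v))\<^sup>2"
    using nonneg u v by (simp add: power2_sum)
  finally show "q (\<lambda>x. u x + v x) \<le> (sqrt (q u) + sqrt (q v))\<^sup>2" .
qed

lemma triangle_diff:
  assumes u: "u \<in> V" and v: "v \<in> V"
  shows "sqrt (q (\<lambda>x. u x - v x)) \<le> sqrt (q u) + sqrt (q v)"
  using triangle[OF u minus_mem[OF v]] q_minus[OF v] by simp

lemma triangle_sub:
  assumes u: "u \<in> V" and v: "v \<in> V"
  shows "sqrt (q u) \<le> sqrt (q v) + sqrt (q (\<lambda>x. u x - v x))"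
  using triangle[OF v diff_mem[OF u v]] by simp

lemma sqrt_scale: "u \<in> V \<Longrightarrow> sqrt (q (\<lambda>x. c * u x)) = \<bar>c\<bar> * sqrt (q u)"
  by (simp add: hom real_sqrt_mult)

lemma q_add_le: "u \<in> V \<Longrightarrow> v \<in> V \<Longrightarrow> q (\<lambda>x. u x + v x) \<le> 2 * q u + 2 * q v"
  using par[of u v] nonneg[OF diff_mem, of u v] by linarith

lemma q_diff_le: "u \<in> V \<Longrightarrow> v \<in> V \<Longrightarrow> q (\<lambda>x. u x - v x) \<le> 2 * q u + 2 * q v"
  using par[of u v] nonneg[OF add_mem, of u v] by linarith

lemma q_midpoint_le:
  assumes "u \<in> V" "v \<in> V"
  shows "2 * q (\<lambda>x. (u x + v x) / 2) \<le> q u + q v"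
  using hom[OF add_mem[OF assms], of "1/2"] q_add_le[OF assms]
  by (simp add: power2_eq_square field_simps)

lemma q_cong_null:
  assumes "u \<in> V" "v \<in> V" "q (\<lambda>x. u x - v x) = 0"
  shows "q u = q v"
  using triangle_sub[OF assms(1,2)] triangle_sub[OF assms(2,1)] assms(3)
    q_diff_commute[OF assms(1,2)] by simp

end

lemma quad_form_add:
  assumes "quad_form V q" "quad_form V r"
  shows "quad_form V (\<lambda>u. q u + r u)"
proof -
  interpret q: quad_form V q by fact
  interpret r: quad_form V r by fact
  show ?thesis
  proof
    fix u v :: "'a \<Rightarrow> real" and c :: real
    assume u: "u \<in> V"
    show "0 \<le> q u + r u" using q.nonneg[OF u] r.nonneg[OF u] by simp
    show "q (\<lambda>x. c * u x) + r (\<lambda>x. c * u x) = c\<^sup>2 * (q u + r u)"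
      by (simp add: q.hom[OF u] r.hom[OF u] algebra_simps)
    assume v: "v \<in> V"
    show "q (\<lambda>x. u x + v x) + r (\<lambda>x. u x + v x) + (q (\<lambda>x. u x - v x) + r (\<lambda>x. u x - v x))
      = 2 * (q u + r u) + 2 * (q v + r v)"
      using q.par[OF u v] r.par[OF u v] by simp
  qed
qed

lemma quad_form_mono:
  assumes "quad_form V q" "fun_space W" "W \<subseteq> V"
  shows "quad_form W q"
proof -
  interpret q: quad_form V q by fact
  interpret W: fun_space W by fact
  show ?thesis
  proof
    fix u v :: "'a \<Rightarrow> real" and c :: real
    assume "u \<in> W"
    then have u: "u \<in> V" using assms(3) by auto
    show "0 \<le> q u" "q (\<lambda>x. c * u x) = c\<^sup>2 * q u" using q.nonneg[OF u] q.hom[OF u] by auto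
    assume "v \<in> W"
    then show "q (\<lambda>x. u x + v x) + q (\<lambda>x. u x - v x) = 2 * q u + 2 * q v"
      using q.par[OF u] assms(3) by auto
  qed
qed

section \<open>Square-integrable functions\<close>

lemma L2_measurable: "L2 m u \<Longrightarrow> u \<in> borel_measurable m"
  and L2_integrable: "L2 m u \<Longrightarrow> integrable m (\<lambda>x. (u x)\<^sup>2)"
  by (auto simp: L2_def)

lemma L2_dominated:
  assumes "L2 m v" "u \<in> borel_measurable m" "AE x in m. \<bar>u x\<bar> \<le> \<bar>v x\<bar>"
  shows "L2 m u"
  unfolding L2_def
proof
  show "integrable m (\<lambda>x. (u x)\<^sup>2)"
    by (rule Bochner_Integration.integrable_bound[OF L2_integrable[OF assms(1)]])
       (use assms in \<open>auto simp: abs_le_square_iff elim!: eventually_mono\<close>)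
qed fact

lemma L2_add: assumes "L2 m u" "L2 m v" shows "L2 m (\<lambda>x. u x + v x)"
  unfolding L2_def
proof
  show "integrable m (\<lambda>x. (u x + v x)\<^sup>2)"
  proof (rule Bochner_Integration.integrable_bound)
    show "integrable m (\<lambda>x. 2 * (u x)\<^sup>2 + 2 * (v x)\<^sup>2)"
      using assms by (simp add: L2_def)
    have "(a + b)\<^sup>2 \<le> 2 * a\<^sup>2 + 2 * b\<^sup>2" for a b :: real
      using zero_le_power2[of "a - b"] by (simp add: power2_sum power2_diff)
    then show "AE x in m. norm ((u x + v x)\<^sup>2) \<le> norm (2 * (u x)\<^sup>2 + 2 * (v x)\<^sup>2)"
      by simp
  qed (use assms in \<open>auto simp: L2_def\<close>)
qed (use assms in \<open>auto simp: L2_def\<close>)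

interpretation L2: quad_form "{u. L2 m u}" "\<lambda>u. \<integral>x. (u x)\<^sup>2 \<partial>m" for m :: "'a measure"
proof
  fix u v :: "'a \<Rightarrow> real" and c :: real
  show "(\<lambda>x. 0) \<in> {u. L2 m u}" by (simp add: L2_def)
  assume u: "u \<in> {u. L2 m u}"
  then show "(\<lambda>x. c * u x) \<in> {u. L2 m u}" by (auto simp: L2_def power_mult_distrib)
  show "0 \<le> (\<integral>x. (u x)\<^sup>2 \<partial>m)" by simp
  show "(\<integral>x. (c * u x)\<^sup>2 \<partial>m) = c\<^sup>2 * (\<integral>x. (u x)\<^sup>2 \<partial>m)" by (simp add: power_mult_distrib)
  assume v: "v \<in> {u. L2 m u}"
  show uv: "(\<lambda>x. u x + v x) \<in> {u. L2 m u}" using u v L2_add by auto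
  have "L2 m (\<lambda>x. - v x)" using v by (simp add: L2_def)
  then have uv': "L2 m (\<lambda>x. u x - v x)" using L2_add[of m u "\<lambda>x. - v x"] u by simp
  have "(\<integral>x. (u x + v x)\<^sup>2 \<partial>m) + (\<integral>x. (u x - v x)\<^sup>2 \<partial>m) = (\<integral>x. (u x + v x)\<^sup>2 + (u x - v x)\<^sup>2 \<partial>m)"
    using uv uv' by (simp add: L2_def)
  also have "\<dots> = (\<integral>x. 2 * (u x)\<^sup>2 + 2 * (v x)\<^sup>2 \<partial>m)"
    by (rule Bochner_Integration.integral_cong) (auto simp: power2_sum power2_diff)
  also have "\<dots> = 2 * (\<integral>x. (u x)\<^sup>2 \<partial>m) + 2 * (\<integral>x. (v x)\<^sup>2 \<partial>m)"
    using u v by (simp add: L2_def)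
  finally show "(\<integral>x. (u x + v x)\<^sup>2 \<partial>m) + (\<integral>x. (u x - v x)\<^sup>2 \<partial>m)
    = 2 * (\<integral>x. (u x)\<^sup>2 \<partial>m) + 2 * (\<integral>x. (v x)\<^sup>2 \<partial>m)" .
qed

lemma L2_diff: "L2 m u \<Longrightarrow> L2 m v \<Longrightarrow> L2 m (\<lambda>x. u x - v x)"
  using L2.diff_mem by auto

lemma L2_eq_zero_AE:
  assumes "L2 m u" "(\<integral>x. (u x)\<^sup>2 \<partial>m) \<le> 0"
  shows "AE x in m. u x = 0"
proof -
  have "(\<integral>x. (u x)\<^sup>2 \<partial>m) = 0" using assms(2) by (simp add: antisym)
  then have "AE x in m. (u x)\<^sup>2 = 0"
    using integral_nonneg_eq_0_iff_AE[OF L2_integrable[OF assms(1)]] by simp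
  then show ?thesis by simp
qed

lemma L2_prod_integrable: "L2 m u \<Longrightarrow> L2 m v \<Longrightarrow> integrable m (\<lambda>x. u x * v x)"
proof -
  assume u: "L2 m u" and v: "L2 m v"
  have "integrable m (\<lambda>x. ((u x + v x)\<^sup>2 - (u x - v x)\<^sup>2) / 4)"
    using L2_add[OF u v] L2_diff[OF u v] by (simp add: L2_def)
  moreover have "((a + b)\<^sup>2 - (a - b)\<^sup>2) / 4 = a * b" for a b :: real
    by (simp add: power2_sum power2_diff)
  ultimately show ?thesis by simp
qed

lemma polar_L2:
  assumes u: "L2 m u" and v: "L2 m v"
  shows "polar (\<lambda>u. \<integral>x. (u x)\<^sup>2 \<partial>m) u v = (\<integral>x. u x * v x \<partial>m)"
proof -
  have "((a + b)\<^sup>2 - (a - b)\<^sup>2) / 4 = a * b" for a b :: real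
    by (simp add: power2_sum power2_diff)
  then have "(\<integral>x. u x * v x \<partial>m) = (\<integral>x. ((u x + v x)\<^sup>2 - (u x - v x)\<^sup>2) / 4 \<partial>m)" by simp
  also have "\<dots> = polar (\<lambda>u. \<integral>x. (u x)\<^sup>2 \<partial>m) u v"
    using L2_add[OF u v] L2_diff[OF u v] by (simp add: L2_def polar_def)
  finally show ?thesis ..
qed

lemma L2_holder:
  assumes u: "L2 m u" and v: "L2 m v"
  shows "\<bar>\<integral>x. u x * v x \<partial>m\<bar> \<le> sqrt (\<integral>x. (u x)\<^sup>2 \<partial>m) * sqrt (\<integral>x. (v x)\<^sup>2 \<partial>m)"
  using L2.cauchy_schwarz[of u m v] polar_L2[OF u v] u v by simp

lemma L2_dominated_convergence:
  assumes w: "L2 m w" and meas: "\<And>n. us n \<in> borel_measurable m" "u \<in> borel_measurable m"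
    and bd: "\<And>n. AE x in m. \<bar>us n x\<bar> \<le> w x" "AE x in m. \<bar>u x\<bar> \<le> w x"
    and lim: "AE x in m. (\<lambda>n. us n x) \<longlonglongrightarrow> u x"
  shows "(\<lambda>n. \<integral>x. (us n x - u x)\<^sup>2 \<partial>m) \<longlonglongrightarrow> 0"
proof -
  have "(\<lambda>n. \<integral>x. (us n x - u x)\<^sup>2 \<partial>m) \<longlonglongrightarrow> (\<integral>x. 0 \<partial>m)"
  proof (rule integral_dominated_convergence)
    show "integrable m (\<lambda>x. 4 * (w x)\<^sup>2)" using w by (simp add: L2_def)
    show "AE x in m. (\<lambda>n. (us n x - u x)\<^sup>2) \<longlonglongrightarrow> 0"
      using lim
    proof eventually_elim
      case (elim x)
      then have "(\<lambda>n. (us n x - u x)\<^sup>2) \<longlonglongrightarrow> (u x - u x)\<^sup>2" by (intro tendsto_intros)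
      then show ?case by simp
    qed
    fix n
    show "AE x in m. norm ((us n x - u x)\<^sup>2) \<le> 4 * (w x)\<^sup>2"
      using bd(1)[of n] bd(2)
    proof eventually_elim
      case (elim x)
      then have "\<bar>us n x - u x\<bar> \<le> \<bar>2 * w x\<bar>" by linarith
      then have "(us n x - u x)\<^sup>2 \<le> (2 * w x)\<^sup>2" by (simp only: abs_le_square_iff)
      then show ?case by (simp add: power_mult_distrib)
    qed
  qed (use meas in auto)
  then show ?thesis by simp
qed

section \<open>Weak lower semicontinuity\<close>

text \<open>Dyadic convex combinations of the tail from index n on. Midpoints stand in for general
  convex combinations because they are what the parallelogram law and \<open>q_midpoint_le\<close>
  speak about.\<close>

inductive_set mid_hull :: "(nat \<Rightarrow> 'a \<Rightarrow> real) \<Rightarrow> nat \<Rightarrow> ('a \<Rightarrow> real) set"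
  for us :: "nat \<Rightarrow> 'a \<Rightarrow> real" and n :: nat where
  base: "n \<le> k \<Longrightarrow> us k \<in> mid_hull us n"
| mid: "u \<in> mid_hull us n \<Longrightarrow> v \<in> mid_hull us n \<Longrightarrow> (\<lambda>x. (u x + v x) / 2) \<in> mid_hull us n"

lemma mid_hull_antimono:
  assumes "n \<le> k" "u \<in> mid_hull us k"
  shows "u \<in> mid_hull us n"
  using assms(2,1) by induction (auto intro: mid_hull.intros)

section \<open>Dirichlet forms as complete quadratic forms\<close>

locale dform =
  fixes m :: "'a measure" and Q :: "('a \<Rightarrow> real) \<Rightarrow> ('a \<Rightarrow> real) \<Rightarrow> real" and D :: "('a \<Rightarrow> real) set"
  assumes dform: "dirichlet_form m Q D"
begin

lemma
  shows D_subset: "D \<subseteq> {u. L2 m u}"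
    and D_zero: "(\<lambda>x. 0) \<in> D"
    and D_add: "\<forall>u\<in>D. \<forall>v\<in>D. (\<lambda>x. u x + v x) \<in> D"
    and D_scale: "\<forall>u\<in>D. \<forall>c. (\<lambda>x. c * u x) \<in> D"
    and Q_sym_all: "\<forall>u\<in>D. \<forall>v\<in>D. Q u v = Q v u"
    and Q_add_all: "\<forall>u\<in>D. \<forall>v\<in>D. \<forall>w\<in>D. Q (\<lambda>x. u x + v x) w = Q u w + Q v w"
    and Q_scale_all: "\<forall>u\<in>D. \<forall>v\<in>D. \<forall>c. Q (\<lambda>x. c * u x) v = c * Q u v"
    and Q_nonneg_all: "\<forall>u\<in>D. Q u u \<ge> 0"
    and D_AE_all: "\<forall>u\<in>D. \<forall>v. v \<in> borel_measurable m \<and> (AE x in m. u x = v x) \<longrightarrow>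
        v \<in> D \<and> (\<forall>w\<in>D. Q u w = Q v w)"
    and D_complete_all: "\<forall>us. (\<forall>n. us n \<in> D) \<and>
           (\<forall>e>0. \<exists>N. \<forall>n\<ge>N. \<forall>k\<ge>N. Q1 m Q (\<lambda>x. us n x - us k x) < e) \<longrightarrow>
           (\<exists>u\<in>D. (\<lambda>n. Q1 m Q (\<lambda>x. us n x - u x)) \<longlonglongrightarrow> 0)"
    and Q_unit_contraction_all: "\<forall>u\<in>D. (\<lambda>x. min 1 (max 0 (u x))) \<in> D \<and>
        Q (\<lambda>x. min 1 (max 0 (u x))) (\<lambda>x. min 1 (max 0 (u x))) \<le> Q u u"
  using dform unfolding dirichlet_form_def by - (elim conjE, assumption)+

lemma D_L2: "u \<in> D \<Longrightarrow> L2 m u"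
  using D_subset by auto

lemma D_meas: "u \<in> D \<Longrightarrow> u \<in> borel_measurable m"
  by (rule L2_measurable[OF D_L2])

lemma D_AE: "u \<in> D \<Longrightarrow> v \<in> borel_measurable m \<Longrightarrow> AE x in m. u x = v x \<Longrightarrow> v \<in> D"
  using D_AE_all by blast

lemma Q_AE:
  "u \<in> D \<Longrightarrow> v \<in> borel_measurable m \<Longrightarrow> AE x in m. u x = v x \<Longrightarrow> w \<in> D \<Longrightarrow> Q u w = Q v w"
  using D_AE_all by blast

lemma Q_sym: "u \<in> D \<Longrightarrow> v \<in> D \<Longrightarrow> Q u v = Q v u"
  using Q_sym_all by blast

lemma Q_AE_self:
  assumes u: "u \<in> D" and v: "v \<in> borel_measurable m" and ae: "AE x in m. u x = v x"
  shows "Q u u = Q v v"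
proof -
  have vD: "v \<in> D" by (rule D_AE[OF u v ae])
  have "Q u u = Q v u" by (rule Q_AE[OF u v ae u])
  also have "\<dots> = Q u v" by (rule Q_sym[OF vD u])
  also have "\<dots> = Q v v" by (rule Q_AE[OF u v ae vD])
  finally show ?thesis .
qed

lemma Q_add: "u \<in> D \<Longrightarrow> v \<in> D \<Longrightarrow> w \<in> D \<Longrightarrow> Q (\<lambda>x. u x + v x) w = Q u w + Q v w"
  using Q_add_all by blast

lemma Q_scale: "u \<in> D \<Longrightarrow> v \<in> D \<Longrightarrow> Q (\<lambda>x. c * u x) v = c * Q u v"
  using Q_scale_all by blast

lemma Q_unit_contraction:
  assumes "u \<in> D"
  shows "(\<lambda>x. min 1 (max 0 (u x))) \<in> D"
    "Q (\<lambda>x. min 1 (max 0 (u x))) (\<lambda>x. min 1 (max 0 (u x))) \<le> Q u u"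
  using Q_unit_contraction_all assms by blast+

lemma D_complete:
  assumes "\<And>n. us n \<in> D"
    and "\<And>e. e > 0 \<Longrightarrow> \<exists>N. \<forall>n\<ge>N. \<forall>k\<ge>N. Q1 m Q (\<lambda>x. us n x - us k x) < e"
  obtains u where "u \<in> D" "(\<lambda>n. Q1 m Q (\<lambda>x. us n x - u x)) \<longlonglongrightarrow> 0"
  using D_complete_all[THEN spec, of us] assms by blast

sublocale fun_space D
  by unfold_locales (use D_zero D_add D_scale in auto)

sublocale Q: quad_form D "\<lambda>u. Q u u"
proof
  fix u v :: "'a \<Rightarrow> real" and c :: real
  assume u: "u \<in> D"
  show "0 \<le> Q u u" using Q_nonneg_all u by blast
  show "Q (\<lambda>x. c * u x) (\<lambda>x. c * u x) = c\<^sup>2 * Q u u"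
    using Q_scale[OF u scale_mem[OF u], of c c] Q_scale[OF u u, of c] Q_sym[OF u scale_mem[OF u], of c]
    by (simp add: power2_eq_square)
  assume v: "v \<in> D"
  have ad: "Q (\<lambda>x. a x + b x) (\<lambda>x. a x + b x) = Q a a + 2 * Q a b + Q b b" if "a \<in> D" "b \<in> D" for a b
    using Q_add[OF that add_mem[OF that]] Q_sym[OF that(1) add_mem[OF that]]
      Q_sym[OF that(2) add_mem[OF that]] Q_add[OF that that(1)]
      Q_add[OF that that(2)] Q_sym[OF that] by linarith
  have "Q u (\<lambda>x. - v x) = - Q u v"
    using Q_scale[OF v u, of "-1"] Q_sym[OF u v] Q_sym[OF u minus_mem[OF v]] by simp
  moreover have "Q (\<lambda>x. - v x) (\<lambda>x. - v x) = Q v v"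
    using Q_scale[OF v minus_mem[OF v], of "-1"] Q_scale[OF v v, of "-1"] Q_sym[OF v minus_mem[OF v]] by simp
  ultimately show "Q (\<lambda>x. u x + v x) (\<lambda>x. u x + v x) + Q (\<lambda>x. u x - v x) (\<lambda>x. u x - v x)
      = 2 * Q u u + 2 * Q v v"
    using ad[OF u v] ad[OF u minus_mem[OF v]] by simp
qed

lemma polar_Q:
  assumes u: "u \<in> D" and v: "v \<in> D"
  shows "polar (\<lambda>u. Q u u) u v = Q u v"
  using Q.q_add[OF u v] Q_add[OF u v add_mem[OF u v]] Q_add[OF u v u] Q_add[OF u v v]
    Q_sym[OF u add_mem[OF u v]] Q_sym[OF v add_mem[OF u v]] Q_sym[OF u v] by linarith

sublocale L2D: quad_form D "\<lambda>u. \<integral>x. (u x)\<^sup>2 \<partial>m"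
  by (rule quad_form_mono[OF L2.quad_form_axioms]) (use fun_space_axioms D_L2 in auto)

sublocale Q1: quad_form D "Q1 m Q"
proof -
  have "Q1 m Q = (\<lambda>u. Q u u + (\<integral>x. (u x)\<^sup>2 \<partial>m))" by (auto simp: Q1_def)
  then show "quad_form D (Q1 m Q)"
    using quad_form_add[OF Q.quad_form_axioms L2D.quad_form_axioms] by simp
qed

lemma Q_le_Q1: "Q u u \<le> Q1 m Q u"
  by (simp add: Q1_def)

lemma L2_le_Q1: "u \<in> D \<Longrightarrow> (\<integral>x. (u x)\<^sup>2 \<partial>m) \<le> Q1 m Q u"
  using Q.nonneg by (simp add: Q1_def)

text \<open>Balls around \<open>u\<close> in L2 are closed under midpoints, so once a tail lies in
  such a ball its whole hull does. This identifies the limit found in \<open>weak_lsc\<close> with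
  \<open>u\<close>.\<close>

lemma L2_dist_mid_hull:
  assumes us: "\<And>k. us k \<in> D" and u: "L2 m u"
    and "\<And>k. n \<le> k \<Longrightarrow> (\<integral>x. (us k x - u x)\<^sup>2 \<partial>m) \<le> e" and "x \<in> mid_hull us n"
  shows "x \<in> D \<and> (\<integral>t. (x t - u t)\<^sup>2 \<partial>m) \<le> e"
  using assms(4)
proof induction
  case (mid x y)
  then have "L2 m x" "L2 m y" using D_L2 by auto
  then have "2 * (\<integral>t. (((x t - u t) + (y t - u t)) / 2)\<^sup>2 \<partial>m)
      \<le> (\<integral>t. (x t - u t)\<^sup>2 \<partial>m) + (\<integral>t. (y t - u t)\<^sup>2 \<partial>m)"
    using L2.q_midpoint_le[of "\<lambda>t. x t - u t" m "\<lambda>t. y t - u t"] u by (auto intro!: L2_diff)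
  moreover have "(x t - u t + (y t - u t)) / 2 = (x t + y t) / 2 - u t" for t
    by (simp add: field_simps)
  ultimately have "2 * (\<integral>t. ((x t + y t) / 2 - u t)\<^sup>2 \<partial>m)
      \<le> (\<integral>t. (x t - u t)\<^sup>2 \<partial>m) + (\<integral>t. (y t - u t)\<^sup>2 \<partial>m)"
    by (simp only:)
  then show ?case using mid by (auto intro: divide_mem add_mem)
qed (use us assms(3) in auto)

text \<open>Near-minimisers of the norm over the midpoint hulls of the tails form a Cauchy sequence
  (Mazur's lemma), so quadratic forms dominated by the norm are weakly lower semicontinuous.\<close>

lemma weak_lsc:
  assumes q: "quad_form D q" and q_le: "\<And>v. v \<in> D \<Longrightarrow> q v \<le> Q1 m Q v"
    and us: "\<And>k. us k \<in> D" and bd: "\<And>k. Q (us k) (us k) \<le> C"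
    and u: "L2 m u" and lim: "(\<lambda>k. \<integral>x. (us k x - u x)\<^sup>2 \<partial>m) \<longlonglongrightarrow> 0"
    and qB: "\<And>k. q (us k) \<le> B"
  shows "u \<in> D" "q u \<le> B"
proof -
  interpret q: quad_form D q by fact
  obtain C' where C': "\<And>k. (\<integral>x. (us k x - u x)\<^sup>2 \<partial>m) \<le> C'"
    using convergent_imp_Bseq[OF convergentI[OF lim]] by (force simp: Bseq_def)
  define C1 where "C1 = C + (2 * C' + 2 * (\<integral>x. (u x)\<^sup>2 \<partial>m))"
  have bd1: "Q1 m Q (us k) \<le> C1" for k
    using L2.q_add_le[of "\<lambda>x. us k x - u x" m u] L2_diff[OF D_L2[OF us] u] u bd[of k] C'[of k]
    by (auto simp: Q1_def C1_def)
  have hD: "x \<in> D" if "x \<in> mid_hull us n" for x n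
    using that by induction (auto intro: us divide_mem add_mem)
  define r where "r n = 1 / real (Suc n)" for n
  \<comment> \<open>The hulls shrink as n grows, so \<open>d\<close> is nondecreasing; it is bounded
    because the energies and the L2 norms of the sequence are.\<close>
  define d where "d n = Inf (Q1 m Q ` mid_hull us n)" for n
  have bb: "bdd_below (Q1 m Q ` mid_hull us n)" for n
    using hD Q1.nonneg by (auto intro!: bdd_belowI[of _ 0])
  have d_le: "d n \<le> Q1 m Q x" if "x \<in> mid_hull us n" for x n
    unfolding d_def by (rule cInf_lower) (use that bb in auto)
  have "d n \<le> d k" if "n \<le> k" for n k
    unfolding d_def
  proof (rule cInf_superset_mono)
    show "Q1 m Q ` mid_hull us k \<noteq> {}" using mid_hull.base[of k k us] by auto
    show "Q1 m Q ` mid_hull us k \<subseteq> Q1 m Q ` mid_hull us n" using mid_hull_antimono[OF that] by auto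
  qed (rule bb)
  then have inc: "incseq d" by (auto simp: incseq_def)
  have "d n \<le> C1" for n using d_le[OF mid_hull.base[of n n us]] bd1[of n] by simp
  then obtain l where "d \<longlonglongrightarrow> l" using incseq_convergent[OF inc] by blast
  then have dC: "Cauchy d" by (rule LIMSEQ_imp_Cauchy)
  have "\<exists>x\<in>mid_hull us n. Q1 m Q x < d n + r n" for n
  proof -
    have "d n < d n + r n" by (simp add: r_def)
    then show ?thesis unfolding d_def
      using cInf_lessD[of "Q1 m Q ` mid_hull us n"] mid_hull.base[of n n us] by blast
  qed
  then obtain xs where xs: "\<And>n. xs n \<in> mid_hull us n" "\<And>n. Q1 m Q (xs n) < d n + r n"
    by metis
  have xD: "xs n \<in> D" for n using hD xs(1) by blast
  \<comment> \<open>For n \<le> k the midpoint of the two near-minimisers lies in the hull of the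
    earlier tail, so its value under \<open>Q1\<close> is at least \<open>d n\<close>; the
    parallelogram law turns this into a bound for the difference.\<close>
  have close: "Q1 m Q (\<lambda>x. xs n x - xs k x) \<le> 2 * d k - 2 * d n + 4 * r n" if "n \<le> k" for n k
  proof -
    have "4 * d n \<le> 4 * Q1 m Q (\<lambda>x. (xs n x + xs k x) / 2)"
      using d_le[OF mid_hull.mid[OF xs(1) mid_hull_antimono[OF that xs(1)]]] by simp
    also have "\<dots> = Q1 m Q (\<lambda>x. xs n x + xs k x)"
      using Q1.hom[OF add_mem[OF xD[of n] xD[of k]], of "1/2"] by (simp add: power2_eq_square)
    finally have *: "4 * d n \<le> Q1 m Q (\<lambda>x. xs n x + xs k x)" .
    have **: "r k \<le> r n" using that by (simp add: r_def field_simps)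
    show ?thesis
      using Q1.par[OF xD[of n] xD[of k]] * ** xs(2)[of n] xs(2)[of k] by linarith
  qed
  have cau: "\<exists>N. \<forall>n\<ge>N. \<forall>k\<ge>N. Q1 m Q (\<lambda>x. xs n x - xs k x) < e" if "e > 0" for e
  proof -
    obtain N1 where N1: "\<And>n k. n \<ge> N1 \<Longrightarrow> k \<ge> N1 \<Longrightarrow> \<bar>d n - d k\<bar> < e / 4"
      using CauchyD[OF dC, of "e/4"] \<open>e > 0\<close> by auto
    obtain N2 :: nat where N2: "8 / e < real N2" using reals_Archimedean2 by blast
    have le: "Q1 m Q (\<lambda>x. xs n x - xs k x) < e" if "n \<le> k" "n \<ge> max N1 N2" for n k
    proof -
      have "8 / e < real (Suc n)" using N2 that by simp
      then have "4 * r n < e / 2" using \<open>e > 0\<close> by (simp add: r_def field_simps)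
      moreover have "\<bar>d n - d k\<bar> < e / 4" using N1 that by simp
      ultimately show ?thesis using close[OF that(1)] by linarith
    qed
    show ?thesis
    proof (intro exI[of _ "max N1 N2"] allI impI)
      fix n k assume nk: "max N1 N2 \<le> n" "max N1 N2 \<le> k"
      show "Q1 m Q (\<lambda>x. xs n x - xs k x) < e"
        using le[of n k] le[of k n] nk Q1.q_diff_commute[OF xD[of n] xD[of k]]
        by (cases "n \<le> k") auto
    qed
  qed
  obtain v where v: "v \<in> D" and vlim: "(\<lambda>n. Q1 m Q (\<lambda>x. xs n x - v x)) \<longlonglongrightarrow> 0"
    using D_complete[OF xD cau] by blast
  have "(\<integral>x. (v x - u x)\<^sup>2 \<partial>m) \<le> e" if "e > 0" for e
  proof -
    have "\<forall>\<^sub>F n in sequentially. (\<integral>x. (us n x - u x)\<^sup>2 \<partial>m) < e / 4"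
      using order_tendstoD(2)[OF lim, of "e/4"] that by simp
    then obtain N where N: "\<And>n. n \<ge> N \<Longrightarrow> (\<integral>x. (us n x - u x)\<^sup>2 \<partial>m) \<le> e / 4"
      unfolding eventually_sequentially by (meson less_imp_le)
    have "\<forall>\<^sub>F n in sequentially. Q1 m Q (\<lambda>x. xs n x - v x) < e / 4"
      using order_tendstoD(2)[OF vlim, of "e/4"] that by simp
    then obtain n where n: "n \<ge> N" "Q1 m Q (\<lambda>x. xs n x - v x) < e / 4"
      unfolding eventually_sequentially by (meson linorder_linear order_trans)
    have "(\<integral>x. (xs n x - u x)\<^sup>2 \<partial>m) \<le> e / 4"
      using L2_dist_mid_hull[OF us u _ xs(1)[of n], of "e/4"] N n(1) order_trans by blast
    moreover have "(\<integral>x. (xs n x - v x)\<^sup>2 \<partial>m) \<le> e / 4"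
      using L2_le_Q1[OF diff_mem[OF xD[of n] v]] n(2) by simp
    ultimately show ?thesis
      using L2.q_diff_le[of "\<lambda>x. xs n x - u x" m "\<lambda>x. xs n x - v x"] D_L2[OF xD[of n]] D_L2[OF v] u
      by (auto simp: L2_diff)
  qed
  then have "(\<integral>x. (v x - u x)\<^sup>2 \<partial>m) \<le> 0" by (rule field_le_epsilon) simp
  then have "AE x in m. v x - u x = 0"
    by (rule L2_eq_zero_AE[OF L2_diff[OF D_L2[OF v] u]])
  then have ae: "AE x in m. v x = u x" by eventually_elim simp
  show uD: "u \<in> D" by (rule D_AE[OF v L2_measurable[OF u] ae])
  have ae0: "AE x in m. 0 = u x - v x" using ae by eventually_elim simp
  have "Q1 m Q (\<lambda>x. u x - v x) = 0"
  proof -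
    have "Q (\<lambda>x. u x - v x) (\<lambda>x. u x - v x) = 0"
      using Q_AE_self[OF zero_mem _ ae0] Q.q_zero D_meas[OF diff_mem[OF uD v]] by simp
    moreover have "(\<integral>x. (u x - v x)\<^sup>2 \<partial>m) = (\<integral>x. 0 \<partial>m)"
      by (rule integral_cong_AE) (use ae0 D_meas[OF uD] D_meas[OF v] in \<open>auto elim!: eventually_mono\<close>)
    ultimately show ?thesis by (simp add: Q1_def)
  qed
  then have "q (\<lambda>x. u x - v x) = 0"
    using q_le[OF diff_mem[OF uD v]] q.nonneg[OF diff_mem[OF uD v]] by simp
  then have quv: "q u = q v" by (rule q.q_cong_null[OF uD v])
  \<comment> \<open>The bound by \<open>B\<close> passes to midpoints by convexity of
    \<open>q\<close>, so the combinations that converge in norm still satisfy it.\<close>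
  have qx: "q (xs n) \<le> B" for n
  proof -
    have "q x \<le> B" if "x \<in> mid_hull us n" for x
      using that
    proof induction
      case (mid x y)
      then show ?case using q.q_midpoint_le[OF hD[OF mid(1)] hD[OF mid(2)]] by linarith
    qed (rule qB)
    then show ?thesis using xs(1) by blast
  qed
  have "sqrt (q v) \<le> sqrt B + sqrt (Q1 m Q (\<lambda>x. xs n x - v x))" for n
  proof -
    have "sqrt (q v) \<le> sqrt (q (xs n)) + sqrt (q (\<lambda>x. v x - xs n x))"
      by (rule q.triangle_sub[OF v xD])
    also have "q (\<lambda>x. v x - xs n x) = q (\<lambda>x. xs n x - v x)" by (rule q.q_diff_commute[OF v xD])
    also have "\<dots> \<le> Q1 m Q (\<lambda>x. xs n x - v x)" by (rule q_le[OF diff_mem[OF xD v]])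
    finally show ?thesis using qx[of n] by (simp add: order_trans add_mono)
  qed
  moreover have "(\<lambda>n. sqrt B + sqrt (Q1 m Q (\<lambda>x. xs n x - v x))) \<longlonglongrightarrow> sqrt B + sqrt 0"
    by (intro tendsto_intros vlim)
  ultimately have "sqrt (q v) \<le> sqrt B + sqrt 0" by (intro LIMSEQ_le_const) auto
  then show "q u \<le> B" using quv by simp
qed

lemma weak_lsc_Q:
  assumes "\<And>k. us k \<in> D" "\<And>k. Q (us k) (us k) \<le> C"
    "L2 m u" "(\<lambda>k. \<integral>x. (us k x - u x)\<^sup>2 \<partial>m) \<longlonglongrightarrow> 0"
  shows "u \<in> D" "Q u u \<le> C"
  using weak_lsc[OF Q.quad_form_axioms Q_le_Q1 assms assms(2)] by auto

end

section \<open>Lattice operations\<close>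

text \<open>The square of \<open>c n\<close> is the integral of 2 (c n - min t v) over 0 \<le> t
  \<le> n d, and the quantity estimated here is the error of its right-endpoint Riemann sum with
  step d. It is nonnegative because the integrand decreases in t.\<close>

lemma square_interpolation_error:
  fixes v d :: real
  assumes "0 \<le> v" "0 \<le> d"
  defines "c \<equiv> (\<lambda>i::nat. min (real i * d) v)"
  shows "0 \<le> (c n)\<^sup>2 - 2 * real n * d * c n + 2 * d * (\<Sum>i=1..n. c i) \<and>
    (c n)\<^sup>2 - 2 * real n * d * c n + 2 * d * (\<Sum>i=1..n. c i) \<le> d * c n"
proof (induction n)
  case 0
  then show ?case using assms by simp
next
  case (Suc n)
  define a where "a = c n"
  define b where "b = c (Suc n)"
  \<comment> \<open>From n to n + 1 the error grows by this product. Either v < n d and a = b, or a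
    = n d and the second factor is b - a, which lies in [0, d].\<close>
  have step: "0 \<le> (b - a) * (b + a - 2 * real n * d)" "(b - a) * (b + a - 2 * real n * d) \<le> d * (b - a)"
  proof -
    have "a \<le> b" unfolding a_def b_def c_def using assms(2) by (auto simp: algebra_simps)
    moreover have "a = b \<or> 0 \<le> b + a - 2 * real n * d \<and> b + a - 2 * real n * d \<le> d"
    proof (cases "real n * d \<le> v")
      case True
      then show ?thesis unfolding a_def b_def c_def using assms(2) by (auto simp: algebra_simps min_def)
    next
      case False
      then have "a = b" unfolding a_def b_def c_def using assms(2) by (auto simp: algebra_simps min_def)
      then show ?thesis ..
    qed
    ultimately have "0 \<le> (b - a) * (b + a - 2 * real n * d) \<and> (b - a) * (b + a - 2 * real n * d) \<le> (b - a) * d"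
      by (metis diff_ge_0_iff_ge diff_self mult_left_mono mult_nonneg_nonneg mult_zero_left order_refl)
    then show "0 \<le> (b - a) * (b + a - 2 * real n * d)" "(b - a) * (b + a - 2 * real n * d) \<le> d * (b - a)"
      by (simp_all only: mult.commute[of d])
  qed
  have "(c (Suc n))\<^sup>2 - 2 * real (Suc n) * d * c (Suc n) + 2 * d * (\<Sum>i=1..Suc n. c i)
    = ((c n)\<^sup>2 - 2 * real n * d * c n + 2 * d * (\<Sum>i=1..n. c i)) + (b - a) * (b + a - 2 * real n * d)"
    unfolding a_def b_def by (simp add: algebra_simps power2_eq_square)
  moreover have "d * c (Suc n) = d * c n + d * (b - a)" unfolding a_def b_def by (simp add: algebra_simps)
  ultimately show ?case using Suc.IH step by linarith
qed

context dform
begin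

lemma
  assumes u: "u \<in> D" and a: "0 < a"
  shows clip_mem: "(\<lambda>x. min a (max 0 (u x))) \<in> D"
    and Q_clip: "Q (\<lambda>x. min a (max 0 (u x))) (\<lambda>x. min a (max 0 (u x))) \<le> Q u u"
proof -
  let ?w = "\<lambda>x. min 1 (max 0 ((1/a) * u x))"
  have eq: "(\<lambda>x. min a (max 0 (u x))) = (\<lambda>x. a * ?w x)"
    using a by (auto simp: fun_eq_iff min_def max_def field_simps)
  have w: "?w \<in> D" by (rule Q_unit_contraction(1)[OF scale_mem[OF u]])
  then show "(\<lambda>x. min a (max 0 (u x))) \<in> D" unfolding eq by (rule scale_mem)
  have "Q ?w ?w \<le> (1/a)\<^sup>2 * Q u u"
    using Q_unit_contraction(2)[OF scale_mem[OF u], of "1/a"] by (simp only: Q.hom[OF u])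
  then have "a\<^sup>2 * Q ?w ?w \<le> a\<^sup>2 * ((1/a)\<^sup>2 * Q u u)" by (rule mult_left_mono) simp
  also have "\<dots> = Q u u" using a by (simp add: power_divide)
  finally show "Q (\<lambda>x. min a (max 0 (u x))) (\<lambda>x. min a (max 0 (u x))) \<le> Q u u"
    unfolding eq Q.hom[OF w] .
qed

lemma clip_L2_lim:
  assumes u: "u \<in> D"
  shows "(\<lambda>n. \<integral>x. (min (real (Suc n)) (max 0 (u x)) - max 0 (u x))\<^sup>2 \<partial>m) \<longlonglongrightarrow> 0"
proof -
  have uL: "L2 m (\<lambda>x. \<bar>u x\<bar>)"
    by (rule L2_dominated[OF D_L2[OF u]]) (use D_meas[OF u] in auto)
  show ?thesis
  proof (rule L2_dominated_convergence[OF uL])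
    show "AE x in m. (\<lambda>n. min (real (Suc n)) (max 0 (u x))) \<longlonglongrightarrow> max 0 (u x)"
    proof (rule AE_I2)
      fix x
      obtain N :: nat where N: "max 0 (u x) \<le> real N" using real_arch_simple by blast
      have "\<forall>\<^sub>F n in sequentially. min (real (Suc n)) (max 0 (u x)) = max 0 (u x)"
        using eventually_ge_at_top[of N]
      proof eventually_elim
        case (elim n)
        then have "max 0 (u x) \<le> real (Suc n)" using N by simp
        then show ?case by (rule min.absorb2)
      qed
      then show "(\<lambda>n. min (real (Suc n)) (max 0 (u x))) \<longlonglongrightarrow> max 0 (u x)"
        by (rule tendsto_eventually)
    qed
  qed (use D_meas[OF u] in auto)
qed

text \<open>The Markov property is postulated for the unit contraction only. The positive part is
  the L2 limit of clips at the heights n + 1, whose energies are at most that of \<open>u\<close>,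
  so weak lower semicontinuity applies.\<close>

lemma
  assumes u: "u \<in> D"
  shows pos_part_mem: "(\<lambda>x. max 0 (u x)) \<in> D"
    and Q_pos_part: "Q (\<lambda>x. max 0 (u x)) (\<lambda>x. max 0 (u x)) \<le> Q u u"
proof -
  have pL: "L2 m (\<lambda>x. max 0 (u x))"
    by (rule L2_dominated[OF D_L2[OF u]]) (use D_meas[OF u] in auto)
  show "(\<lambda>x. max 0 (u x)) \<in> D" "Q (\<lambda>x. max 0 (u x)) (\<lambda>x. max 0 (u x)) \<le> Q u u"
    using weak_lsc_Q[OF clip_mem[OF u] Q_clip[OF u] pL clip_L2_lim[OF u]] by auto
qed

text \<open>The factor 4 comes from \<open>q_add_le\<close> applied to the positive and negative
  parts. This bound serves to keep energies bounded along sequences and to estimate capacities;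
  contraction with constant 1 is proved later for the energy measures.\<close>

lemma
  assumes u: "u \<in> D"
  shows abs_mem: "(\<lambda>x. \<bar>u x\<bar>) \<in> D"
    and Q_abs: "Q (\<lambda>x. \<bar>u x\<bar>) (\<lambda>x. \<bar>u x\<bar>) \<le> 4 * Q u u"
proof -
  have eq: "(\<lambda>x. \<bar>u x\<bar>) = (\<lambda>x. max 0 (u x) + max 0 (- u x))" by (auto simp: fun_eq_iff)
  note p = pos_part_mem[OF u] and n = pos_part_mem[OF minus_mem[OF u]]
  show "(\<lambda>x. \<bar>u x\<bar>) \<in> D" unfolding eq by (rule add_mem[OF p n])
  show "Q (\<lambda>x. \<bar>u x\<bar>) (\<lambda>x. \<bar>u x\<bar>) \<le> 4 * Q u u"
    unfolding eq using Q.q_add_le[OF p n] Q_pos_part[OF u] Q_pos_part[OF minus_mem[OF u]] Q.q_minus[OF u]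
    by simp
qed

lemma max_mem:
  assumes u: "u \<in> D" and v: "v \<in> D"
  shows "(\<lambda>x. max (u x) (v x)) \<in> D"
proof -
  have "(\<lambda>x. v x + max 0 (u x - v x)) \<in> D" by (intro add_mem v pos_part_mem diff_mem u)
  then show ?thesis by (rule back_subst[of "\<lambda>f. f \<in> D"]) (auto simp: fun_eq_iff)
qed

lemma min_mem:
  assumes u: "u \<in> D" and v: "v \<in> D"
  shows "(\<lambda>x. min (u x) (v x)) \<in> D"
proof -
  have "(\<lambda>x. u x - max 0 (u x - v x)) \<in> D" by (intro v pos_part_mem diff_mem u)
  then show ?thesis by (rule back_subst[of "\<lambda>f. f \<in> D"]) (auto simp: fun_eq_iff)
qed

lemma
  assumes u: "u \<in> D" and a: "0 \<le> a"
  shows sym_clip_mem: "(\<lambda>x. max (- a) (min a (u x))) \<in> D"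
    and Q_sym_clip: "Q (\<lambda>x. max (- a) (min a (u x))) (\<lambda>x. max (- a) (min a (u x))) \<le> 4 * Q u u"
proof -
  have "(\<lambda>x. max (- a) (min a (u x))) \<in> D \<and>
    Q (\<lambda>x. max (- a) (min a (u x))) (\<lambda>x. max (- a) (min a (u x))) \<le> 4 * Q u u"
  proof (cases "a = 0")
    case True
    have *: "(\<lambda>x. max (- a) (min a (u x))) = (\<lambda>x. 0)" using True by (auto simp: fun_eq_iff)
    show ?thesis unfolding * using zero_mem Q.q_zero Q.nonneg[OF u] by simp
  next
    case False
    then have a': "0 < a" using a by simp
    have eq: "(\<lambda>x. max (- a) (min a (u x))) = (\<lambda>x. min a (max 0 (u x)) - min a (max 0 (- u x)))"
      using a by (auto simp: fun_eq_iff)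
    note p = clip_mem[OF u a'] and n = clip_mem[OF minus_mem[OF u] a']
    show ?thesis unfolding eq
      using Q.q_diff_le[OF p n] Q_clip[OF u a'] Q_clip[OF minus_mem[OF u] a'] Q.q_minus[OF u] diff_mem[OF p n]
      by simp
  qed
  then show "(\<lambda>x. max (- a) (min a (u x))) \<in> D"
    "Q (\<lambda>x. max (- a) (min a (u x))) (\<lambda>x. max (- a) (min a (u x))) \<le> 4 * Q u u" by auto
qed

lemma Q1_pos_part:
  assumes u: "u \<in> D"
  shows "Q1 m Q (\<lambda>x. max 0 (u x)) \<le> Q1 m Q u"
proof -
  have "(\<integral>x. (max 0 (u x))\<^sup>2 \<partial>m) \<le> (\<integral>x. (u x)\<^sup>2 \<partial>m)"
    by (rule integral_mono[OF L2_integrable[OF D_L2[OF pos_part_mem[OF u]]] L2_integrable[OF D_L2[OF u]]])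
       (auto simp: max_def)
  then show ?thesis using Q_pos_part[OF u] by (simp add: Q1_def)
qed

lemma Q1_abs:
  assumes u: "u \<in> D"
  shows "Q1 m Q (\<lambda>x. \<bar>u x\<bar>) \<le> 4 * Q1 m Q u"
proof -
  have "0 \<le> (\<integral>x. (u x)\<^sup>2 \<partial>m)" by simp
  then show ?thesis using Q_abs[OF u] unfolding Q1_def power2_abs distrib_left by linarith
qed

text \<open>The square is approximated by \<open>2 M v - 2 \<delta> \<Sum>\<^sub>i min (i \<delta>) v\<close>, a combination of unit
  contractions of v whose energy stays bounded.\<close>

lemma square_mem_nonneg:
  assumes v: "v \<in> D" and bd: "\<And>x. 0 \<le> v x" "\<And>x. v x \<le> M"
  shows "(\<lambda>x. (v x)\<^sup>2) \<in> D"
proof -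
  \<comment> \<open>At least 1, so that the step size \<open>d n\<close> is positive and all clip
    heights i d with i \<ge> 1 are admissible for \<open>clip_mem\<close>.\<close>
  define M' where "M' = max 1 M"
  have M: "0 < M'" and vM: "v x \<le> M'" for x
    using bd(2)[of x] by (auto simp: M'_def)
  define d where "d n = M' / real (Suc n)" for n
  have d0: "0 < d n" for n using M by (simp add: d_def)
  define s where "s n x = 2 * M' * v x - 2 * d n * (\<Sum>i=1..Suc n. min (real i * d n) (v x))" for n x
  have clipeq: "min a (v x) = min a (max 0 (v x))" for a x using bd(1)[of x] by simp
  have cD: "(\<lambda>x. min (real i * d n) (v x)) \<in> D" if "1 \<le> i" for i n
    unfolding clipeq by (rule clip_mem[OF v]) (use that d0[of n] in simp)
  have SD: "(\<lambda>x. \<Sum>i=1..Suc n. min (real i * d n) (v x)) \<in> D" for n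
    by (rule sum_mem) (use cD in auto)
  have sD: "s n \<in> D" for n
    unfolding s_def by (intro diff_mem scale_mem v SD)
  \<comment> \<open>Each clip has at most the energy of v, so k of them have norm at most k times
    that of v. For k = n + 1 this factor is cancelled by the step size \<open>d n\<close> in
    \<open>Qs\<close>, which leaves a bound independent of n.\<close>
  have sums: "sqrt (Q (\<lambda>x. \<Sum>i=1..k. min (real i * d n) (v x)) (\<lambda>x. \<Sum>i=1..k. min (real i * d n) (v x)))
      \<le> real k * sqrt (Q v v)" for k n
  proof (induction k)
    case 0
    then show ?case using Q.q_zero by simp
  next
    case (Suc k)
    have kD: "(\<lambda>x. \<Sum>i=1..k. min (real i * d n) (v x)) \<in> D" by (rule sum_mem) (use cD in auto)
    have "0 < real (Suc k) * d n" using d0 by simp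
    from Q_clip[OF v this]
    have "sqrt (Q (\<lambda>x. min (real (Suc k) * d n) (v x)) (\<lambda>x. min (real (Suc k) * d n) (v x))) \<le> sqrt (Q v v)"
      unfolding clipeq[symmetric] by (rule real_sqrt_le_mono)
    moreover have "sqrt (Q (\<lambda>x. \<Sum>i=1..Suc k. min (real i * d n) (v x)) (\<lambda>x. \<Sum>i=1..Suc k. min (real i * d n) (v x)))
      \<le> sqrt (Q (\<lambda>x. \<Sum>i=1..k. min (real i * d n) (v x)) (\<lambda>x. \<Sum>i=1..k. min (real i * d n) (v x)))
        + sqrt (Q (\<lambda>x. min (real (Suc k) * d n) (v x)) (\<lambda>x. min (real (Suc k) * d n) (v x)))"
      using Q.triangle[OF kD cD[of "Suc k" n]] by simp
    moreover have "real (Suc k) * sqrt (Q v v) = real k * sqrt (Q v v) + sqrt (Q v v)"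
      by (simp add: algebra_simps)
    ultimately show ?case using Suc by linarith
  qed
  have Qs: "Q (s n) (s n) \<le> (4 * M' * sqrt (Q v v))\<^sup>2" for n
  proof -
    have "sqrt (Q (s n) (s n)) \<le> \<bar>2 * M'\<bar> * sqrt (Q v v)
      + \<bar>2 * d n\<bar> * sqrt (Q (\<lambda>x. \<Sum>i=1..Suc n. min (real i * d n) (v x)) (\<lambda>x. \<Sum>i=1..Suc n. min (real i * d n) (v x)))"
      unfolding s_def
      using Q.triangle_diff[OF scale_mem[OF v] scale_mem[OF SD[of n]], of "2 * M'" "2 * d n"]
      by (simp only: Q.sqrt_scale[OF v] Q.sqrt_scale[OF SD[of n]])
    also have "\<dots> \<le> \<bar>2 * M'\<bar> * sqrt (Q v v) + \<bar>2 * d n\<bar> * (real (Suc n) * sqrt (Q v v))"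
      by (intro add_left_mono mult_left_mono sums) simp
    also have "\<dots> = 4 * M' * sqrt (Q v v)" using M d0[of n] by (simp add: d_def field_simps)
    finally have "sqrt (Q (s n) (s n)) \<le> 4 * M' * sqrt (Q v v)" .
    then show ?thesis by (rule sqrt_le_D)
  qed
  have err: "\<bar>s n x - (v x)\<^sup>2\<bar> \<le> d n * v x" for n x
  proof -
    have nd: "real (Suc n) * d n = M'" by (simp add: d_def)
    define S where "S = 2 * d n * (\<Sum>i=1..Suc n. min (real i * d n) (v x))"
    have mv: "min (real (Suc n) * d n) (v x) = v x" using vM[of x] nd by simp
    have "2 * real (Suc n) * d n * v x = 2 * M' * v x" using nd by (metis mult.assoc)
    then have "0 \<le> (v x)\<^sup>2 - 2 * M' * v x + S" "(v x)\<^sup>2 - 2 * M' * v x + S \<le> d n * v x"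
      using square_interpolation_error[OF bd(1)[of x] less_imp_le[OF d0[of n]], of "Suc n"]
      unfolding mv S_def[symmetric] by linarith+
    moreover have "0 \<le> d n * v x" using d0[of n] bd(1)[of x] by simp
    ultimately show ?thesis unfolding s_def S_def[symmetric] by linarith
  qed
  have vL: "L2 m (\<lambda>x. (v x)\<^sup>2)"
  proof (rule L2_dominated[OF D_L2[OF scale_mem[OF v, of M']]])
    show "AE x in m. \<bar>(v x)\<^sup>2\<bar> \<le> \<bar>M' * v x\<bar>"
      using bd(1) vM M by (auto simp: power2_eq_square abs_mult intro!: mult_right_mono)
  qed (use D_meas[OF v] in auto)
  have "(\<lambda>n. \<integral>x. (s n x - (v x)\<^sup>2)\<^sup>2 \<partial>m) \<longlonglongrightarrow> 0"
  proof (rule tendsto_sandwich[where f = "\<lambda>_. 0"])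
    have "(\<lambda>n. (M' * inverse (real (Suc n)))\<^sup>2 * (\<integral>x. (v x)\<^sup>2 \<partial>m)) \<longlonglongrightarrow> (M' * 0)\<^sup>2 * (\<integral>x. (v x)\<^sup>2 \<partial>m)"
      by (intro tendsto_intros LIMSEQ_inverse_real_of_nat)
    then show "(\<lambda>n. (d n)\<^sup>2 * (\<integral>x. (v x)\<^sup>2 \<partial>m)) \<longlonglongrightarrow> 0" by (simp add: d_def divide_inverse)
    show "\<forall>\<^sub>F n in sequentially. (\<integral>x. (s n x - (v x)\<^sup>2)\<^sup>2 \<partial>m) \<le> (d n)\<^sup>2 * (\<integral>x. (v x)\<^sup>2 \<partial>m)"
    proof (rule always_eventually, rule allI)
      fix n
      have "(\<integral>x. (s n x - (v x)\<^sup>2)\<^sup>2 \<partial>m) \<le> (\<integral>x. (d n * v x)\<^sup>2 \<partial>m)"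
      proof (rule integral_mono)
        show "(s n x - (v x)\<^sup>2)\<^sup>2 \<le> (d n * v x)\<^sup>2" for x
          using err[of n x] by (simp add: abs_le_square_iff[symmetric])
      qed (use L2_diff[OF D_L2[OF sD[of n]] vL] D_L2[OF scale_mem[OF v, of "d n"]] in \<open>auto simp: L2_def\<close>)
      then show "(\<integral>x. (s n x - (v x)\<^sup>2)\<^sup>2 \<partial>m) \<le> (d n)\<^sup>2 * (\<integral>x. (v x)\<^sup>2 \<partial>m)"
        by (simp add: power_mult_distrib)
    qed
  qed (auto intro!: always_eventually)
  from weak_lsc_Q(1)[OF sD Qs vL this] show ?thesis .
qed

lemma square_mem:
  assumes v: "v \<in> D" and bd: "\<And>x. \<bar>v x\<bar> \<le> M"
  shows "(\<lambda>x. (v x)\<^sup>2) \<in> D"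
proof -
  have M: "0 \<le> M" using bd[of undefined] by linarith
  have "(\<lambda>x. (max 0 (v x))\<^sup>2) \<in> D" "(\<lambda>x. (max 0 (- v x))\<^sup>2) \<in> D"
    using bd M by (auto intro!: square_mem_nonneg[where M = M] pos_part_mem minus_mem v simp: abs_le_iff)
  from add_mem[OF this] show ?thesis
    by (rule back_subst[of "\<lambda>f. f \<in> D"]) (auto simp: fun_eq_iff max_def)
qed

end

section \<open>Locally compact metric spaces\<close>

lemma compact_closure_subset:
  fixes K :: "'a::t2_space set"
  assumes K: "compact K" and "A \<subseteq> K"
  shows "compact (closure A)"
proof -
  have "closure A \<subseteq> K" using assms by (intro closure_minimal compact_imp_closed)
  then have "closure A = K \<inter> closure A" by auto
  then show ?thesis using compact_Int_closed[OF K closed_closure] by metis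
qed

lemma closure_UN_finite_subset:
  assumes "finite F"
  shows "closure (\<Union>x\<in>F. V x) \<subseteq> (\<Union>x\<in>F. closure (V x))"
  by (intro closure_minimal UN_mono closure_subset order_refl closed_UN assms) auto

lemma locally_compact_nbhd:
  fixes x :: "'a::metric_space"
  assumes "locally compact (UNIV :: 'a set)"
  obtains V where "open V" "x \<in> V" "compact (closure V)"
proof -
  obtain V K where VK: "open V" "compact K" "x \<in> V" "V \<subseteq> K"
    by (rule locallyE[OF assms, of UNIV x]) auto
  then show ?thesis using that compact_closure_subset by blast
qed

lemma locally_compact_shrink:
  fixes K :: "'a::metric_space set"
  assumes lc: "locally compact (UNIV :: 'a set)" and K: "compact K" and U: "open U" "K \<subseteq> U"
  obtains V where "open V" "K \<subseteq> V" "compact (closure V)" "closure V \<subseteq> U"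
proof -
  have "\<exists>V. open V \<and> x \<in> V \<and> compact (closure V) \<and> closure V \<subseteq> U" if "x \<in> K" for x
  proof -
    obtain W where W: "open W" "x \<in> W" "compact (closure W)"
      by (rule locally_compact_nbhd[OF lc, of x])
    have "x \<in> U" using U(2) that by (rule subsetD)
    then have "\<exists>e>0. cball x e \<subseteq> U" using open_contains_cball_eq[OF U(1)] by simp
    then obtain e where e: "e > 0" "cball x e \<subseteq> U" by (elim exE conjE)
    have "compact (closure (W \<inter> ball x e))"
      by (rule compact_closure_subset[OF W(3)]) (use closure_subset[of W] in blast)
    moreover have "closure (W \<inter> ball x e) \<subseteq> U"
      using closure_minimal[of "W \<inter> ball x e" "cball x e"] e(2) by fastforce
    ultimately show ?thesis
      using W(1,2) e(1) by (intro exI[of _ "W \<inter> ball x e"]) auto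
  qed
  then obtain V where V: "\<And>x. x \<in> K \<Longrightarrow> open (V x) \<and> x \<in> V x \<and> compact (closure (V x)) \<and> closure (V x) \<subseteq> U"
    by metis
  obtain F where F: "F \<subseteq> K" "finite F" "K \<subseteq> (\<Union>x\<in>F. V x)"
    by (rule compactE_image[OF K, of K V]) (use V in auto)
  have cF: "compact (\<Union>x\<in>F. closure (V x))" using F V by (intro compact_UN) auto
  show ?thesis
  proof
    show "open (\<Union>x\<in>F. V x)" "K \<subseteq> (\<Union>x\<in>F. V x)" using F V by auto
    show "compact (closure (\<Union>x\<in>F. V x))"
      by (rule compact_closure_subset[OF cF UN_mono[OF order_refl closure_subset]])
    show "closure (\<Union>x\<in>F. V x) \<subseteq> U"
      using closure_UN_finite_subset[OF F(2), of V] F(1) V by blast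
  qed
qed

lemma compact_exhaustion:
  assumes lc: "locally compact (UNIV :: 'a::{metric_space, second_countable_topology} set)"
  obtains G :: "nat \<Rightarrow> 'a::{metric_space, second_countable_topology} set" where "\<And>n. open (G n)" "\<And>n. compact (closure (G n))" "incseq G"
    "(\<Union>n. G n) = UNIV" "\<And>K. compact K \<Longrightarrow> \<exists>n. K \<subseteq> G n"
proof -
  let ?F = "{V :: 'a set. open V \<and> compact (closure V)}"
  obtain F' where F': "F' \<subseteq> ?F" "countable F'" "\<Union>F' = \<Union>?F"
    using Lindelof[of ?F] by auto
  have "x \<in> \<Union>?F" for x using locally_compact_nbhd[OF lc, of x] by blast
  then have cov: "\<Union>F' = UNIV" using F'(3) by auto
  then have "F' \<noteq> {}" by auto
  then have rng: "range (from_nat_into F') = F'" using F'(2) by (rule range_from_nat_into)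
  define G where "G n = (\<Union>i<n. from_nat_into F' i)" for n
  have e: "open (from_nat_into F' i)" "compact (closure (from_nat_into F' i))" for i
    using F'(1) from_nat_into[OF \<open>F' \<noteq> {}\<close>, of i] by auto
  have inc: "incseq G" unfolding G_def incseq_def by fastforce
  have U: "(\<Union>n. G n) = UNIV"
  proof -
    have "x \<in> (\<Union>n. G n)" for x
    proof -
      obtain i where "x \<in> from_nat_into F' i" using cov rng by (metis UNIV_I Union_iff imageE)
      then show ?thesis by (auto simp: G_def intro!: exI[of _ "Suc i"])
    qed
    then show ?thesis by auto
  qed
  have oG: "open (G n)" for n unfolding G_def using e by auto
  have "\<exists>n. K \<subseteq> G n" if K: "compact K" for K
  proof -
    obtain N where N: "finite N" "K \<subseteq> (\<Union>n\<in>N. G n)"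
      by (rule compactE_image[OF K, of UNIV G]) (use U oG in auto)
    have "K \<subseteq> G (Max (insert 0 N))"
    proof
      fix x assume "x \<in> K"
      then obtain n where "n \<in> N" "x \<in> G n" using N(2) by auto
      moreover have "G n \<subseteq> G (Max (insert 0 N))" using inc N(1) \<open>n \<in> N\<close> by (auto simp: incseq_def)
      ultimately show "x \<in> G (Max (insert 0 N))" by auto
    qed
    then show ?thesis by blast
  qed
  moreover have "compact (closure (G n))" for n
  proof (rule compact_closure_subset)
    show "compact (\<Union>i<n. closure (from_nat_into F' i))" using e by (intro compact_UN) auto
    show "G n \<subseteq> (\<Union>i<n. closure (from_nat_into F' i))" unfolding G_def by (intro UN_mono closure_subset order_refl)
  qed
  ultimately show ?thesis using that[OF oG _ inc U] by blast
qed

lemma CcI: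
  fixes w :: "'a::t2_space \<Rightarrow> real"
  assumes "continuous_on UNIV w" "{x. w x \<noteq> 0} \<subseteq> K" "compact K"
  shows "w \<in> Cc"
proof -
  show ?thesis using compact_closure_subset[OF assms(3,2)] assms(1) by (simp add: Cc_def)
qed

lemma Cc_cont: "u \<in> Cc \<Longrightarrow> continuous_on UNIV u"
  by (simp add: Cc_def)

lemma Cc_comp2:
  fixes u v w :: "'a::t2_space \<Rightarrow> real"
  assumes "u \<in> Cc" "v \<in> Cc" "continuous_on UNIV w" "\<And>x. u x = 0 \<Longrightarrow> v x = 0 \<Longrightarrow> w x = 0"
  shows "w \<in> Cc"
proof (rule CcI[OF assms(3)])
  show "compact (closure {x. u x \<noteq> 0} \<union> closure {x. v x \<noteq> 0})"
    using assms(1,2) by (auto simp: Cc_def)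
  show "{x. w x \<noteq> 0} \<subseteq> closure {x. u x \<noteq> 0} \<union> closure {x. v x \<noteq> 0}"
  proof
    fix x assume "x \<in> {x. w x \<noteq> 0}"
    then have "x \<in> {x. u x \<noteq> 0} \<union> {x. v x \<noteq> 0}" using assms(4)[of x] by auto
    then show "x \<in> closure {x. u x \<noteq> 0} \<union> closure {x. v x \<noteq> 0}"
      using closure_subset[of "{x. u x \<noteq> 0}"] closure_subset[of "{x. v x \<noteq> 0}"] by blast
  qed
qed

lemma Cc_comp:
  fixes u w :: "'a::t2_space \<Rightarrow> real"
  assumes "u \<in> Cc" "continuous_on UNIV w" "\<And>x. u x = 0 \<Longrightarrow> w x = 0"
  shows "w \<in> Cc"
  using Cc_comp2[OF assms(1,1,2)] assms(3) by blast

lemma Cc_bounded: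
  assumes "u \<in> Cc"
  obtains M where "\<And>x. \<bar>u x\<bar> \<le> M" "0 < M"
proof -
  have "compact (u ` closure {x. u x \<noteq> 0})"
    using assms continuous_on_subset by (intro compact_continuous_image) (auto simp: Cc_def)
  then obtain M where M: "0 < M" "\<And>y. y \<in> u ` closure {x. u x \<noteq> 0} \<Longrightarrow> \<bar>y\<bar> \<le> M"
    using compact_imp_bounded bounded_pos by (metis real_norm_def)
  have "\<bar>u x\<bar> \<le> M" for x
    using M closure_subset[of "{x. u x \<noteq> 0}"] by (cases "u x = 0") auto
  then show ?thesis using that M(1) by blast
qed

text \<open>By the Lindeloef property countably many members already cover the union. It is used
  both for the local vanishing of measures and for the largest open set that is null off a given
  set.\<close>

lemma null_Union_open:
  fixes M :: "'a::second_countable_topology measure"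
  assumes "sets M = sets borel" and A: "A \<in> sets borel"
    and "\<And>V. V \<in> F \<Longrightarrow> open V \<and> emeasure M (V \<inter> A) = 0"
  shows "emeasure M (\<Union>F \<inter> A) = 0"
proof -
  obtain F' where F': "F' \<subseteq> F" "countable F'" "\<Union>F' = \<Union>F"
    using Lindelof[of F] assms(3) by auto
  have "(\<Union>V\<in>F'. V \<inter> A) \<in> null_sets M"
    using F' assms by (intro null_sets_UN') (auto simp: null_sets_def)
  moreover have "(\<Union>V\<in>F'. V \<inter> A) = \<Union>F \<inter> A" using F'(3) by auto
  ultimately show ?thesis by auto
qed

section \<open>Capacity\<close>

locale rform = dform m Q D
  for m :: "'a::{metric_space, second_countable_topology} measure"
    and Q :: "('a \<Rightarrow> real) \<Rightarrow> ('a \<Rightarrow> real) \<Rightarrow> real" and D :: "('a \<Rightarrow> real) set" +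
  assumes lc: "locally compact (UNIV :: 'a set)"
    and radon: "radon_full_support m"
    and regular: "regular_dirichlet_form m Q D"
begin

abbreviation "cap \<equiv> capacity m Q D"
abbreviation "qc \<equiv> quasi_continuous m Q D"

lemma sets_m: "sets m = sets borel"
  using radon by (simp add: radon_full_support_def)

lemma space_m: "space m = UNIV"
  using sets_eq_imp_space_eq[OF sets_m] by simp

lemma borel_imp_meas: "u \<in> borel_measurable borel \<Longrightarrow> u \<in> borel_measurable m"
  using measurable_cong_sets[OF sets_m refl] by blast

lemma D_borel: "u \<in> D \<Longrightarrow> u \<in> borel_measurable borel"
  using D_meas measurable_cong_sets[OF sets_m refl] by blast

lemma compact_finite: "compact K \<Longrightarrow> emeasure m K < \<infinity>"
  using radon by (simp add: radon_full_support_def)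

lemma regular_dense: "u \<in> D \<Longrightarrow> e > 0 \<Longrightarrow> \<exists>v\<in>D \<inter> Cc. Q1 m Q (\<lambda>x. u x - v x) < e"
  using regular by (simp add: regular_dirichlet_form_def)

lemma regular_uniform: "g \<in> Cc \<Longrightarrow> e > 0 \<Longrightarrow> \<exists>v\<in>D \<inter> Cc. \<forall>x. \<bar>v x - g x\<bar> < e"
  using regular by (simp add: regular_dirichlet_form_def)

lemma approx_seq:
  assumes u: "u \<in> D"
  obtains us where "\<And>n. us n \<in> D" "\<And>n. us n \<in> Cc" "(\<lambda>n. Q1 m Q (\<lambda>x. us n x - u x)) \<longlonglongrightarrow> 0"
proof -
  have "\<exists>v. v \<in> D \<and> v \<in> Cc \<and> Q1 m Q (\<lambda>x. u x - v x) < inverse (real (Suc n))" for n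
    using regular_dense[OF u, of "inverse (real (Suc n))"] by auto
  then obtain us where us: "\<And>n. us n \<in> D" "\<And>n. us n \<in> Cc"
      "\<And>n. Q1 m Q (\<lambda>x. u x - us n x) < inverse (real (Suc n))"
    by metis
  have "(\<lambda>n. Q1 m Q (\<lambda>x. us n x - u x)) \<longlonglongrightarrow> 0"
  proof (rule tendsto_sandwich[where f = "\<lambda>_. 0" and h = "\<lambda>n. inverse (real (Suc n))"])
    show "\<forall>\<^sub>F n in sequentially. Q1 m Q (\<lambda>x. us n x - u x) \<le> inverse (real (Suc n))"
      using us(3) Q1.q_diff_commute[OF u us(1)] by (auto intro!: always_eventually less_imp_le)
  qed (use Q1.nonneg[OF diff_mem[OF us(1) u]] LIMSEQ_inverse_real_of_nat in auto)
  then show ?thesis using that us by blast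
qed

text \<open>A Urysohn function of the metric lies in \<open>Cc\<close> but need not lie in D.
  Regularity supplies a function of D uniformly close to it, and clipping that function at two
  levels restores the exact values 0 and 1.\<close>

lemma cutoff:
  assumes K: "compact K" and U: "open U" "K \<subseteq> U"
  obtains phi V where "phi \<in> D" "phi \<in> Cc" "\<forall>x. 0 \<le> phi x" "\<forall>x. phi x \<le> 1" "open V" "K \<subseteq> V"
    "\<forall>x\<in>V. phi x = 1" "closure {x. phi x \<noteq> 0} \<subseteq> U"
proof (cases "K = {}")
  case True
  then show ?thesis using that[of "\<lambda>x. 0" "{}"] zero_mem by (auto simp: Cc_def)
next
  case False
  obtain V1 where V1: "open V1" "K \<subseteq> V1" "compact (closure V1)" "closure V1 \<subseteq> U"
    by (rule locally_compact_shrink[OF lc K U])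
  obtain V2 where V2: "open V2" "closure V1 \<subseteq> V2" "compact (closure V2)" "closure V2 \<subseteq> U"
    by (rule locally_compact_shrink[OF lc V1(3) U(1) V1(4)])
  let ?S = "closure V1"
  have Sne: "?S \<noteq> {}" using False V1(2) closure_subset[of V1] by blast
  define T where "T = - V2"
  have T: "closed T" using V2(1) by (simp add: T_def closed_Compl)
  \<comment> \<open>The height 2 leaves room for an approximation error of 1/2 around the levels 1/2
    and 3/2 used below. The separate case is due to \<open>infdist\<close> being 0 for the empty
    set.\<close>
  define g where "g x = (if T = {} then 2 else 2 * infdist x T / (infdist x T + infdist x ?S))" for x
  have dT: "0 < infdist x T" if "T \<noteq> {}" "x \<notin> T" for x
    using in_closed_iff_infdist_zero[OF T that(1), of x] that(2) infdist_nonneg[of x T] by linarith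
  have dS: "0 < infdist x ?S" if "x \<notin> ?S" for x
    using in_closed_iff_infdist_zero[OF closed_closure Sne, of x] that infdist_nonneg[of x ?S] by linarith
  have gS: "g x = 2" if "x \<in> ?S" for x
  proof (cases "T = {}")
    case False
    then have "0 < infdist x T" using dT[of x] that V2(2) by (auto simp: T_def)
    then show ?thesis using that False by (simp add: g_def)
  qed (simp add: g_def)
  have gT: "g x = 0" if "x \<notin> V2" for x
    using that by (auto simp: g_def T_def)
  have "g \<in> Cc"
  proof (rule CcI[OF _ _ V2(3)])
    have "infdist x T + infdist x ?S \<noteq> 0" if "T \<noteq> {}" for x
    proof (cases "x \<in> T")
      case True
      then have "x \<notin> ?S" using V2(2) by (auto simp: T_def)
      then show ?thesis using dS[of x] infdist_nonneg[of x T] by linarith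
    next
      case False
      then show ?thesis using dT[OF that, of x] infdist_nonneg[of x ?S] by linarith
    qed
    then show "continuous_on UNIV g" unfolding g_def
      by (cases "T = {}") (auto intro!: continuous_intros)
    show "{x. g x \<noteq> 0} \<subseteq> closure V2" using gT closure_subset[of V2] by blast
  qed
  then obtain v where v: "v \<in> D" "v \<in> Cc" "\<And>x. \<bar>v x - g x\<bar> < 1/2"
    using regular_uniform[of g "1/2"] by auto
  \<comment> \<open>The part of v between the levels 1/2 and 3/2: v exceeds 3/2 where g = 2 and
    stays below 1/2 where g = 0.\<close>
  define phi where "phi x = min (3/2) (max 0 (v x)) - min (1/2) (max 0 (v x))" for x
  have supp: "{x. phi x \<noteq> 0} \<subseteq> V2"
  proof
    fix x assume "x \<in> {x. phi x \<noteq> 0}"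
    then have "v x > 1/2" unfolding phi_def by (auto simp: min_def max_def split: if_splits)
    then show "x \<in> V2" using gT[of x] v(3)[of x] by (cases "x \<in> V2") auto
  qed
  have cl: "closure {x. phi x \<noteq> 0} \<subseteq> closure V2" by (rule closure_mono[OF supp])
  show ?thesis
  proof
    show "phi \<in> D" unfolding phi_def by (intro diff_mem clip_mem v) auto
    show "phi \<in> Cc"
    proof (rule CcI[OF _ _ V2(3)])
      show "continuous_on UNIV phi" unfolding phi_def using Cc_cont[OF v(2)] by (intro continuous_intros)
      show "{x. phi x \<noteq> 0} \<subseteq> closure V2" using supp closure_subset[of V2] by blast
    qed
    show "\<forall>x. 0 \<le> phi x" "\<forall>x. phi x \<le> 1" unfolding phi_def by (auto simp: min_def max_def)
    show "open V1" "K \<subseteq> V1" by fact+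
    show "\<forall>x\<in>V1. phi x = 1"
    proof
      fix x assume "x \<in> V1"
      then have "g x = 2" using gS closure_subset[of V1] by blast
      then have "v x > 3/2" using v(3)[of x] by linarith
      then show "phi x = 1" by (simp add: phi_def)
    qed
    show "closure {x. phi x \<noteq> 0} \<subseteq> U" using cl V2(4) by blast
  qed
qed

section \<open>Capacity and its countable subadditivity\<close>

lemma cap_mono: "A \<subseteq> B \<Longrightarrow> cap A \<le> cap B"
  unfolding capacity_def by (rule INF_superset_mono) auto

lemma cap_lessD:
  assumes "cap A < e"
  obtains U u where "open U" "A \<subseteq> U" "u \<in> D" "AE x in m. x \<in> U \<longrightarrow> 1 \<le> u x" "ennreal (Q1 m Q u) < e"
  using assms unfolding capacity_def by (auto simp: INF_less_iff)

lemma cap_le: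
  assumes "open U" "A \<subseteq> U" "u \<in> D" "AE x in m. x \<in> U \<longrightarrow> 1 \<le> u x"
  shows "cap A \<le> ennreal (Q1 m Q u)"
  unfolding capacity_def by (rule INF_lower2[of U], use assms in simp, rule INF_lower2[of u], use assms in auto)

lemma cap_empty: "cap {} = 0"
  using cap_le[of "{}" "{}" "\<lambda>x. 0"] zero_mem Q1.q_zero by simp

text \<open>Capacity is the square of a norm, so the estimate is made for norms. The positive parts
  of near-optimal functions have norms at most \<open>d * (1/2)^Suc i\<close>, so their sum
  converges to a function of norm at most d, and this function is at least 1 on every piece.\<close>

lemma cap_Union_small:
  assumes A: "\<And>i. cap (A i) < ennreal ((d * (1/2)^Suc i)\<^sup>2)" and d: "0 < d"
  shows "\<exists>W. open W \<and> (\<Union>i. A i) \<subseteq> W \<and> cap W \<le> ennreal (d\<^sup>2)"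
proof -
  define R where "R i U u \<longleftrightarrow> open U \<and> A i \<subseteq> U \<and> u \<in> D \<and> (AE x in m. x \<in> U \<longrightarrow> 1 \<le> u x)
      \<and> ennreal (Q1 m Q u) < ennreal ((d * (1/2)^Suc i)\<^sup>2)" for i U u
  have "\<exists>U u. R i U u" for i
    by (rule cap_lessD[OF A[of i]]) (auto simp: R_def)
  then obtain U u where "\<And>i. R i (U i) (u i)" by metis
  then have U: "\<And>i. open (U i)" "\<And>i. A i \<subseteq> U i" and u: "\<And>i. u i \<in> D"
      and u1: "\<And>i. AE x in m. x \<in> U i \<longrightarrow> 1 \<le> u i x"
      and Qu: "\<And>i. ennreal (Q1 m Q (u i)) < ennreal ((d * (1/2)^Suc i)\<^sup>2)"
    by (auto simp: R_def)
  define p where "p i x = max 0 (u i x)" for i x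
  have p: "p i \<in> D" for i unfolding p_def by (rule pos_part_mem[OF u])
  have Qp: "sqrt (Q1 m Q (p i)) \<le> d * (1/2)^Suc i" for i
  proof -
    have "Q1 m Q (u i) < (d * (1/2)^Suc i)\<^sup>2"
      using Qu[of i] Q1.nonneg[OF u[of i]] by (simp add: ennreal_less_iff)
    then have "Q1 m Q (p i) \<le> (d * (1/2)^Suc i)\<^sup>2" unfolding p_def using Q1_pos_part[OF u[of i]] by linarith
    then show ?thesis using d by (intro real_le_lsqrt) auto
  qed
  define s where "s n x = (\<Sum>i<n. p i x)" for n x
  have s: "s n \<in> D" for n unfolding s_def by (rule sum_mem) (rule p)
  have close: "sqrt (Q1 m Q (\<lambda>x. s k x - s n x)) \<le> d * (1/2)^n - d * (1/2)^k" if "n \<le> k" for n k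
    using that
  proof (induction k rule: dec_induct)
    case base
    then show ?case using Q1.q_zero by simp
  next
    case (step k)
    have "(\<lambda>x. s (Suc k) x - s n x) = (\<lambda>x. (s k x - s n x) + p k x)" by (auto simp: s_def)
    then have "sqrt (Q1 m Q (\<lambda>x. s (Suc k) x - s n x)) \<le> sqrt (Q1 m Q (\<lambda>x. s k x - s n x)) + sqrt (Q1 m Q (p k))"
      using Q1.triangle[OF diff_mem[OF s[of k] s[of n]] p[of k]] by simp
    then show ?case using step Qp[of k] by simp
  qed
  have pw: "(\<lambda>n. d * (1/2)^n) \<longlonglongrightarrow> d * 0" by (intro tendsto_intros LIMSEQ_power_zero) auto
  have cau: "\<exists>N. \<forall>n\<ge>N. \<forall>k\<ge>N. Q1 m Q (\<lambda>x. s n x - s k x) < e" if "e > 0" for e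
  proof -
    have "\<forall>\<^sub>F n in sequentially. d * (1/2)^n < sqrt e"
      using order_tendstoD(2)[OF pw, of "sqrt e"] that by simp
    then obtain N where N: "\<And>n. n \<ge> N \<Longrightarrow> d * (1/2)^n < sqrt e" unfolding eventually_sequentially by blast
    have le: "Q1 m Q (\<lambda>x. s k x - s n x) < e" if "N \<le> n" "n \<le> k" for n k
    proof -
      have "0 < d * (1/2)^k" using d by simp
      then have "sqrt (Q1 m Q (\<lambda>x. s k x - s n x)) < sqrt e"
        using close[OF that(2)] N[OF that(1)] by linarith
      then show ?thesis by simp
    qed
    show ?thesis
    proof (intro exI[of _ N] allI impI)
      fix n k assume "N \<le> n" "N \<le> k"
      then show "Q1 m Q (\<lambda>x. s n x - s k x) < e"
        using le[of n k] le[of k n] Q1.q_diff_commute[OF s[of n] s[of k]] by (cases "n \<le> k") auto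
    qed
  qed
  obtain S where S: "S \<in> D" and Slim: "(\<lambda>n. Q1 m Q (\<lambda>x. s n x - S x)) \<longlonglongrightarrow> 0"
    using D_complete[OF s cau] by blast
  have sQ: "sqrt (Q1 m Q (s n)) \<le> d" for n
  proof -
    have "sqrt (Q1 m Q (s n)) \<le> d - d * (1/2)^n" using close[of 0 n] by (simp add: s_def[abs_def])
    moreover have "0 < d * (1/2)^n" using d by simp
    ultimately show ?thesis by linarith
  qed
  have "sqrt (Q1 m Q S) \<le> d + sqrt (Q1 m Q (\<lambda>x. s n x - S x))" for n
    using Q1.triangle_sub[OF S s[of n]] sQ[of n] Q1.q_diff_commute[OF S s[of n]] by simp
  moreover have "(\<lambda>n. d + sqrt (Q1 m Q (\<lambda>x. s n x - S x))) \<longlonglongrightarrow> d + sqrt 0"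
    by (intro tendsto_intros Slim)
  ultimately have "sqrt (Q1 m Q S) \<le> d + sqrt 0" by (intro LIMSEQ_le_const) auto
  then have QS: "Q1 m Q S \<le> d\<^sup>2" by (simp add: sqrt_le_D)
  \<comment> \<open>The partial sums increase, so the excess of \<open>s n\<close> over
    \<open>S\<close> is dominated by the distance of \<open>s N\<close> from \<open>S\<close> for
    every larger N, which tends to 0 in L2.\<close>
  have AES: "AE x in m. s n x \<le> S x" for n
  proof -
    let ?w = "\<lambda>x. max 0 (s n x - S x)"
    have w: "?w \<in> D" by (rule pos_part_mem[OF diff_mem[OF s S]])
    have "(\<integral>x. (?w x)\<^sup>2 \<partial>m) \<le> Q1 m Q (\<lambda>x. s N x - S x)" if "n \<le> N" for N
    proof -
      have mono: "s n x \<le> s N x" for x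
        unfolding s_def by (rule sum_mono2) (use that in \<open>auto simp: p_def\<close>)
      have "(\<integral>x. (?w x)\<^sup>2 \<partial>m) \<le> (\<integral>x. (s N x - S x)\<^sup>2 \<partial>m)"
      proof (rule integral_mono)
        show "(?w x)\<^sup>2 \<le> (s N x - S x)\<^sup>2" for x
          using mono[of x] by (auto simp: max_def intro!: power_mono)
      qed (use L2_integrable D_L2 w diff_mem[OF s S] in auto)
      then show ?thesis using L2_le_Q1[OF diff_mem[OF s[of N] S]] by linarith
    qed
    then have "(\<integral>x. (?w x)\<^sup>2 \<partial>m) \<le> 0" by (intro LIMSEQ_le_const[OF Slim]) auto
    then have "AE x in m. ?w x = 0" by (rule L2_eq_zero_AE[OF D_L2[OF w]])
    then show ?thesis by eventually_elim (auto simp: max_def split: if_splits)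
  qed
  have "AE x in m. \<forall>n. s n x \<le> S x" using AES by (simp add: AE_all_countable)
  moreover have "AE x in m. \<forall>i. x \<in> U i \<longrightarrow> 1 \<le> u i x" using u1 by (simp add: AE_all_countable)
  ultimately have "AE x in m. x \<in> (\<Union>i. U i) \<longrightarrow> 1 \<le> S x"
  proof eventually_elim
    case (elim x)
    show ?case
    proof
      assume "x \<in> (\<Union>i. U i)"
      then obtain i where "x \<in> U i" by blast
      then have "1 \<le> p i x" using elim by (auto simp: p_def)
      also have "\<dots> \<le> s (Suc i) x" unfolding s_def by (rule member_le_sum) (auto simp: p_def)
      finally show "1 \<le> S x" using elim order_trans by blast
    qed
  qed
  then have "cap (\<Union>i. U i) \<le> ennreal (Q1 m Q S)"
    using U S by (intro cap_le[of "\<Union>i. U i"]) auto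
  also have "\<dots> \<le> ennreal (d\<^sup>2)" using QS by (rule ennreal_leI)
  finally show ?thesis using U by (intro exI[of _ "\<Union>i. U i"]) auto
qed

text \<open>\<open>P i U\<close> is meant as: the i-th property holds off the open set U.
  Monotonicity in U lets one exceptional set serve for all i, which is how quasi-everywhere
  statements are combined below.\<close>

lemma small_Union:
  fixes P :: "nat \<Rightarrow> 'a set \<Rightarrow> bool"
  assumes small: "\<And>i e. 0 < e \<Longrightarrow> \<exists>U. open U \<and> cap U < ennreal e \<and> P i U"
    and mono: "\<And>i U W. P i U \<Longrightarrow> U \<subseteq> W \<Longrightarrow> P i W" and e: "0 < e"
  shows "\<exists>W. open W \<and> cap W < ennreal e \<and> (\<forall>i. P i W)"
proof -
  \<comment> \<open>The halving turns the bound by \<open>d\<^sup>2\<close> for the union into the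
    strict bound by e.\<close>
  define d where "d = sqrt e / 2"
  have d: "0 < d" "d\<^sup>2 < e" using e by (auto simp: d_def power_divide)
  have "\<exists>U. open U \<and> cap U < ennreal ((d * (1/2)^Suc i)\<^sup>2) \<and> P i U" for i
    by (rule small) (use d(1) in simp)
  then obtain U where U: "\<And>i. open (U i)" "\<And>i. cap (U i) < ennreal ((d * (1/2)^Suc i)\<^sup>2)" "\<And>i. P i (U i)"
    by metis
  obtain W where W: "open W" "(\<Union>i. U i) \<subseteq> W" "cap W \<le> ennreal (d\<^sup>2)"
    using cap_Union_small[OF U(2) d(1)] by blast
  have "cap W < ennreal e" using W(3) d(2) e by (meson ennreal_lessI le_less_trans)
  moreover have "P i W" for i using mono[OF U(3)[of i], of W] W(2) by blast
  ultimately show ?thesis using W(1) by blast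
qed

lemma small_pair:
  assumes "\<And>e. 0 < e \<Longrightarrow> \<exists>U. open U \<and> cap U < ennreal e \<and> P U"
    and "\<And>e. 0 < e \<Longrightarrow> \<exists>U. open U \<and> cap U < ennreal e \<and> R U"
    and mono: "\<And>U W. P U \<Longrightarrow> U \<subseteq> W \<Longrightarrow> P W" "\<And>U W. R U \<Longrightarrow> U \<subseteq> W \<Longrightarrow> R W" and e: "0 < e"
  shows "\<exists>W. open W \<and> cap W < ennreal e \<and> P W \<and> R W"
proof -
  have "\<exists>W. open W \<and> cap W < ennreal e \<and> (\<forall>i::nat. (if i = 0 then P else R) W)"
    by (rule small_Union[OF _ _ e]) (use assms in \<open>auto split: if_splits\<close>)
  then show ?thesis by (metis zero_neq_one)
qed

text \<open>Intersecting exceptional sets whose capacities tend to 0 gives a Borel set of capacity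
  zero, the kind of set that J and k are assumed not to charge.\<close>

lemma small_null:
  assumes "\<And>e. 0 < e \<Longrightarrow> \<exists>U. open U \<and> cap U < ennreal e \<and> (\<forall>x. x \<notin> U \<longrightarrow> R x)"
  obtains N where "N \<in> sets borel" "cap N = 0" "\<And>x. x \<notin> N \<Longrightarrow> R x"
proof -
  have "\<exists>U. open U \<and> cap U < ennreal (inverse (real (Suc n))) \<and> (\<forall>x. x \<notin> U \<longrightarrow> R x)" for n
    by (rule assms) simp
  then obtain U where U: "\<And>n. open (U n)" "\<And>n. cap (U n) < ennreal (inverse (real (Suc n)))"
      "\<And>n x. x \<notin> U n \<Longrightarrow> R x"
    by metis
  have "cap (\<Inter>n. U n) \<le> ennreal (inverse (real (Suc n)))" for n
    using cap_mono[of "\<Inter>n. U n" "U n"] U(2)[of n] by (meson INT_lower UNIV_I le_less_trans less_imp_le)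
  moreover have "(\<lambda>n. ennreal (inverse (real (Suc n)))) \<longlonglongrightarrow> ennreal 0"
    by (intro tendsto_ennrealI LIMSEQ_inverse_real_of_nat)
  ultimately have "cap (\<Inter>n. U n) \<le> ennreal 0" by (intro LIMSEQ_le_const) auto
  then show ?thesis using that[of "\<Inter>n. U n"] U by auto
qed

section \<open>Quasi-continuous versions\<close>

lemma qc_cont: "continuous_on UNIV f \<Longrightarrow> qc f"
  unfolding quasi_continuous_def using cap_empty by (auto intro!: exI[of _ "{}"])

lemma qcD: "qc f \<Longrightarrow> 0 < e \<Longrightarrow> \<exists>U. open U \<and> cap U < ennreal e \<and> continuous_on (- U) f"
  by (auto simp: quasi_continuous_def)

lemma continuous_on_Compl_mono: "continuous_on (- U) f \<Longrightarrow> U \<subseteq> W \<Longrightarrow> continuous_on (- W) f"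
  by (erule continuous_on_subset) auto

lemma qc_pair:
  assumes "qc f" "qc g" "0 < e"
  shows "\<exists>U. open U \<and> cap U < ennreal e \<and> continuous_on (- U) f \<and> continuous_on (- U) g"
  by (rule small_pair[OF qcD[OF assms(1)] qcD[OF assms(2)] _ _ assms(3)])
     (auto intro: continuous_on_Compl_mono)

lemma qc_comp2:
  assumes "qc f" "qc g"
    and "\<And>S. continuous_on S f \<Longrightarrow> continuous_on S g \<Longrightarrow> continuous_on S (\<lambda>x. h (f x) (g x))"
  shows "qc (\<lambda>x. h (f x) (g x))"
  unfolding quasi_continuous_def using qc_pair[OF assms(1,2)] assms(3) by meson

lemma qc_add: "qc f \<Longrightarrow> qc g \<Longrightarrow> qc (\<lambda>x. f x + g x)"
  by (rule qc_comp2) (auto intro: continuous_intros)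

lemma qc_diff: "qc f \<Longrightarrow> qc g \<Longrightarrow> qc (\<lambda>x. f x - g x)"
  by (rule qc_comp2) (auto intro: continuous_intros)

lemma qc_scale: "qc f \<Longrightarrow> qc (\<lambda>x. c * f x)"
  by (rule qc_comp2[where h = "\<lambda>a b. c * a" and g = f]) (auto intro: continuous_intros)

lemma qc_max: "qc f \<Longrightarrow> qc g \<Longrightarrow> qc (\<lambda>x. max (f x) (g x))"
  by (rule qc_comp2) (auto intro: continuous_intros)

lemma qc_min: "qc f \<Longrightarrow> qc g \<Longrightarrow> qc (\<lambda>x. min (f x) (g x))"
  by (rule qc_comp2) (auto intro: continuous_intros)

text \<open>Take a fast sequence of continuous approximations. By a Chebyshev bound for the
  capacity, its increments exceed (1/2)^n only on open sets of rapidly decreasing capacity, and off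
  the union of a tail of these sets the convergence is uniform.\<close>

lemma qc_exists:
  assumes u: "u \<in> D"
  obtains f where "f \<in> borel_measurable borel" "qc f" "AE x in m. f x = u x"
proof -
  \<comment> \<open>With these distances the increments have norm at most (1/8)^(n+1) / 2. The
    factor 2^n of the Chebyshev bound and the factor 4 from \<open>Q1_abs\<close> then still leave
    (1/4)^(n+1) as a bound for the root of the capacity of \<open>G n\<close>.\<close>
  define c :: "nat \<Rightarrow> real" where "c n = (1/8)^Suc n / 4" for n
  have c0: "0 < c n" for n by (simp add: c_def)
  have "\<exists>v. v \<in> D \<and> v \<in> Cc \<and> Q1 m Q (\<lambda>x. u x - v x) < (c n)\<^sup>2" for n
    using regular_dense[OF u, of "(c n)\<^sup>2"] c0[of n] by auto
  then obtain v where v: "\<And>n. v n \<in> D" "\<And>n. v n \<in> Cc" "\<And>n. Q1 m Q (\<lambda>x. u x - v n x) < (c n)\<^sup>2"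
    by metis
  have vs: "sqrt (Q1 m Q (\<lambda>x. u x - v n x)) \<le> c n" for n
    using v(3)[of n] c0[of n] by (intro real_le_lsqrt) auto
  define w where "w n x = v (Suc n) x - v n x" for n x
  have w: "w n \<in> D" for n unfolding w_def by (intro diff_mem v)
  have wQ: "sqrt (Q1 m Q (w n)) \<le> (1/8)^Suc n / 2" for n
  proof -
    have "w n = (\<lambda>x. (u x - v n x) - (u x - v (Suc n) x))" by (auto simp: w_def)
    then have "sqrt (Q1 m Q (w n)) \<le> c n + c (Suc n)"
      using Q1.triangle_diff[OF diff_mem[OF u v(1)[of n]] diff_mem[OF u v(1)[of "Suc n"]]] vs[of n] vs[of "Suc n"]
      by simp
    also have "\<dots> \<le> (1/8)^Suc n / 2" by (simp add: c_def)
    finally show ?thesis .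
  qed
  define G where "G n = {x. (1/2)^n < \<bar>w n x\<bar>}" for n
  have wc: "continuous_on UNIV (w n)" for n
    unfolding w_def by (intro continuous_intros Cc_cont v)
  have G: "open (G n)" for n
    unfolding G_def by (intro open_Collect_less continuous_intros wc)
  have capG: "cap (G n) \<le> ennreal (((1/4)^Suc n)\<^sup>2)" for n
  proof -
    have "cap (G n) \<le> ennreal (Q1 m Q (\<lambda>x. 2^n * \<bar>w n x\<bar>))"
      by (rule cap_le[OF G order_refl scale_mem[OF abs_mem[OF w]]])
         (auto simp: G_def field_simps power_one_over intro!: AE_I2)
    also have "\<dots> \<le> ennreal (((1/4)^Suc n)\<^sup>2)"
    proof (rule ennreal_leI)
      have "Q1 m Q (\<lambda>x. 2^n * \<bar>w n x\<bar>) \<le> (2^n)\<^sup>2 * (4 * Q1 m Q (w n))"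
        unfolding Q1.hom[OF abs_mem[OF w]] by (rule mult_left_mono[OF Q1_abs[OF w]]) simp
      also have "Q1 m Q (w n) \<le> ((1/8)^Suc n / 2)\<^sup>2" by (rule sqrt_le_D[OF wQ])
      also have "(2^n)\<^sup>2 * (4 * ((1/8)^Suc n / 2)\<^sup>2) = (2^n * (1/8)^Suc n :: real)\<^sup>2"
        by (simp add: power_mult_distrib power_divide)
      also have "\<dots> \<le> ((1/4)^Suc n)\<^sup>2"
      proof (rule power_mono)
        have "2^n * (1/8)^n = (2 * (1/8::real))^n" by (rule power_mult_distrib[symmetric])
        then show "2^n * (1/8)^Suc n \<le> (1/4::real)^Suc n" by simp
      qed simp
      finally show "Q1 m Q (\<lambda>x. 2^n * \<bar>w n x\<bar>) \<le> ((1/4)^Suc n)\<^sup>2" by simp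
    qed
    finally show ?thesis .
  qed
  \<comment> \<open>\<open>lim\<close> takes one fixed default value where the sequence diverges, so
    f is Borel on the whole space and can be integrated against J and k.\<close>
  define f where "f x = lim (\<lambda>n. v n x)" for x
  have fmeas: "f \<in> borel_measurable borel"
    unfolding f_def using D_borel[OF v(1)] by (intro borel_measurable_lim_metric)
  have "qc f"
    unfolding quasi_continuous_def
  proof (intro allI impI)
    fix e :: real assume e: "0 < e"
    have "(\<lambda>n. 2 * (1/2)^n) \<longlonglongrightarrow> 2 * (0::real)" by (intro tendsto_intros LIMSEQ_power_zero) auto
    then have "(\<lambda>n. (2 * (1/2)^n)\<^sup>2) \<longlonglongrightarrow> (2 * (0::real))\<^sup>2" by (rule tendsto_power)
    then have "\<forall>\<^sub>F n in sequentially. (2 * (1/2)^n)\<^sup>2 < e" using e by (intro order_tendstoD(2)) auto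
    then obtain N where N: "(2 * (1/2)^N)\<^sup>2 < e" unfolding eventually_sequentially by blast
    \<comment> \<open>The radius 2 (1/2)^N fits \<open>cap_Union_small\<close>: its share with
      weight (1/2)^(i+1) is (1/2)^(N+i), which exceeds the bound (1/4)^(N+i+1) for the root of the
      capacity.\<close>
    have "cap (G (N + i)) < ennreal ((2 * (1/2)^N * (1/2)^Suc i)\<^sup>2)" for i
    proof -
      have "(1/4::real)^Suc (N + i) < (1/2)^(N + i)"
      proof -
        have "(1/4::real)^Suc (N + i) \<le> (1/2)^Suc (N + i)" by (rule power_mono) auto
        also have "\<dots> < (1/2)^(N + i)" by simp
        finally show ?thesis .
      qed
      then have "((1/4::real)^Suc (N + i))\<^sup>2 < ((1/2)^(N + i))\<^sup>2" by (intro power_strict_mono) auto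
      also have "(1/2::real)^(N + i) = 2 * (1/2)^N * (1/2)^Suc i" by (simp add: power_add)
      finally show ?thesis using capG[of "N + i"] by (meson ennreal_lessI le_less_trans zero_le_power2 order.strict_trans1)
    qed
    then obtain W where W: "open W" "(\<Union>i. G (N + i)) \<subseteq> W" "cap W \<le> ennreal ((2 * (1/2)^N)\<^sup>2)"
      using cap_Union_small[of "\<lambda>i. G (N + i)" "2 * (1/2)^N"] by auto
    have "cap W < ennreal e" using W(3) N e by (meson ennreal_lessI le_less_trans)
    moreover have "continuous_on (- W) f"
    proof -
      have sm: "summable (\<lambda>i. (1/2::real)^(N + i))" by (simp add: power_add summable_mult)
      have bd: "norm (w (N + i) x) \<le> (1/2)^(N + i)" if "x \<in> - W" for i x
      proof -
        have "x \<notin> G (N + i)" using that W(2) by blast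
        then show ?thesis unfolding G_def mem_Collect_eq real_norm_def by (rule leI)
      qed
      have ul: "uniform_limit (- W) (\<lambda>n x. \<Sum>i<n. w (N + i) x) (\<lambda>x. suminf (\<lambda>i. w (N + i) x)) sequentially"
        by (rule Weierstrass_m_test[OF bd sm])
      have co: "continuous_on (- W) (\<lambda>x. suminf (\<lambda>i. w (N + i) x))"
        by (rule uniform_limit_theorem[OF _ ul])
           (auto intro!: always_eventually continuous_intros continuous_on_subset[OF wc])
      have tele: "(\<Sum>i<n. w (N + i) x) = v (N + n) x - v N x" for n x
        by (induction n) (auto simp: w_def)
      have feq: "f x = v N x + suminf (\<lambda>i. w (N + i) x)" if "x \<in> - W" for x
      proof -
        have "(\<lambda>n. \<Sum>i<n. w (N + i) x) \<longlonglongrightarrow> suminf (\<lambda>i. w (N + i) x)"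
          by (rule tendsto_uniform_limitI[OF ul that])
        then have "(\<lambda>n. v (n + N) x - v N x) \<longlonglongrightarrow> suminf (\<lambda>i. w (N + i) x)"
          unfolding tele by (simp add: add.commute)
        then have "(\<lambda>n. v N x + (v (n + N) x - v N x)) \<longlonglongrightarrow> v N x + suminf (\<lambda>i. w (N + i) x)"
          by (intro tendsto_intros)
        then have "(\<lambda>n. v n x) \<longlonglongrightarrow> v N x + suminf (\<lambda>i. w (N + i) x)"
          by (simp add: LIMSEQ_offset[of _ N])
        then show ?thesis unfolding f_def by (rule limI)
      qed
      have "continuous_on (- W) (\<lambda>x. v N x + suminf (\<lambda>i. w (N + i) x))"
        by (intro continuous_intros co continuous_on_subset[OF Cc_cont[OF v(2)]]) auto
      then show ?thesis by (rule continuous_on_eq) (simp add: feq)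
    qed
    ultimately show "\<exists>G. open G \<and> cap G < ennreal e \<and> continuous_on (- G) f" using W(1) by blast
  qed
  \<comment> \<open>Norm convergence alone gives no pointwise convergence. Here the squared L2
    errors are summable, so the series of squared errors is finite almost everywhere and the
    approximations converge to u there.\<close>
  moreover have "AE x in m. f x = u x"
  proof -
    have [measurable]: "(\<lambda>x. (u x - v n x)\<^sup>2) \<in> borel_measurable m" for n
      using D_meas[OF u] D_meas[OF v(1)[of n]] by measurable
    have "(\<integral>\<^sup>+x. (\<Sum>n. ennreal ((u x - v n x)\<^sup>2)) \<partial>m) = (\<Sum>n. \<integral>\<^sup>+x. ennreal ((u x - v n x)\<^sup>2) \<partial>m)"
      by (rule nn_integral_suminf) measurable
    also have "\<dots> \<le> (\<Sum>n. ennreal ((1/2)^n))"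
    proof (rule suminf_le)
      fix n
      have "(\<integral>\<^sup>+x. ennreal ((u x - v n x)\<^sup>2) \<partial>m) = ennreal (\<integral>x. (u x - v n x)\<^sup>2 \<partial>m)"
        by (rule nn_integral_eq_integral[OF L2_integrable[OF D_L2[OF diff_mem[OF u v(1)]]]]) simp
      also have "\<dots> \<le> ennreal ((1/2)^n)"
      proof (rule ennreal_leI)
        have "(\<integral>x. (u x - v n x)\<^sup>2 \<partial>m) \<le> (c n)\<^sup>2"
          using L2_le_Q1[OF diff_mem[OF u v(1)[of n]]] v(3)[of n] by linarith
        also have "\<dots> \<le> c n"
        proof -
          have "(1/8::real)^Suc n \<le> 1" by (rule power_le_one) auto
          then have "c n \<le> 1" by (simp add: c_def)
          then show ?thesis using c0[of n] by (simp add: power2_eq_square mult_left_le)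
        qed
        also have "\<dots> \<le> (1/8)^n" by (simp add: c_def)
        also have "\<dots> \<le> (1/2)^n" by (rule power_mono) auto
        finally show "(\<integral>x. (u x - v n x)\<^sup>2 \<partial>m) \<le> (1/2)^n" .
      qed
      finally show "(\<integral>\<^sup>+x. ennreal ((u x - v n x)\<^sup>2) \<partial>m) \<le> ennreal ((1/2)^n)" .
    qed auto
    also have "(\<Sum>n. ennreal ((1/2)^n)) = ennreal (\<Sum>n. (1/2)^n)"
      by (rule suminf_ennreal2) (simp, rule summable_geometric, simp)
    also have "\<dots> < \<infinity>" unfolding infinity_ennreal_def by (rule ennreal_less_top)
    finally have "AE x in m. (\<Sum>n. ennreal ((u x - v n x)\<^sup>2)) \<noteq> \<infinity>"
      by (intro nn_integral_PInf_AE) auto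
    then show ?thesis
    proof eventually_elim
      case (elim x)
      then have "summable (\<lambda>n. (u x - v n x)\<^sup>2)"
        by (intro summable_suminf_not_top) auto
      then have "(\<lambda>n. (u x - v n x)\<^sup>2) \<longlonglongrightarrow> 0" by (rule summable_LIMSEQ_zero)
      then have "(\<lambda>n. sqrt ((u x - v n x)\<^sup>2)) \<longlonglongrightarrow> sqrt 0" by (rule tendsto_real_sqrt)
      then have "(\<lambda>n. u x - v n x) \<longlonglongrightarrow> 0" by (simp add: tendsto_rabs_zero_iff)
      then have "(\<lambda>n. u x - (u x - v n x)) \<longlonglongrightarrow> u x - 0" by (intro tendsto_intros)
      then show ?case unfolding f_def by (intro limI) simp
    qed
  qed
  ultimately show ?thesis using that fmeas by blast
qed

text \<open>An open set may be enlarged by all open sets that are m-almost contained in it without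
  changing its capacity; off the enlarged set, almost everywhere equality becomes equality.\<close>

lemma qc_unique:
  assumes f: "qc f" and g: "qc g" and G: "open G" and ae: "AE x in m. x \<in> G \<longrightarrow> f x = g x" and e: "0 < e"
  shows "\<exists>U. open U \<and> cap U < ennreal e \<and> (\<forall>x. x \<notin> U \<longrightarrow> x \<in> G \<longrightarrow> f x = g x)"
proof -
  obtain U where U: "open U" "cap U < ennreal e" "continuous_on (- U) f" "continuous_on (- U) g"
    using qc_pair[OF f g e] by blast
  define F where "F = {V. open V \<and> emeasure m (V \<inter> - U) = 0}"
  define W where "W = \<Union>F"
  have W: "open W" "U \<subseteq> W" unfolding W_def F_def using U(1) by auto
  have null: "emeasure m (W \<inter> - U) = 0"
    unfolding W_def by (rule null_Union_open[OF sets_m]) (use U(1) in \<open>auto simp: F_def\<close>)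
  then have "W \<inter> - U \<in> null_sets m" using U(1) W(1) by (auto simp: null_sets_def sets_m)
  then have aeU: "AE x in m. x \<in> W \<longrightarrow> x \<in> U" by (auto dest!: AE_not_in elim!: eventually_mono)
  have "cap W < ennreal e"
  proof -
    obtain U' u where U': "open U'" "U \<subseteq> U'" "u \<in> D" "AE x in m. x \<in> U' \<longrightarrow> 1 \<le> u x" "ennreal (Q1 m Q u) < ennreal e"
      by (rule cap_lessD[OF U(2)])
    have "AE x in m. x \<in> W \<longrightarrow> 1 \<le> u x" using U'(4) aeU by eventually_elim (use U'(2) in auto)
    then have "cap W \<le> ennreal (Q1 m Q u)" using W(1) U'(3) by (intro cap_le[of W]) auto
    then show ?thesis using U'(5) by (rule le_less_trans)
  qed
  moreover have "f x = g x" if x: "x \<notin> W" "x \<in> G" for x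
  \<comment> \<open>If f and g differed at x, continuity off U would give an open V around x on
    which they differ off U. Then V \<inter> G is null off U, hence one of the sets united in W,
    although x lies outside W.\<close>
  proof (rule ccontr)
    assume ne: "f x \<noteq> g x"
    have "continuous_on (- U) (\<lambda>x. f x - g x)" using U(3,4) by (intro continuous_intros)
    then obtain V where V: "open V" "V \<inter> - U = (\<lambda>x. f x - g x) -` (- {0}) \<inter> - U"
      unfolding continuous_on_open_invariant by (metis open_Compl closed_singleton)
    have "x \<in> V" using V(2) x(1) W(2) ne by auto
    have "AE x in m. x \<notin> (V \<inter> G) \<inter> - U" using ae by eventually_elim (use V(2) in auto)
    then have "emeasure m ((V \<inter> G) \<inter> - U) = 0"
      by (subst AE_iff_measurable[symmetric, where P = "\<lambda>x. x \<notin> (V \<inter> G) \<inter> - U"])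
         (use V(1) G U(1) in \<open>auto simp: space_m sets_m\<close>)
    then have "V \<inter> G \<in> F" using V(1) G by (auto simp: F_def)
    then show False using x \<open>x \<in> V\<close> by (auto simp: W_def)
  qed
  ultimately show ?thesis using W(1) by blast
qed

lemma qc_unique_null:
  assumes "qc f" "qc g" "open G" "AE x in m. x \<in> G \<longrightarrow> f x = g x"
  obtains N where "N \<in> sets borel" "cap N = 0" "\<And>x. x \<notin> N \<Longrightarrow> x \<in> G \<Longrightarrow> f x = g x"
  using small_null[OF qc_unique[OF assms]] by metis

end

section \<open>Energy measures\<close>

lemma L2_conv_mono:
  assumes L: "\<And>k. L2 m (\<lambda>x. us k x - u x)" and lim: "(\<lambda>k. \<integral>x. (us k x - u x)\<^sup>2 \<partial>m) \<longlonglongrightarrow> 0"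
    and w: "\<And>k. ws k \<in> borel_measurable m" "w \<in> borel_measurable m"
    and le: "\<And>k. AE x in m. \<bar>ws k x - w x\<bar> \<le> \<bar>us k x - u x\<bar>"
  shows "(\<lambda>k. \<integral>x. (ws k x - w x)\<^sup>2 \<partial>m) \<longlonglongrightarrow> 0"
proof (rule tendsto_sandwich[where f = "\<lambda>_. 0" and h = "\<lambda>k. \<integral>x. (us k x - u x)\<^sup>2 \<partial>m"])
  have "(\<integral>x. (ws k x - w x)\<^sup>2 \<partial>m) \<le> (\<integral>x. (us k x - u x)\<^sup>2 \<partial>m)" for k
  proof (rule integral_mono_AE)
    have "L2 m (\<lambda>x. ws k x - w x)" by (rule L2_dominated[OF L _ le]) (use w in auto)
    then show "integrable m (\<lambda>x. (ws k x - w x)\<^sup>2)" by (rule L2_integrable)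
    show "AE x in m. (ws k x - w x)\<^sup>2 \<le> (us k x - u x)\<^sup>2"
      using le[of k] by eventually_elim (simp only: abs_le_square_iff)
  qed (rule L2_integrable[OF L])
  then show "\<forall>\<^sub>F k in sequentially. (\<integral>x. (ws k x - w x)\<^sup>2 \<partial>m) \<le> (\<integral>x. (us k x - u x)\<^sup>2 \<partial>m)"
    by (intro always_eventually allI)
qed (use lim in auto)

context dform
begin

lemma weak_lsc_lim:
  assumes q: "quad_form D q" and q_le: "\<And>v. v \<in> D \<Longrightarrow> q v \<le> Q1 m Q v"
    and us: "\<And>k. us k \<in> D" and bd: "\<And>k. Q (us k) (us k) \<le> C"
    and u: "L2 m u" and lim: "(\<lambda>k. \<integral>x. (us k x - u x)\<^sup>2 \<partial>m) \<longlonglongrightarrow> 0"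
    and qb: "\<And>k. q (us k) \<le> b k" and b: "b \<longlonglongrightarrow> B"
  shows "q u \<le> B"
proof (rule field_le_epsilon)
  fix e :: real assume "0 < e"
  then have "\<forall>\<^sub>F k in sequentially. b k < B + e" by (intro order_tendstoD(2)[OF b]) simp
  then obtain N where N: "\<And>k. N \<le> k \<Longrightarrow> b k < B + e" unfolding eventually_sequentially by blast
  show "q u \<le> B + e"
  proof (rule weak_lsc(2)[OF q q_le, of "\<lambda>k. us (k + N)"])
    show "(\<lambda>k. \<integral>x. (us (k + N) x - u x)\<^sup>2 \<partial>m) \<longlonglongrightarrow> 0"
      by (rule LIMSEQ_ignore_initial_segment[OF lim])
    show "q (us (k + N)) \<le> B + e" for k using qb[of "k + N"] N[of "k + N"] by simp
  qed (use us bd u in auto)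
qed

lemma Q1_lim_L2:
  assumes us: "\<And>k. us k \<in> D" and u: "u \<in> D" and lim: "(\<lambda>k. Q1 m Q (\<lambda>x. us k x - u x)) \<longlonglongrightarrow> 0"
  shows "(\<lambda>k. \<integral>x. (us k x - u x)\<^sup>2 \<partial>m) \<longlonglongrightarrow> 0"
  by (rule tendsto_sandwich[where f = "\<lambda>_. 0", OF _ _ _ lim])
     (use L2_le_Q1[OF diff_mem[OF us u]] in \<open>auto intro!: always_eventually\<close>)

lemma Q1_lim_bounded:
  assumes us: "\<And>k. us k \<in> D" and u: "u \<in> D" and lim: "(\<lambda>k. Q1 m Q (\<lambda>x. us k x - u x)) \<longlonglongrightarrow> 0"
  obtains C where "\<And>k. Q (us k) (us k) \<le> C"
proof -
  obtain B where B: "\<And>k. Q1 m Q (\<lambda>x. us k x - u x) \<le> B"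
  proof -
    obtain K where "\<And>k. norm (Q1 m Q (\<lambda>x. us k x - u x)) \<le> K"
      using convergent_imp_Bseq[OF convergentI[OF lim]] unfolding Bseq_def by blast
    then show ?thesis using that[of K] by (simp add: abs_le_iff)
  qed
  have "Q (us k) (us k) \<le> 2 * B + 2 * Q u u" for k
    using Q.q_add_le[OF diff_mem[OF us[of k] u] u] Q_le_Q1[of "\<lambda>x. us k x - u x"] B[of k] by simp
  then show ?thesis using that by blast
qed

end

locale bform = rform m Q D
  for m :: "'a::{metric_space, second_countable_topology} measure"
    and Q :: "('a \<Rightarrow> real) \<Rightarrow> ('a \<Rightarrow> real) \<Rightarrow> real" and D :: "('a \<Rightarrow> real) set" +
  fixes mu :: "('a \<Rightarrow> real) \<Rightarrow> 'a measure" and J :: "('a \<times> 'a) measure" and k :: "'a measure"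
  assumes bd: "beurling_deny m Q D mu J k"
begin

abbreviation "em u \<equiv> measure (mu u)"

lemma
  shows sets_J: "sets J = sets borel"
    and J_sym: "\<forall>A\<in>sets J. emeasure J ((\<lambda>p. (snd p, fst p)) -` A) = emeasure J A"
    and sets_k: "sets k = sets borel"
    and cap_null: "\<forall>N\<in>sets borel. cap N = 0 \<longrightarrow> emeasure k N = 0 \<and> emeasure J (N \<times> UNIV) = 0"
    and mu_all: "\<forall>u\<in>D. sets (mu u) = sets borel \<and> emeasure (mu u) UNIV < \<infinity>"
    and mu_par: "\<forall>u\<in>D. \<forall>v\<in>D. \<forall>A\<in>sets borel.
        emeasure (mu (\<lambda>x. u x + v x)) A + emeasure (mu (\<lambda>x. u x - v x)) A
          = 2 * emeasure (mu u) A + 2 * emeasure (mu v) A"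
    and mu_hom: "\<forall>u\<in>D. \<forall>c. \<forall>A\<in>sets borel. emeasure (mu (\<lambda>x. c * u x)) A = ennreal (c\<^sup>2) * emeasure (mu u) A"
    and bd_formula_all: "\<forall>u\<in>D. \<forall>f. qc f \<and> (AE x in m. f x = u x) \<longrightarrow>
        ennreal (Q u u) = emeasure (mu u) UNIV
          + (\<integral>\<^sup>+p. ennreal ((f (fst p) - f (snd p))\<^sup>2) \<partial>J)
          + (\<integral>\<^sup>+x. ennreal ((f x)\<^sup>2) \<partial>k)"
    and Qc_local: "\<forall>u\<in>D \<inter> Cc. \<forall>v\<in>D \<inter> Cc.
        (\<exists>U c. open U \<and> closure {x. u x \<noteq> 0} \<subseteq> U \<and> (\<forall>x\<in>U. v x = c)) \<longrightarrow> Qc mu u v = 0"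
    and mu_integral: "\<forall>u\<in>D. \<forall>phi\<in>D \<inter> Cc. (\<exists>C. AE x in m. \<bar>u x\<bar> \<le> C) \<longrightarrow>
        (\<integral>x. phi x \<partial>mu u) = Qc mu (\<lambda>x. u x * phi x) u - Qc mu (\<lambda>x. (u x)\<^sup>2) phi / 2"
  using bd unfolding beurling_deny_def by - (elim conjE, assumption)+

lemma sets_mu: "u \<in> D \<Longrightarrow> sets (mu u) = sets borel"
  using mu_all by blast

lemma space_mu: "u \<in> D \<Longrightarrow> space (mu u) = UNIV"
  using sets_eq_imp_space_eq[OF sets_mu] by simp

lemma mu_finite: "u \<in> D \<Longrightarrow> finite_measure (mu u)"
  using mu_all space_mu by (intro finite_measureI) (auto simp: less_top)

lemma mu_measure: "u \<in> D \<Longrightarrow> emeasure (mu u) A = ennreal (em u A)"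
  using finite_measure.emeasure_eq_measure[OF mu_finite] by blast

lemma bd_formula:
  assumes "u \<in> D" "qc f" "AE x in m. f x = u x"
  shows "ennreal (Q u u) = emeasure (mu u) UNIV
          + (\<integral>\<^sup>+p. ennreal ((f (fst p) - f (snd p))\<^sup>2) \<partial>J)
          + (\<integral>\<^sup>+x. ennreal ((f x)\<^sup>2) \<partial>k)"
  using bd_formula_all assms by blast

lemma em_quad:
  assumes A: "A \<in> sets borel"
  shows "quad_form D (\<lambda>u. em u A)"
proof
  fix u v :: "'a \<Rightarrow> real" and c :: real
  assume u: "u \<in> D"
  show "0 \<le> em u A" by simp
  have "emeasure (mu (\<lambda>x. c * u x)) A = ennreal (c\<^sup>2) * emeasure (mu u) A"
    using mu_hom u A by blast
  then show "em (\<lambda>x. c * u x) A = c\<^sup>2 * em u A"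
    unfolding mu_measure[OF u] mu_measure[OF scale_mem[OF u]]
    by (simp add: ennreal_mult[symmetric])
  assume v: "v \<in> D"
  have "emeasure (mu (\<lambda>x. u x + v x)) A + emeasure (mu (\<lambda>x. u x - v x)) A
          = 2 * emeasure (mu u) A + 2 * emeasure (mu v) A"
    using mu_par u v A by blast
  then have "ennreal (em (\<lambda>x. u x + v x) A + em (\<lambda>x. u x - v x) A)
          = ennreal (2 * em u A + 2 * em v A)"
    unfolding mu_measure[OF u] mu_measure[OF v] mu_measure[OF add_mem[OF u v]] mu_measure[OF diff_mem[OF u v]]
    by (simp add: ennreal_mult)
  then show "em (\<lambda>x. u x + v x) A + em (\<lambda>x. u x - v x) A
          = 2 * em u A + 2 * em v A"
    by (subst (asm) ennreal_inj) auto
qed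

lemma em_le_Q:
  assumes u: "u \<in> D"
  shows "em u A \<le> Q u u"
proof -
  obtain f where f: "qc f" "AE x in m. f x = u x" by (rule qc_exists[OF u])
  have "ennreal (em u A) \<le> emeasure (mu u) UNIV"
    unfolding mu_measure[OF u, symmetric] using emeasure_space[of "mu u" A] space_mu[OF u] by simp
  also have "\<dots> \<le> ennreal (Q u u)" unfolding bd_formula[OF u f] by (simp add: add.assoc)
  finally show ?thesis using Q.nonneg[OF u] by simp
qed

text \<open>This domination admits \<open>\<lambda>u. em u A\<close> as the form \<open>q\<close> in
  \<open>weak_lsc\<close> for every Borel set A. It is how statements about energy measures pass
  from continuous functions to D.\<close>

lemma em_le_Q1: "u \<in> D \<Longrightarrow> em u A \<le> Q1 m Q u"
  using em_le_Q[of u A] Q_le_Q1[of u] by linarith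

lemma em_mono: "u \<in> D \<Longrightarrow> A \<subseteq> B \<Longrightarrow> B \<in> sets borel \<Longrightarrow> em u A \<le> em u B"
  using finite_measure.finite_measure_mono[OF mu_finite] sets_mu by metis

section \<open>Strong locality and contraction properties of the energy measures\<close>

lemma em_locally_null:
  assumes u: "u \<in> D" and loc: "\<And>x. x \<in> U \<Longrightarrow> \<exists>V. open V \<and> x \<in> V \<and> em u V = 0"
  shows "em u U = 0"
proof -
  have "U \<subseteq> \<Union>{V. open V \<and> em u V = 0}" using loc by blast
  moreover have "emeasure (mu u) (\<Union>{V. open V \<and> em u V = 0} \<inter> UNIV) = 0"
    by (rule null_Union_open[OF sets_mu[OF u]]) (auto simp: mu_measure[OF u])
  ultimately have "emeasure (mu u) U \<le> 0"
    using emeasure_mono[of U "\<Union>{V. open V \<and> em u V = 0}" "mu u"] sets_mu[OF u]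
    by (auto intro!: borel_open open_Union)
  then show ?thesis by (simp add: mu_measure[OF u])
qed

lemma Qc_localD:
  assumes "u \<in> D" "u \<in> Cc" "v \<in> D" "v \<in> Cc" "open U" "closure {x. u x \<noteq> 0} \<subseteq> U" "\<And>x. x \<in> U \<Longrightarrow> v x = c"
  shows "Qc mu u v = 0"
proof -
  have "\<exists>U c. open U \<and> closure {x. u x \<noteq> 0} \<subseteq> U \<and> (\<forall>x\<in>U. v x = c)"
    using assms(5-7) by (intro exI[of _ U] exI[of _ c]) auto
  then show ?thesis using Qc_local[THEN bspec, THEN bspec, THEN mp, of u v] assms(1-4) by simp
qed

text \<open>For a cutoff phi supported in U the product v phi equals c phi, so the integral identity
  expresses the integral of phi through Q^(c)(phi, v) and Q^(c)(v^2, phi). Both vanish by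
  \<open>Qc_local\<close>, as v and v^2 are constant near the support of phi.\<close>

lemma em_local_Cc:
  assumes v: "v \<in> D" "v \<in> Cc" and U: "open U" "\<And>x. x \<in> U \<Longrightarrow> v x = c"
  shows "em v U = 0"
proof -
  interpret e: quad_form D "\<lambda>u. em u UNIV" by (rule em_quad) simp
  have Qc_polar: "Qc mu = polar (\<lambda>u. em u UNIV)"
    by (auto simp: Qc_def polar_def fun_eq_iff)
  obtain M where M: "\<And>x. \<bar>v x\<bar> \<le> M" using Cc_bounded[OF v(2)] by blast
  have v2: "(\<lambda>x. (v x)\<^sup>2) \<in> D" by (rule square_mem[OF v(1) M])
  have v2c: "(\<lambda>x. (v x)\<^sup>2) \<in> Cc" by (rule Cc_comp[OF v(2)]) (auto intro!: continuous_intros Cc_cont[OF v(2)])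
  have "\<exists>V. open V \<and> x \<in> V \<and> em v V = 0" if "x \<in> U" for x
  proof -
    have xU: "{x} \<subseteq> U" using that by simp
    obtain phi V where p: "phi \<in> D" "phi \<in> Cc" "\<forall>x. 0 \<le> phi x" "\<forall>x. phi x \<le> 1" "open V" "{x} \<subseteq> V"
        "\<forall>x\<in>V. phi x = 1" "closure {x. phi x \<noteq> 0} \<subseteq> U"
      by (rule cutoff[OF compact_sing U(1) xU])
    have pU: "phi x = 0" if "x \<notin> U" for x using p(8) that closure_subset[of "{x. phi x \<noteq> 0}"] by blast
    have vphi: "(\<lambda>x. v x * phi x) = (\<lambda>x. c * phi x)" using pU U(2) by (metis mult_zero_right)
    have Qphi: "Qc mu phi v = 0" by (rule Qc_localD[OF p(1,2) v U(1) p(8) U(2)])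
    have Qphi2: "Qc mu phi (\<lambda>x. (v x)\<^sup>2) = 0"
      by (rule Qc_localD[OF p(1,2) v2 v2c U(1) p(8), where c = "c\<^sup>2"]) (simp add: U(2))
    have 0: "(\<integral>x. phi x \<partial>mu v) = 0"
    proof -
      have "\<exists>C. AE x in m. \<bar>v x\<bar> \<le> C" using M by (intro exI[of _ M]) simp
      then have "(\<integral>x. phi x \<partial>mu v) = Qc mu (\<lambda>x. v x * phi x) v - Qc mu (\<lambda>x. (v x)\<^sup>2) phi / 2"
        using mu_integral[THEN bspec, THEN bspec, THEN mp, of v phi] v(1) p(1,2) by simp
      then show ?thesis
        using vphi Qphi Qphi2 e.polar_scale[OF p(1) v(1), of c] e.polar_commute[OF v2 p(1)]
        unfolding Qc_polar by simp
    qed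
    have int: "integrable (mu v) phi"
    proof (rule finite_measure.integrable_const_bound[OF mu_finite[OF v(1)], where B = 1])
      show "phi \<in> borel_measurable (mu v)"
        using D_borel[OF p(1)] measurable_cong_sets[OF sets_mu[OF v(1)] refl] by blast
    qed (use p(3,4) in auto)
    have "em v V = (\<integral>x. indicator V x \<partial>mu v)" using space_mu[OF v(1)] by simp
    also have "\<dots> \<le> (\<integral>x. phi x \<partial>mu v)"
    proof (rule integral_mono[OF _ int])
      show "integrable (mu v) (indicator V :: _ \<Rightarrow> real)"
        using p(5) sets_mu[OF v(1)] mu_measure[OF v(1)] by (auto simp: ennreal_less_top)
      show "indicator V x \<le> phi x" for x using p(3,7) by (auto simp: indicator_def)
    qed
    finally have "em v V = 0" using 0 by (simp add: measure_le_0_iff)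
    then show ?thesis using p(5,6) by blast
  qed
  then show ?thesis by (rule em_locally_null[OF v(1)])
qed

text \<open>Subtracting from v its clip to [- r, r] gives a function that vanishes on an open
  neighbourhood of the zero set, so its energy measure is null there. As r tends to 0 these
  functions converge to v in L2 with bounded energy.\<close>

lemma em_zero_set_Cc:
  assumes v: "v \<in> D" "v \<in> Cc"
  shows "em v {x. v x = 0} = 0"
proof -
  define r where "r n = inverse (real (Suc n))" for n
  have r0: "0 < r n" for n by (simp add: r_def)
  define w where "w n x = v x - max (- r n) (min (r n) (v x))" for n x
  have w: "w n \<in> D" for n unfolding w_def using r0[of n] by (intro diff_mem v sym_clip_mem) auto
  have wC: "w n \<in> Cc" for n
    by (rule Cc_comp[OF v(2)]) (use r0[of n] in \<open>auto simp: w_def intro!: continuous_intros Cc_cont[OF v(2)]\<close>)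
  have N: "{x. v x = 0} \<in> sets borel" by (intro borel_closed closed_Collect_eq continuous_intros Cc_cont[OF v(2)])
  have e0: "em (w n) {x. v x = 0} \<le> 0" for n
  proof -
    have op: "open {x. \<bar>v x\<bar> < r n}" by (intro open_Collect_less continuous_intros Cc_cont[OF v(2)])
    have "em (w n) {x. v x = 0} \<le> em (w n) {x. \<bar>v x\<bar> < r n}"
      by (rule em_mono[OF w]) (use r0[of n] op in auto)
    also have "\<dots> = 0" by (rule em_local_Cc[OF w wC op, where c = 0]) (auto simp: w_def)
    finally show ?thesis .
  qed
  \<comment> \<open>The constant is 2 + 2 * 4, where the 4 comes from
    \<open>Q_sym_clip\<close>.\<close>
  have Qw: "Q (w n) (w n) \<le> 10 * Q v v" for n
    unfolding w_def using Q.q_diff_le[OF v(1) sym_clip_mem[OF v(1), of "r n"]] Q_sym_clip[OF v(1), of "r n"] r0[of n]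
    by simp
  have aL: "L2 m (\<lambda>x. \<bar>v x\<bar>)" by (rule D_L2[OF abs_mem[OF v(1)]])
  have lim: "(\<lambda>n. \<integral>x. (w n x - v x)\<^sup>2 \<partial>m) \<longlonglongrightarrow> 0"
  proof (rule L2_dominated_convergence[OF aL])
    show "AE x in m. (\<lambda>n. w n x) \<longlonglongrightarrow> v x"
    proof (rule AE_I2)
      fix x
      have "(\<lambda>n. v x - max (- r n) (min (r n) (v x))) \<longlonglongrightarrow> v x - max (- 0) (min 0 (v x))"
        unfolding r_def by (intro tendsto_intros LIMSEQ_inverse_real_of_nat)
      then show "(\<lambda>n. w n x) \<longlonglongrightarrow> v x" by (simp add: w_def)
    qed
    show "AE x in m. \<bar>w n x\<bar> \<le> \<bar>v x\<bar>" for n using r0[of n] by (auto simp: w_def)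
  qed (use D_meas w v in auto)
  have "em v {x. v x = 0} \<le> 0"
    by (rule weak_lsc(2)[OF em_quad[OF N] em_le_Q1 w Qw D_L2[OF v(1)] lim e0])
  then show ?thesis by (simp add: measure_le_0_iff)
qed

text \<open>On the open sets where u is positive or negative, the absolute value agrees with u or -
  u and locality applies. On the closed zero set locality says nothing, but there
  \<open>em_zero_set_Cc\<close> applies to the absolute value.\<close>

lemma em_abs_Cc:
  assumes u: "u \<in> D" "u \<in> Cc" and A: "A \<in> sets borel"
  shows "em (\<lambda>x. \<bar>u x\<bar>) A \<le> em u A"
proof -
  let ?a = "\<lambda>x. \<bar>u x\<bar>"
  have a: "?a \<in> D" by (rule abs_mem[OF u(1)])
  have aC: "?a \<in> Cc" by (rule Cc_comp[OF u(2)]) (auto intro!: continuous_intros Cc_cont[OF u(2)])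
  define P where "P = {x. 0 < u x}"
  define M where "M = {x. u x < 0}"
  define Z where "Z = {x. u x = 0}"
  have op: "open P" "open M" and Zb: "Z \<in> sets borel"
    unfolding P_def M_def Z_def by (intro open_Collect_less borel_closed closed_Collect_eq continuous_intros Cc_cont[OF u(2)])+
  have split: "em w A = em w (A \<inter> P) + em w (A \<inter> M) + em w (A \<inter> Z)"
    if "w \<in> D" for w
  proof -
    interpret f: finite_measure "mu w" by (rule mu_finite[OF that])
    note [simp] = sets_mu[OF that]
    have "em w ((A \<inter> P) \<union> (A \<inter> M) \<union> (A \<inter> Z))
      = em w ((A \<inter> P) \<union> (A \<inter> M)) + em w (A \<inter> Z)"
      by (rule f.finite_measure_Union) (use A op Zb in \<open>auto simp: P_def M_def Z_def\<close>)
    also have "em w ((A \<inter> P) \<union> (A \<inter> M)) = em w (A \<inter> P) + em w (A \<inter> M)"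
      by (rule f.finite_measure_Union) (use A op in \<open>auto simp: P_def M_def\<close>)
    also have "(A \<inter> P) \<union> (A \<inter> M) \<union> (A \<inter> Z) = A" by (auto simp: P_def M_def Z_def)
    finally show ?thesis .
  qed
  have zero: "em w (A \<inter> B) = 0" if "w \<in> D" "em w B = 0" "B \<in> sets borel" for w B
    using em_mono[OF that(1), of "A \<inter> B" B] that(2,3) by (simp add: measure_le_0_iff)
  have "em ?a (A \<inter> P) = em u (A \<inter> P)"
  proof -
    interpret e: quad_form D "\<lambda>u. em u (A \<inter> P)" by (rule em_quad) (use A op in auto)
    have "em (\<lambda>x. ?a x - u x) P = 0"
      by (rule em_local_Cc[OF diff_mem[OF a u(1)] _ op(1), where c = 0])
         (auto simp: P_def intro!: Cc_comp[OF u(2)] continuous_intros Cc_cont[OF u(2)])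
    then show ?thesis
      by (intro e.q_cong_null[OF a u(1)] zero diff_mem a u) (use op in auto)
  qed
  moreover have "em ?a (A \<inter> M) = em u (A \<inter> M)"
  proof -
    interpret e: quad_form D "\<lambda>u. em u (A \<inter> M)" by (rule em_quad) (use A op in auto)
    have "em (\<lambda>x. ?a x - - u x) M = 0"
      by (rule em_local_Cc[OF diff_mem[OF a minus_mem[OF u(1)]] _ op(2), where c = 0])
         (auto simp: M_def intro!: Cc_comp[OF u(2)] continuous_intros Cc_cont[OF u(2)])
    then have "em ?a (A \<inter> M) = em (\<lambda>x. - u x) (A \<inter> M)"
      by (intro e.q_cong_null[OF a minus_mem[OF u(1)]] zero diff_mem minus_mem a u) (use op in auto)
    then show ?thesis using e.q_minus[OF u(1)] by simp
  qed
  moreover have "em ?a (A \<inter> Z) = 0"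
    using em_zero_set_Cc[OF a aC] by (intro zero a Zb) (simp add: Z_def)
  ultimately show ?thesis using split[OF a] split[OF u(1)] by simp
qed

lemma em_abs:
  assumes u: "u \<in> D" and A: "A \<in> sets borel"
  shows "em (\<lambda>x. \<bar>u x\<bar>) A \<le> em u A"
proof -
  interpret e: quad_form D "\<lambda>u. em u A" by (rule em_quad[OF A])
  obtain us where us: "\<And>n. us n \<in> D" "\<And>n. us n \<in> Cc" and lim: "(\<lambda>n. Q1 m Q (\<lambda>x. us n x - u x)) \<longlonglongrightarrow> 0"
    using approx_seq[OF u] by blast
  obtain C where C: "\<And>n. Q (us n) (us n) \<le> C" using Q1_lim_bounded[OF us(1) u lim] by blast
  show ?thesis
  proof (rule weak_lsc_lim[OF em_quad[OF A] em_le_Q1 abs_mem[OF us(1)]])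
    show "Q (\<lambda>x. \<bar>us n x\<bar>) (\<lambda>x. \<bar>us n x\<bar>) \<le> 4 * C" for n using Q_abs[OF us(1)[of n]] C[of n] by linarith
    show "L2 m (\<lambda>x. \<bar>u x\<bar>)" by (rule D_L2[OF abs_mem[OF u]])
    show "(\<lambda>n. \<integral>x. (\<bar>us n x\<bar> - \<bar>u x\<bar>)\<^sup>2 \<partial>m) \<longlonglongrightarrow> 0"
      by (rule L2_conv_mono[OF D_L2[OF diff_mem[OF us(1) u]] Q1_lim_L2[OF us(1) u lim]])
         (use D_meas[OF u] D_meas[OF us(1)] in auto)
    show "em (\<lambda>x. \<bar>us n x\<bar>) A
        \<le> (sqrt (em u A) + sqrt (Q1 m Q (\<lambda>x. us n x - u x)))\<^sup>2" for n
    proof -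
      have "sqrt (em (us n) A) \<le> sqrt (em u A) + sqrt (em (\<lambda>x. us n x - u x) A)"
        by (rule e.triangle_sub[OF us(1) u])
      also have "\<dots> \<le> sqrt (em u A) + sqrt (Q1 m Q (\<lambda>x. us n x - u x))"
        using em_le_Q1[OF diff_mem[OF us(1) u]] by simp
      finally have "em (us n) A \<le> (sqrt (em u A) + sqrt (Q1 m Q (\<lambda>x. us n x - u x)))\<^sup>2"
        by (rule sqrt_le_D)
      then show ?thesis using em_abs_Cc[OF us(1,2) A, of n] by linarith
    qed
    have "(\<lambda>n. (sqrt (em u A) + sqrt (Q1 m Q (\<lambda>x. us n x - u x)))\<^sup>2) \<longlonglongrightarrow> (sqrt (em u A) + sqrt 0)\<^sup>2"
      by (intro tendsto_intros lim)
    then show "(\<lambda>n. (sqrt (em u A) + sqrt (Q1 m Q (\<lambda>x. us n x - u x)))\<^sup>2) \<longlonglongrightarrow> em u A"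
      by simp
  qed
qed

text \<open>Continuous approximants of u need not vanish on U. Subtracting C phi from their clips at
  C and keeping the positive part makes them vanish where phi = 1 and leaves the limit unchanged,
  since u = 0 almost everywhere on the support of phi.\<close>

lemma em_local_bounded:
  assumes u: "u \<in> D" and U: "open U" and ae: "AE x in m. x \<in> U \<longrightarrow> u x = 0"
    and C: "0 < C" "\<And>x. 0 \<le> u x" "\<And>x. u x \<le> C"
  shows "em u U = 0"
proof -
  obtain us where us: "\<And>n. us n \<in> D" "\<And>n. us n \<in> Cc" and lim: "(\<lambda>n. Q1 m Q (\<lambda>x. us n x - u x)) \<longlonglongrightarrow> 0"
    using approx_seq[OF u] by blast
  obtain B where B: "\<And>n. Q (us n) (us n) \<le> B" using Q1_lim_bounded[OF us(1) u lim] by blast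
  have "\<exists>V. open V \<and> x \<in> V \<and> em u V = 0" if "x \<in> U" for x
  proof -
    have xU: "{x} \<subseteq> U" using that by simp
    obtain phi V where p: "phi \<in> D" "phi \<in> Cc" "\<forall>x. 0 \<le> phi x" "\<forall>x. phi x \<le> 1" "open V" "{x} \<subseteq> V"
        "\<forall>x\<in>V. phi x = 1" "closure {x. phi x \<noteq> 0} \<subseteq> U"
      by (rule cutoff[OF compact_sing U xU])
    have pU: "phi x = 0" if "x \<notin> U" for x using p(8) that closure_subset[of "{x. phi x \<noteq> 0}"] by blast
    define w where "w n x = max 0 (min C (max 0 (us n x)) - C * phi x)" for n x
    have w: "w n \<in> D" for n
      unfolding w_def by (intro pos_part_mem diff_mem clip_mem scale_mem us p C)
    have wC: "w n \<in> Cc" for n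
      by (rule Cc_comp2[OF us(2)[of n] p(2)])
         (use C(1) in \<open>auto simp: w_def intro!: continuous_intros Cc_cont[OF us(2)[of n]] Cc_cont[OF p(2)]\<close>)
    have e0: "em (w n) V \<le> 0" for n
      using em_local_Cc[OF w wC p(5), where c = 0] p(7) by (simp add: w_def)
    have Qw: "Q (w n) (w n) \<le> 2 * B + 2 * (C\<^sup>2 * Q phi phi)" for n
    proof -
      have "Q (w n) (w n) \<le> 2 * Q (\<lambda>x. min C (max 0 (us n x))) (\<lambda>x. min C (max 0 (us n x)))
          + 2 * Q (\<lambda>x. C * phi x) (\<lambda>x. C * phi x)"
        unfolding w_def
        by (rule order_trans[OF Q_pos_part Q.q_diff_le]) (intro diff_mem clip_mem scale_mem us p C)+
      then show ?thesis using Q_clip[OF us(1)[of n] C(1)] B[of n] Q.hom[OF p(1), of C] by linarith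
    qed
    have wl: "(\<lambda>n. \<integral>x. (w n x - u x)\<^sup>2 \<partial>m) \<longlonglongrightarrow> 0"
    proof (rule L2_conv_mono[OF D_L2[OF diff_mem[OF us(1) u]] Q1_lim_L2[OF us(1) u lim]])
      fix n
      \<comment> \<open>On U the limit is 0 and w lies between 0 and the positive part of the
        approximant. Off U phi = 0, and clipping to [0, C] does not increase the distance to u,
        whose values lie in that interval.\<close>
      show "AE x in m. \<bar>w n x - u x\<bar> \<le> \<bar>us n x - u x\<bar>"
        using ae
      proof eventually_elim
        case (elim x)
        show ?case
        proof (cases "x \<in> U")
          case True
          have "0 \<le> C * phi x" using C(1) p(3) by simp
          moreover have "u x = 0" using elim True by simp
          ultimately show ?thesis using C(1) unfolding w_def by linarith
        next
          case False
          then show ?thesis unfolding w_def using pU[OF False] C(2)[of x] C(3)[of x] by simp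
        qed
      qed
    qed (use D_meas[OF w] D_meas[OF u] in auto)
    have "em u V \<le> 0"
      by (rule weak_lsc(2)[OF em_quad em_le_Q1 w Qw D_L2[OF u] wl e0]) (use p(5) in auto)
    then show ?thesis using p(5,6) by (auto simp: measure_le_0_iff)
  qed
  then show ?thesis by (rule em_locally_null[OF u])
qed

text \<open>The clips at the heights n + 1 are bounded and vanish on U, and lower semicontinuity
  carries their zero energy on U to the limit.\<close>

lemma em_local_pos_part:
  assumes u: "u \<in> D" and U: "open U" and ae: "AE x in m. x \<in> U \<longrightarrow> u x = 0"
  shows "em (\<lambda>x. max 0 (u x)) U = 0"
proof -
  have le: "em (\<lambda>x. min (real (Suc n)) (max 0 (u x))) U \<le> 0" for n
  proof -
    have "AE x in m. x \<in> U \<longrightarrow> min (real (Suc n)) (max 0 (u x)) = 0" using ae by eventually_elim auto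
    then show ?thesis
      using em_local_bounded[OF clip_mem[OF u] U, of "real (Suc n)" "real (Suc n)"] by simp
  qed
  have "em (\<lambda>x. max 0 (u x)) U \<le> 0"
    by (rule weak_lsc(2)[OF em_quad em_le_Q1 clip_mem[OF u] Q_clip[OF u] D_L2[OF pos_part_mem[OF u]] clip_L2_lim[OF u] le])
       (use U in auto)
  then show ?thesis by (simp add: measure_le_0_iff)
qed

lemma em_local:
  assumes u: "u \<in> D" and U: "open U" and ae: "AE x in m. x \<in> U \<longrightarrow> u x = 0"
  shows "em u U = 0"
proof -
  interpret e: quad_form D "\<lambda>u. em u U" by (rule em_quad) (use U in auto)
  have "AE x in m. x \<in> U \<longrightarrow> - u x = 0" using ae by eventually_elim auto
  from em_local_pos_part[OF minus_mem[OF u] U this] em_local_pos_part[OF u U ae]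
  have "em (\<lambda>x. max 0 (u x) - max 0 (- u x)) U \<le> 0"
    using e.q_diff_le[OF pos_part_mem[OF u] pos_part_mem[OF minus_mem[OF u]]] by simp
  moreover have "(\<lambda>x. max 0 (u x) - max 0 (- u x)) = u" by (auto simp: fun_eq_iff)
  ultimately show ?thesis by (simp add: measure_le_0_iff)
qed

text \<open>This makes the local energy measure of a function in D(Q)loc independent of the
  representative chosen on an open set.\<close>

lemma em_cong:
  assumes u: "u \<in> D" and v: "v \<in> D" and U: "open U" and ae: "AE x in m. x \<in> U \<longrightarrow> u x = v x"
    and A: "A \<subseteq> U" "A \<in> sets borel"
  shows "em u A = em v A"
proof -
  interpret e: quad_form D "\<lambda>u. em u A" by (rule em_quad[OF A(2)])
  have "AE x in m. x \<in> U \<longrightarrow> u x - v x = 0" using ae by eventually_elim auto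
  then have "em (\<lambda>x. u x - v x) U = 0" by (rule em_local[OF diff_mem[OF u v] U])
  then have "em (\<lambda>x. u x - v x) A = 0"
    using em_mono[OF diff_mem[OF u v] A(1)] U by (simp add: measure_le_0_iff)
  then show ?thesis by (rule e.q_cong_null[OF u v])
qed

text \<open>Twice the maximum is (u + v) + |u - v|, so \<open>em_abs\<close> and the triangle
  inequality suffice. Squared and combined with the parallelogram law, this becomes
  \<open>em_max_le\<close> with constant 1.\<close>

lemma em_max:
  assumes u: "u \<in> D" and v: "v \<in> D" and A: "A \<in> sets borel"
  shows "2 * sqrt (em (\<lambda>x. max (u x) (v x)) A)
    \<le> sqrt (em (\<lambda>x. u x + v x) A) + sqrt (em (\<lambda>x. u x - v x) A)"
proof -
  interpret e: quad_form D "\<lambda>u. em u A" by (rule em_quad[OF A])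
  have "2 * sqrt (em (\<lambda>x. max (u x) (v x)) A) = sqrt (em (\<lambda>x. 2 * max (u x) (v x)) A)"
    using e.sqrt_scale[OF max_mem[OF u v], of 2] by simp
  also have "(\<lambda>x. 2 * max (u x) (v x)) = (\<lambda>x. (u x + v x) + \<bar>u x - v x\<bar>)" by (auto simp: fun_eq_iff max_def)
  also have "sqrt (em (\<lambda>x. (u x + v x) + \<bar>u x - v x\<bar>) A)
      \<le> sqrt (em (\<lambda>x. u x + v x) A) + sqrt (em (\<lambda>x. \<bar>u x - v x\<bar>) A)"
    by (rule e.triangle[OF add_mem[OF u v] abs_mem[OF diff_mem[OF u v]]])
  also have "\<dots> \<le> sqrt (em (\<lambda>x. u x + v x) A) + sqrt (em (\<lambda>x. u x - v x) A)"
    using em_abs[OF diff_mem[OF u v] A] by simp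
  finally show ?thesis .
qed

lemma em_max_le:
  assumes u: "u \<in> D" and v: "v \<in> D" and A: "A \<in> sets borel"
  shows "em (\<lambda>x. max (u x) (v x)) A \<le> em u A + em v A"
proof -
  interpret e: quad_form D "\<lambda>u. em u A" by (rule em_quad[OF A])
  let ?a = "sqrt (em (\<lambda>x. u x + v x) A)" and ?b = "sqrt (em (\<lambda>x. u x - v x) A)"
  have "(2 * sqrt (em (\<lambda>x. max (u x) (v x)) A))\<^sup>2 \<le> (?a + ?b)\<^sup>2"
    by (rule power_mono[OF em_max[OF assms]]) simp
  also have "\<dots> \<le> 2 * ?a\<^sup>2 + 2 * ?b\<^sup>2" using zero_le_power2[of "?a - ?b"] unfolding power2_sum power2_diff by linarith
  also have "\<dots> = 4 * em u A + 4 * em v A" using e.par[OF u v] by simp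
  finally show ?thesis by (simp add: power_mult_distrib)
qed


lemma em_min_le:
  assumes u: "u \<in> D" and v: "v \<in> D" and A: "A \<in> sets borel"
  shows "em (\<lambda>x. min (u x) (v x)) A \<le> em u A + em v A"
proof -
  interpret e: quad_form D "\<lambda>u. em u A" by (rule em_quad[OF A])
  have eq: "(\<lambda>x. min (u x) (v x)) = (\<lambda>x. - max (- u x) (- v x))" by (auto simp: fun_eq_iff)
  show ?thesis unfolding eq
    using em_max_le[OF minus_mem[OF u] minus_mem[OF v] A] e.q_minus[OF u] e.q_minus[OF v]
      e.q_minus[OF max_mem[OF minus_mem[OF u] minus_mem[OF v]]] by simp
qed

text \<open>One exhaustion is fixed once and for all, so that the energies of different functions
  are suprema along the same sequence and can be added term by term.\<close>

definition exh :: "nat \<Rightarrow> 'a set" where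
  "exh = (SOME G. (\<forall>n. open (G n)) \<and> (\<forall>n. compact (closure (G n))) \<and> incseq G \<and>
    (\<Union>n. G n) = UNIV \<and> (\<forall>K. compact K \<longrightarrow> (\<exists>n. K \<subseteq> G n)))"

lemma exh_props: "(\<forall>n. open (exh n)) \<and> (\<forall>n. compact (closure (exh n))) \<and> incseq exh \<and>
    (\<Union>n. exh n) = UNIV \<and> (\<forall>K. compact K \<longrightarrow> (\<exists>n. K \<subseteq> exh n))"
proof -
  obtain G :: "nat \<Rightarrow> 'a set" where "\<And>n. open (G n)" "\<And>n. compact (closure (G n))" "incseq G"
    "(\<Union>n. G n) = UNIV" "\<And>K. compact K \<Longrightarrow> \<exists>n. K \<subseteq> G n"
    by (rule compact_exhaustion[OF lc]) blast
  then have "\<exists>G :: nat \<Rightarrow> 'a set. (\<forall>n. open (G n)) \<and> (\<forall>n. compact (closure (G n))) \<and> incseq G \<and>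
    (\<Union>n. G n) = UNIV \<and> (\<forall>K. compact K \<longrightarrow> (\<exists>n. K \<subseteq> G n))"
    by (intro exI[of _ G]) auto
  then show ?thesis unfolding exh_def by (rule someI_ex)
qed

lemma exh_open: "open (exh n)" and exh_compact: "compact (closure (exh n))" and exh_inc: "incseq exh"
  and exh_UN: "(\<Union>n. exh n) = UNIV" and exh_cover: "compact K \<Longrightarrow> \<exists>n. K \<subseteq> exh n"
  using exh_props by auto

text \<open>Constants need not lie in D. On \<open>exh n\<close> the constant a is replaced by a
  phi, where phi = 1 near the closure of \<open>exh n\<close>. The energy measure of a phi vanishes
  there, so the bounds for max and min lose nothing and the contraction has constant 1; letting n
  grow covers A.\<close>

lemma em_sym_clip:
  assumes u: "u \<in> D" and a: "0 \<le> a" and A: "A \<in> sets borel"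
  shows "em (\<lambda>x. max (- a) (min a (u x))) A \<le> em u A"
proof -
  let ?c = "\<lambda>x. max (- a) (min a (u x))"
  have c: "?c \<in> D" by (rule sym_clip_mem[OF u a])
  have le: "em ?c (A \<inter> exh n) \<le> em u A" for n
  proof -
    obtain phi V where p: "phi \<in> D" "phi \<in> Cc" "\<forall>x. 0 \<le> phi x" "\<forall>x. phi x \<le> 1" "open V" "closure (exh n) \<subseteq> V"
        "\<forall>x\<in>V. phi x = 1" "closure {x. phi x \<noteq> 0} \<subseteq> UNIV"
      by (rule cutoff[OF exh_compact[of n] open_UNIV subset_UNIV])
    let ?B = "A \<inter> exh n"
    have B: "?B \<in> sets borel" using A exh_open by auto
    have BV: "exh n \<subseteq> V" using p(6) closure_subset[of "exh n"] by blast
    interpret e: quad_form D "\<lambda>u. em u ?B" by (rule em_quad[OF B])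
    have "em phi V = 0" by (rule em_local_Cc[OF p(1,2,5), where c = 1]) (use p(7) in auto)
    then have "em phi ?B = 0"
      using em_mono[OF p(1), of ?B V] BV p(5) by (force simp: measure_le_0_iff)
    then have n0: "em (\<lambda>x. b * phi x) ?B = 0" for b using e.hom[OF p(1), of b] by simp
    have ap: "(\<lambda>x. b * phi x) \<in> D" for b by (rule scale_mem[OF p(1)])
    have mm: "(\<lambda>x. min (a * phi x) (u x)) \<in> D" by (rule min_mem[OF ap u])
    have "AE x in m. x \<in> exh n \<longrightarrow> ?c x = max (- a * phi x) (min (a * phi x) (u x))"
      using p(7) BV by (intro AE_I2) auto
    then have "em ?c ?B = em (\<lambda>x. max (- a * phi x) (min (a * phi x) (u x))) ?B"
      by (rule em_cong[OF c max_mem[OF ap mm] exh_open _ _ B]) auto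
    also have "\<dots> \<le> em u ?B"
      using em_max_le[OF ap mm B, of "- a"] em_min_le[OF ap u B, of a] n0[of "- a"] n0[of a] by linarith
    also have "\<dots> \<le> em u A" by (rule em_mono[OF u _ A]) auto
    finally show ?thesis .
  qed
  have "(\<lambda>n. em ?c (A \<inter> exh n)) \<longlonglongrightarrow> em ?c (\<Union>n. A \<inter> exh n)"
    using A exh_open exh_inc
    by (intro finite_measure.finite_Lim_measure_incseq[OF mu_finite[OF c]])
       (auto simp: sets_mu[OF c] incseq_def)
  moreover have "(\<Union>n. A \<inter> exh n) = A" using exh_UN by auto
  ultimately show ?thesis using le by (intro LIMSEQ_le_const2) auto
qed

end

section \<open>Jump and killing parts\<close>

lemma quad_form_ennreal:
  assumes "fun_space V" and fin: "\<And>u. u \<in> V \<Longrightarrow> E u < \<infinity>"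
    and par: "\<And>u v. u \<in> V \<Longrightarrow> v \<in> V \<Longrightarrow>
      E (\<lambda>x. u x + v x) + E (\<lambda>x. u x - v x) = 2 * E u + 2 * E v"
    and hom: "\<And>u c. u \<in> V \<Longrightarrow> E (\<lambda>x. c * u x) = ennreal (c\<^sup>2) * E u"
  shows "quad_form V (\<lambda>u. enn2real (E u))"
proof -
  interpret fun_space V by fact
  have e: "E u = ennreal (enn2real (E u))" if "u \<in> V" for u using fin[OF that] by simp
  show ?thesis
  proof
    fix u v :: "'a \<Rightarrow> real" and c :: real
    assume u: "u \<in> V"
    show "0 \<le> enn2real (E u)" by simp
    show "enn2real (E (\<lambda>x. c * u x)) = c\<^sup>2 * enn2real (E u)"
      unfolding hom[OF u] by (simp add: enn2real_mult)
    assume v: "v \<in> V"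
    have "ennreal (enn2real (E (\<lambda>x. u x + v x)) + enn2real (E (\<lambda>x. u x - v x)))
      = E (\<lambda>x. u x + v x) + E (\<lambda>x. u x - v x)"
      using e[OF add_mem[OF u v]] e[OF diff_mem[OF u v]] by (simp add: ennreal_plus)
    also have "\<dots> = 2 * E u + 2 * E v" by (rule par[OF u v])
    also have "\<dots> = ennreal (2 * enn2real (E u) + 2 * enn2real (E v))"
      using e[OF u] e[OF v] by (simp add: ennreal_plus ennreal_mult)
    finally show "enn2real (E (\<lambda>x. u x + v x)) + enn2real (E (\<lambda>x. u x - v x))
      = 2 * enn2real (E u) + 2 * enn2real (E v)"
      by (subst (asm) ennreal_inj) auto
  qed
qed

lemma nn_integral_par:
  fixes a b i :: "'b \<Rightarrow> real"
  assumes [measurable]: "a \<in> borel_measurable M" "b \<in> borel_measurable M" "i \<in> borel_measurable M"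
    and i: "\<And>x. 0 \<le> i x"
  shows "(\<integral>\<^sup>+x. ennreal ((a x + b x)\<^sup>2 * i x) \<partial>M) + (\<integral>\<^sup>+x. ennreal ((a x - b x)\<^sup>2 * i x) \<partial>M)
    = 2 * (\<integral>\<^sup>+x. ennreal ((a x)\<^sup>2 * i x) \<partial>M) + 2 * (\<integral>\<^sup>+x. ennreal ((b x)\<^sup>2 * i x) \<partial>M)"
proof -
  have "(\<integral>\<^sup>+x. ennreal ((a x + b x)\<^sup>2 * i x) \<partial>M) + (\<integral>\<^sup>+x. ennreal ((a x - b x)\<^sup>2 * i x) \<partial>M)
    = (\<integral>\<^sup>+x. ennreal ((a x + b x)\<^sup>2 * i x) + ennreal ((a x - b x)\<^sup>2 * i x) \<partial>M)"
    by (rule nn_integral_add[symmetric]) measurable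
  also have "\<dots> = (\<integral>\<^sup>+x. 2 * ennreal ((a x)\<^sup>2 * i x) + 2 * ennreal ((b x)\<^sup>2 * i x) \<partial>M)"
  proof (rule nn_integral_cong)
    fix x
    have "ennreal ((a x + b x)\<^sup>2 * i x) + ennreal ((a x - b x)\<^sup>2 * i x)
      = ennreal ((a x + b x)\<^sup>2 * i x + (a x - b x)\<^sup>2 * i x)"
      using i[of x] by (simp add: ennreal_plus)
    also have "(a x + b x)\<^sup>2 * i x + (a x - b x)\<^sup>2 * i x = 2 * ((a x)\<^sup>2 * i x) + 2 * ((b x)\<^sup>2 * i x)"
      by (simp add: power2_sum power2_diff algebra_simps)
    also have "ennreal \<dots> = 2 * ennreal ((a x)\<^sup>2 * i x) + 2 * ennreal ((b x)\<^sup>2 * i x)"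
      using i[of x] by (simp add: ennreal_plus ennreal_mult)
    finally show "ennreal ((a x + b x)\<^sup>2 * i x) + ennreal ((a x - b x)\<^sup>2 * i x)
      = 2 * ennreal ((a x)\<^sup>2 * i x) + 2 * ennreal ((b x)\<^sup>2 * i x)" .
  qed
  also have "\<dots> = (\<integral>\<^sup>+x. 2 * ennreal ((a x)\<^sup>2 * i x) \<partial>M) + (\<integral>\<^sup>+x. 2 * ennreal ((b x)\<^sup>2 * i x) \<partial>M)"
    by (rule nn_integral_add) measurable
  also have "\<dots> = 2 * (\<integral>\<^sup>+x. ennreal ((a x)\<^sup>2 * i x) \<partial>M) + 2 * (\<integral>\<^sup>+x. ennreal ((b x)\<^sup>2 * i x) \<partial>M)"
    by (simp add: nn_integral_cmult)
  finally show ?thesis .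
qed

lemma nn_integral_hom:
  fixes a i :: "'b \<Rightarrow> real"
  assumes [measurable]: "a \<in> borel_measurable M" "i \<in> borel_measurable M"
  shows "(\<integral>\<^sup>+x. ennreal ((c * a x)\<^sup>2 * i x) \<partial>M) = ennreal (c\<^sup>2) * (\<integral>\<^sup>+x. ennreal ((a x)\<^sup>2 * i x) \<partial>M)"
proof -
  have "(\<integral>\<^sup>+x. ennreal ((c * a x)\<^sup>2 * i x) \<partial>M) = (\<integral>\<^sup>+x. ennreal (c\<^sup>2) * ennreal ((a x)\<^sup>2 * i x) \<partial>M)"
    by (rule nn_integral_cong) (simp add: ennreal_mult'[symmetric] power_mult_distrib mult.assoc)
  also have "\<dots> = ennreal (c\<^sup>2) * (\<integral>\<^sup>+x. ennreal ((a x)\<^sup>2 * i x) \<partial>M)" by (rule nn_integral_cmult) measurable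
  finally show ?thesis .
qed

lemma nn_integral_le_add:
  fixes a b c i :: "'b \<Rightarrow> real"
  assumes [measurable]: "a \<in> borel_measurable M" "b \<in> borel_measurable M" "i \<in> borel_measurable M"
    and i: "\<And>x. 0 \<le> i x" and le: "\<And>x. (c x)\<^sup>2 \<le> (a x)\<^sup>2 + (b x)\<^sup>2"
  shows "(\<integral>\<^sup>+x. ennreal ((c x)\<^sup>2 * i x) \<partial>M) \<le> (\<integral>\<^sup>+x. ennreal ((a x)\<^sup>2 * i x) \<partial>M) + (\<integral>\<^sup>+x. ennreal ((b x)\<^sup>2 * i x) \<partial>M)"
proof -
  have "(\<integral>\<^sup>+x. ennreal ((c x)\<^sup>2 * i x) \<partial>M) \<le> (\<integral>\<^sup>+x. ennreal ((a x)\<^sup>2 * i x) + ennreal ((b x)\<^sup>2 * i x) \<partial>M)"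
  proof (rule nn_integral_mono)
    fix x
    have "(c x)\<^sup>2 * i x \<le> ((a x)\<^sup>2 + (b x)\<^sup>2) * i x" by (rule mult_right_mono[OF le i])
    then have "ennreal ((c x)\<^sup>2 * i x) \<le> ennreal ((a x)\<^sup>2 * i x + (b x)\<^sup>2 * i x)"
      by (intro ennreal_leI) (simp add: algebra_simps)
    then show "ennreal ((c x)\<^sup>2 * i x) \<le> ennreal ((a x)\<^sup>2 * i x) + ennreal ((b x)\<^sup>2 * i x)"
      using i[of x] by (simp add: ennreal_plus)
  qed
  also have "\<dots> = (\<integral>\<^sup>+x. ennreal ((a x)\<^sup>2 * i x) \<partial>M) + (\<integral>\<^sup>+x. ennreal ((b x)\<^sup>2 * i x) \<partial>M)"
    by (rule nn_integral_add) measurable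
  finally show ?thesis .
qed

lemma nn_integral_indicator_SUP:
  fixes a :: "'b \<Rightarrow> real"
  assumes [measurable]: "a \<in> borel_measurable M" and S: "\<And>n. S n \<in> sets M" "incseq S" "(\<Union>n. S n) = UNIV"
  shows "(\<integral>\<^sup>+x. ennreal ((a x)\<^sup>2) \<partial>M) = (SUP n. \<integral>\<^sup>+x. ennreal ((a x)\<^sup>2 * indicator (S n) x) \<partial>M)"
proof -
  have [measurable]: "S n \<in> sets M" for n by (rule S)
  have inc: "incseq (\<lambda>n x. ennreal ((a x)\<^sup>2 * indicator (S n) x))"
    using S(2) by (auto simp: incseq_def le_fun_def indicator_def intro!: ennreal_leI)
  have "(SUP n. ennreal ((a x)\<^sup>2 * indicator (S n) x)) = ennreal ((a x)\<^sup>2)" for x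
  proof (rule antisym)
    obtain n where "x \<in> S n" using S(3) by blast
    then show "ennreal ((a x)\<^sup>2) \<le> (SUP n. ennreal ((a x)\<^sup>2 * indicator (S n) x))"
      by (intro SUP_upper2[of n]) auto
    show "(SUP n. ennreal ((a x)\<^sup>2 * indicator (S n) x)) \<le> ennreal ((a x)\<^sup>2)"
      by (rule SUP_least) (auto simp: indicator_def intro!: ennreal_leI)
  qed
  then have "(\<integral>\<^sup>+x. ennreal ((a x)\<^sup>2) \<partial>M) = (\<integral>\<^sup>+x. (SUP n. ennreal ((a x)\<^sup>2 * indicator (S n) x)) \<partial>M)" by simp
  also have "\<dots> = (SUP n. \<integral>\<^sup>+x. ennreal ((a x)\<^sup>2 * indicator (S n) x) \<partial>M)"
    by (rule nn_integral_monotone_convergence_SUP[OF inc]) measurable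
  finally show ?thesis .
qed

context bform
begin

lemma AE_k_null: "N \<in> sets borel \<Longrightarrow> cap N = 0 \<Longrightarrow> AE x in k. x \<notin> N"
  using cap_null sets_k by (intro AE_not_in) (auto simp: null_sets_def)

lemma AE_J_null:
  assumes N: "N \<in> sets borel" "cap N = 0"
  shows "AE p in J. fst p \<notin> N \<and> snd p \<notin> N"
proof -
  have s: "N \<times> UNIV \<in> sets J" "UNIV \<times> N \<in> sets J" unfolding sets_J using N(1) by (auto intro!: borel_Times)
  have 1: "emeasure J (N \<times> UNIV) = 0" using cap_null N by blast
  have "(\<lambda>p. (snd p, fst p)) -` (N \<times> UNIV) = (UNIV \<times> N :: ('a \<times> 'a) set)" by auto
  then have 2: "emeasure J (UNIV \<times> N) = 0" using J_sym s(1) 1 by metis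
  have "AE p in J. p \<notin> N \<times> UNIV" "AE p in J. p \<notin> UNIV \<times> N"
    using s 1 2 by (auto intro!: AE_not_in simp: null_sets_def)
  then show ?thesis by eventually_elim auto
qed

lemma meas_k: "f \<in> borel_measurable borel \<Longrightarrow> f \<in> borel_measurable k"
  using measurable_cong_sets[OF sets_k refl] by blast

lemma meas_J:
  fixes f :: "'a \<Rightarrow> real"
  assumes f: "f \<in> borel_measurable borel"
  shows "(\<lambda>p. f (fst p) - f (snd p)) \<in> borel_measurable J"
proof -
  have "(\<lambda>p. f (fst p)) \<in> borel_measurable (borel :: ('a \<times> 'a) measure)"
    by (rule measurable_compose[OF _ f]) (intro borel_measurable_continuous_onI continuous_intros)
  moreover have "(\<lambda>p. f (snd p)) \<in> borel_measurable (borel :: ('a \<times> 'a) measure)"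
    by (rule measurable_compose[OF _ f]) (intro borel_measurable_continuous_onI continuous_intros)
  ultimately have "(\<lambda>p. f (fst p) - f (snd p)) \<in> borel_measurable (borel :: ('a \<times> 'a) measure)"
    by (rule borel_measurable_diff)
  then show ?thesis using measurable_cong_sets[OF sets_J refl] by blast
qed

lemma ind_J: "G \<in> sets borel \<Longrightarrow> (indicator (G \<times> G) :: _ \<Rightarrow> real) \<in> borel_measurable J"
  by (rule borel_measurable_indicator) (auto simp: sets_J intro!: borel_Times)

lemma ind_k: "G \<in> sets borel \<Longrightarrow> (indicator G :: _ \<Rightarrow> real) \<in> borel_measurable k"
  by (rule borel_measurable_indicator) (simp add: sets_k)

text \<open>Jump and killing energy inside G. Jumps count only when both ends lie in G, so the value
  depends on f on G alone and may be computed from a local representative.\<close>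

definition jk :: "'a set \<Rightarrow> ('a \<Rightarrow> real) \<Rightarrow> ennreal" where
  "jk G f = (\<integral>\<^sup>+p. ennreal ((f (fst p) - f (snd p))\<^sup>2 * indicator (G \<times> G) p) \<partial>J)
    + (\<integral>\<^sup>+x. ennreal ((f x)\<^sup>2 * indicator G x) \<partial>k)"

lemma jk_cong:
  assumes "qc f" "qc g" "open G" "AE x in m. x \<in> G \<longrightarrow> f x = g x"
  shows "jk G f = jk G g"
proof -
  obtain N where N: "N \<in> sets borel" "cap N = 0" "\<And>x. x \<notin> N \<Longrightarrow> x \<in> G \<Longrightarrow> f x = g x"
    using qc_unique_null[OF assms] by blast
  show ?thesis unfolding jk_def
  proof (intro arg_cong2[where f = "(+)"] nn_integral_cong_AE)
    show "AE p in J. ennreal ((f (fst p) - f (snd p))\<^sup>2 * indicator (G \<times> G) p)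
        = ennreal ((g (fst p) - g (snd p))\<^sup>2 * indicator (G \<times> G) p)"
      using AE_J_null[OF N(1,2)] by eventually_elim (use N(3) in \<open>auto simp: indicator_def\<close>)
    show "AE x in k. ennreal ((f x)\<^sup>2 * indicator G x) = ennreal ((g x)\<^sup>2 * indicator G x)"
      using AE_k_null[OF N(1,2)] by eventually_elim (use N(3) in \<open>auto simp: indicator_def\<close>)
  qed
qed

lemma jk_par:
  assumes f: "f \<in> borel_measurable borel" and g: "g \<in> borel_measurable borel" and G: "G \<in> sets borel"
  shows "jk G (\<lambda>x. f x + g x) + jk G (\<lambda>x. f x - g x) = 2 * jk G f + 2 * jk G g"
proof -
  have 1: "(\<lambda>p. (f (fst p) + g (fst p)) - (f (snd p) + g (snd p))) = (\<lambda>p. (f (fst p) - f (snd p)) + (g (fst p) - g (snd p)))"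
    and 2: "(\<lambda>p. (f (fst p) - g (fst p)) - (f (snd p) - g (snd p))) = (\<lambda>p. (f (fst p) - f (snd p)) - (g (fst p) - g (snd p)))"
    by auto
  note J = nn_integral_par[OF meas_J[OF f] meas_J[OF g] ind_J[OF G]]
  note k = nn_integral_par[OF meas_k[OF f] meas_k[OF g] ind_k[OF G]]
  let ?j = "\<lambda>a. \<integral>\<^sup>+p. ennreal ((a p)\<^sup>2 * indicator (G \<times> G) p) \<partial>J"
  have "jk G (\<lambda>x. f x + g x) + jk G (\<lambda>x. f x - g x)
    = (?j (\<lambda>p. (f (fst p) - f (snd p)) + (g (fst p) - g (snd p))) + ?j (\<lambda>p. (f (fst p) - f (snd p)) - (g (fst p) - g (snd p))))
      + ((\<integral>\<^sup>+x. ennreal ((f x + g x)\<^sup>2 * indicator G x) \<partial>k) + (\<integral>\<^sup>+x. ennreal ((f x - g x)\<^sup>2 * indicator G x) \<partial>k))"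
    unfolding jk_def 1[THEN fun_cong, simplified] by (simp add: algebra_simps)
  also have "\<dots> = 2 * jk G f + 2 * jk G g"
    using J k unfolding jk_def by (simp add: algebra_simps)
  finally show ?thesis .
qed

lemma jk_hom:
  assumes f: "f \<in> borel_measurable borel" and G: "G \<in> sets borel"
  shows "jk G (\<lambda>x. c * f x) = ennreal (c\<^sup>2) * jk G f"
proof -
  have 1: "c * f (fst p) - c * f (snd p) = c * (f (fst p) - f (snd p))" for p :: "'a \<times> 'a"
    by (simp add: algebra_simps)
  show ?thesis unfolding jk_def 1
    by (simp add: nn_integral_hom[OF meas_J[OF f] ind_J[OF G]] nn_integral_hom[OF meas_k[OF f] ind_k[OF G]] distrib_left)
qed

lemma jk_contraction:
  assumes "\<And>x y. \<bar>h x - h y\<bar> \<le> \<bar>f x - f y\<bar>" "\<And>x. \<bar>h x\<bar> \<le> \<bar>f x\<bar>"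
  shows "jk G h \<le> jk G f"
  unfolding jk_def using assms
  by (intro add_mono nn_integral_mono ennreal_leI mult_right_mono) (auto simp: abs_le_square_iff[symmetric])

lemma jk_le_add:
  assumes f: "f \<in> borel_measurable borel" and g: "g \<in> borel_measurable borel" and G: "G \<in> sets borel"
    and 1: "\<And>x y. (h x - h y)\<^sup>2 \<le> (f x - f y)\<^sup>2 + (g x - g y)\<^sup>2" and 2: "\<And>x. (h x)\<^sup>2 \<le> (f x)\<^sup>2 + (g x)\<^sup>2"
  shows "jk G h \<le> jk G f + jk G g"
proof -
  have "jk G h \<le> ((\<integral>\<^sup>+p. ennreal ((f (fst p) - f (snd p))\<^sup>2 * indicator (G \<times> G) p) \<partial>J)
      + (\<integral>\<^sup>+p. ennreal ((g (fst p) - g (snd p))\<^sup>2 * indicator (G \<times> G) p) \<partial>J))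
    + ((\<integral>\<^sup>+x. ennreal ((f x)\<^sup>2 * indicator G x) \<partial>k) + (\<integral>\<^sup>+x. ennreal ((g x)\<^sup>2 * indicator G x) \<partial>k))"
    unfolding jk_def
    by (intro add_mono nn_integral_le_add meas_J meas_k ind_J ind_k f g G 1 2) auto
  also have "\<dots> = jk G f + jk G g" unfolding jk_def by (simp add: ac_simps)
  finally show ?thesis .
qed

lemma jk_mono: "G \<subseteq> H \<Longrightarrow> jk G f \<le> jk H f"
  unfolding jk_def by (intro add_mono nn_integral_mono ennreal_leI mult_left_mono) (auto simp: indicator_def)

lemma jk_SUP:
  assumes f: "f \<in> borel_measurable borel"
  shows "jk UNIV f = (SUP n. jk (exh n) f)"
proof -
  have "\<exists>n. x \<in> exh n \<and> y \<in> exh n" for x y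
  proof -
    obtain i j where "x \<in> exh i" "y \<in> exh j" using exh_UN by blast
    moreover have "exh i \<subseteq> exh (max i j)" "exh j \<subseteq> exh (max i j)" using exh_inc by (auto simp: incseq_def)
    ultimately show ?thesis by blast
  qed
  then have U: "(\<Union>n. exh n \<times> exh n) = UNIV" by (force simp: set_eq_iff)
  have i: "incseq (\<lambda>n. exh n \<times> exh n)" using exh_inc unfolding incseq_def by blast
  have s: "exh n \<times> exh n \<in> sets J" "exh n \<in> sets k" for n
    using exh_open by (auto simp: sets_J sets_k intro!: borel_Times)
  have "(SUP n. jk (exh n) f) = (SUP n. \<integral>\<^sup>+p. ennreal ((f (fst p) - f (snd p))\<^sup>2 * indicator (exh n \<times> exh n) p) \<partial>J)
      + (SUP n. \<integral>\<^sup>+x. ennreal ((f x)\<^sup>2 * indicator (exh n) x) \<partial>k)"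
    unfolding jk_def
  proof (rule ennreal_SUP_add)
    have sub: "exh i \<subseteq> exh j" if "i \<le> j" for i j using exh_inc that by (auto simp: incseq_def)
    show "incseq (\<lambda>n. \<integral>\<^sup>+p. ennreal ((f (fst p) - f (snd p))\<^sup>2 * indicator (exh n \<times> exh n) p) \<partial>J)"
      "incseq (\<lambda>n. \<integral>\<^sup>+x. ennreal ((f x)\<^sup>2 * indicator (exh n) x) \<partial>k)"
      unfolding incseq_def using sub
      by (auto intro!: nn_integral_mono ennreal_leI mult_left_mono simp: indicator_def) blast+
  qed
  then show ?thesis
    unfolding nn_integral_indicator_SUP[OF meas_J[OF f] s(1) i U, symmetric]
      nn_integral_indicator_SUP[OF meas_k[OF f] s(2) exh_inc exh_UN, symmetric]
    by (simp add: jk_def)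
qed

section \<open>Functions locally in the domain\<close>

lemma Dloc_seq:
  assumes "w \<in> Dloc m D"
  obtains v where "\<And>n. v n \<in> D" "\<And>n. AE x in m. x \<in> exh n \<longrightarrow> w x = v n x"
proof -
  have "\<exists>v. v \<in> D \<and> (AE x in m. x \<in> exh n \<longrightarrow> w x = v x)" for n
    using assms exh_open[of n] exh_compact[of n] by (auto simp: Dloc_def)
  then obtain v where "\<And>n. v n \<in> D \<and> (AE x in m. x \<in> exh n \<longrightarrow> w x = v n x)" by metis
  then show ?thesis using that by blast
qed

lemma Dloc_meas: "w \<in> Dloc m D \<Longrightarrow> w \<in> borel_measurable m"
  by (simp add: Dloc_def L2loc_def)

lemma DlocI:
  assumes w: "w \<in> borel_measurable m" and ex: "\<And>n. \<exists>v\<in>D. AE x in m. x \<in> exh n \<longrightarrow> w x = v x"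
  shows "w \<in> Dloc m D"
proof -
  have "integrable m (\<lambda>x. indicator K x * (w x)\<^sup>2)" if K: "compact K" for K
  proof -
    obtain n where n: "K \<subseteq> exh n" using exh_cover[OF K] by blast
    obtain v where v: "v \<in> D" "AE x in m. x \<in> exh n \<longrightarrow> w x = v x" using ex[of n] by blast
    have Ks: "K \<in> sets m" using K by (simp add: sets_m borel_compact)
    show ?thesis
    proof (rule Bochner_Integration.integrable_bound[OF L2_integrable[OF D_L2[OF v(1)]]])
      show "AE x in m. norm (indicator K x * (w x)\<^sup>2) \<le> norm ((v x)\<^sup>2)"
        using v(2) by eventually_elim (use n in \<open>auto simp: indicator_def\<close>)
    qed (use w Ks in measurable)
  qed
  moreover have "\<exists>v\<in>D. AE x in m. x \<in> G \<longrightarrow> w x = v x" if G: "compact (closure G)" for G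
  proof -
    obtain n where n: "closure G \<subseteq> exh n" using exh_cover[OF G] by blast
    obtain v where v: "v \<in> D" "AE x in m. x \<in> exh n \<longrightarrow> w x = v x" using ex[of n] by blast
    have "AE x in m. x \<in> G \<longrightarrow> w x = v x"
      using v(2) by eventually_elim (use n closure_subset[of G] in auto)
    then show ?thesis using v(1) by blast
  qed
  ultimately show ?thesis using w by (simp add: Dloc_def L2loc_def)
qed

lemma D_Dloc: "u \<in> D \<Longrightarrow> u \<in> Dloc m D"
  by (rule DlocI[OF D_meas]) auto

text \<open>Versions of the local representatives agree quasi-everywhere on overlaps. Off one open
  set of small capacity they are continuous and agree on all overlaps, so the function that uses at
  x the version with the least admissible index is locally one of them and hence continuous
  there.\<close>

lemma Dloc_qc_exists:
  assumes w: "w \<in> Dloc m D"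
  shows "\<exists>f. f \<in> borel_measurable borel \<and> qc f \<and> (AE x in m. f x = w x)"
proof -
  obtain v where v: "\<And>n. v n \<in> D" "\<And>n. AE x in m. x \<in> exh n \<longrightarrow> w x = v n x"
    using Dloc_seq[OF w] by blast
  have "\<exists>f. f \<in> borel_measurable borel \<and> qc f \<and> (AE x in m. f x = v n x)" for n
    using qc_exists[OF v(1)[of n]] by blast
  then obtain f where f: "\<And>n. f n \<in> borel_measurable borel" "\<And>n. qc (f n)" "\<And>n. AE x in m. f n x = v n x"
    by metis
  define i where "i x = (LEAST n. x \<in> exh n)" for x
  have ix: "x \<in> exh (i x)" for x
    unfolding i_def by (rule LeastI_ex) (use exh_UN in blast)
  define F where "F x = f (i x) x" for x
  have [measurable]: "exh n \<in> sets borel" for n using exh_open by auto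
  have "i \<in> measurable borel (count_space UNIV)" unfolding i_def by measurable
  then have Fm: "F \<in> borel_measurable borel" unfolding F_def
    by (rule measurable_compose_countable[rotated]) (rule f)
  have small: "\<exists>U. open U \<and> cap U < ennreal e \<and>
      (continuous_on (- U) (f n) \<and> (\<forall>x. x \<notin> U \<longrightarrow> x \<in> exh n \<inter> exh j \<longrightarrow> f n x = f j x))"
    if "0 < e" for e n j
  proof (rule small_pair[OF qcD[OF f(2)] qc_unique[OF f(2) f(2)] _ _ that])
    show "open (exh n \<inter> exh j)" using exh_open by auto
    show "AE x in m. x \<in> exh n \<inter> exh j \<longrightarrow> f n x = f j x"
      using v(2)[of n] v(2)[of j] f(3)[of n] f(3)[of j] by eventually_elim auto
  qed (auto intro: continuous_on_Compl_mono)
  have "qc F"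
    unfolding quasi_continuous_def
  proof (intro allI impI)
    fix e :: real assume e: "0 < e"
    \<comment> \<open>A pair of indices is coded as one number, since \<open>small_Union\<close>
      merges a single sequence of properties. The pairs (n, n) give continuity of each version, the
      pairs (n, j) agreement on overlaps.\<close>
    define P where "P t U \<longleftrightarrow> continuous_on (- U) (f (fst (prod_decode t))) \<and>
      (\<forall>x. x \<notin> U \<longrightarrow> x \<in> exh (fst (prod_decode t)) \<inter> exh (snd (prod_decode t)) \<longrightarrow>
        f (fst (prod_decode t)) x = f (snd (prod_decode t)) x)" for t U
    have "\<exists>W. open W \<and> cap W < ennreal e \<and> (\<forall>t. P t W)"
    proof (rule small_Union[OF _ _ e])
      show "\<exists>U. open U \<and> cap U < ennreal e \<and> P t U" if "0 < e" for t e
        unfolding P_def by (rule small[OF that])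
      show "P t W" if "P t U" "U \<subseteq> W" for t U W
        using that unfolding P_def by (auto intro: continuous_on_Compl_mono)
    qed
    then obtain W where W: "open W" "cap W < ennreal e" "\<And>t. P t W" by blast
    have Wc: "continuous_on (- W) (f n)" for n
      using W(3)[of "prod_encode (n, n)"] by (simp add: P_def)
    have We: "f n x = f j x" if "x \<notin> W" "x \<in> exh n" "x \<in> exh j" for n j x
      using W(3)[of "prod_encode (n, j)"] that by (simp add: P_def)
    have "continuous (at x within - W) F" if x: "x \<in> - W" for x
    proof -
      obtain d where d: "0 < d" "ball x d \<subseteq> exh (i x)"
        using ix[of x] exh_open[of "i x"] open_contains_ball_eq by metis
      show ?thesis
      proof (rule continuous_transform_within[OF _ d(1) x])
        show "continuous (at x within - W) (f (i x))"
          using Wc x by (simp add: continuous_on_eq_continuous_within)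
        fix y assume y: "y \<in> - W" "dist y x < d"
        then have "y \<in> exh (i x)" using d(2) by (auto simp: dist_commute)
        then show "f (i x) y = F y" unfolding F_def using We[of y "i x" "i y"] ix[of y] y(1) by auto
      qed
    qed
    then have "continuous_on (- W) F" by (simp add: continuous_on_eq_continuous_within)
    then show "\<exists>G. open G \<and> cap G < ennreal e \<and> continuous_on (- G) F" using W by blast
  qed
  moreover have "AE x in m. F x = w x"
  proof -
    have "AE x in m. \<forall>n. x \<in> exh n \<longrightarrow> w x = v n x" using v(2) by (simp add: AE_all_countable)
    moreover have "AE x in m. \<forall>n. f n x = v n x" using f(3) by (simp add: AE_all_countable)
    ultimately show ?thesis by eventually_elim (metis F_def ix)
  qed
  ultimately show ?thesis using Fm by blast
qed

text \<open>The version chosen inside \<open>Qloc\<close> is only quasi-continuous. This one is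
  Borel as well, so that integrals against J and k are additive; the two choices agree off a set of
  zero capacity.\<close>

definition bq :: "('a \<Rightarrow> real) \<Rightarrow> 'a \<Rightarrow> real" where
  "bq u = (SOME f. f \<in> borel_measurable borel \<and> qc f \<and> (AE x in m. f x = u x))"

lemma bq:
  assumes "w \<in> Dloc m D"
  shows "bq w \<in> borel_measurable borel" "qc (bq w)" "AE x in m. bq w x = w x"
  using someI_ex[OF Dloc_qc_exists[OF assms]] unfolding bq_def by auto

lemmas bqD = bq[OF D_Dloc]

text \<open>Energy of u inside G. For open G its real value is a quadratic form on D, bounded by Q,
  that sees u on G only; this makes it computable for functions that lie in D merely
  locally.\<close>

definition en :: "'a set \<Rightarrow> ('a \<Rightarrow> real) \<Rightarrow> ennreal" where
  "en G u = emeasure (mu u) G + jk G (bq u)"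

lemma en_version:
  assumes u: "u \<in> D" and f: "qc f" and G: "open G" and ae: "AE x in m. f x = u x"
  shows "en G u = emeasure (mu u) G + jk G f"
proof -
  have "AE x in m. x \<in> G \<longrightarrow> bq u x = f x" using bqD(3)[OF u] ae by eventually_elim auto
  then show ?thesis unfolding en_def using jk_cong[OF bqD(2)[OF u] f G] by simp
qed

lemma en_cong:
  assumes u: "u \<in> D" and v: "v \<in> D" and G: "open G" and ae: "AE x in m. x \<in> G \<longrightarrow> u x = v x"
  shows "en G u = en G v"
proof -
  have "AE x in m. x \<in> G \<longrightarrow> bq u x = bq v x"
    using bqD(3)[OF u] bqD(3)[OF v] ae by eventually_elim auto
  moreover have "em u G = em v G" by (rule em_cong[OF u v G ae]) (use G in auto)
  ultimately show ?thesis
    unfolding en_def mu_measure[OF u] mu_measure[OF v] using jk_cong[OF bqD(2)[OF u] bqD(2)[OF v] G] by simp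
qed

lemma en_UNIV: "u \<in> D \<Longrightarrow> en UNIV u = ennreal (Q u u)"
  using bd_formula[OF _ bqD(2,3), of u] by (simp add: en_def jk_def add.assoc)

lemma en_mono:
  assumes "u \<in> D" "G \<subseteq> H" "H \<in> sets borel"
  shows "en G u \<le> en H u"
  unfolding en_def using assms sets_mu[OF assms(1)] by (intro add_mono emeasure_mono jk_mono) auto

lemma en_le_Q: "u \<in> D \<Longrightarrow> en G u \<le> ennreal (Q u u)"
  using en_mono[of u G UNIV] en_UNIV[of u] by simp

lemma en_add_par:
  assumes u: "u \<in> D" and v: "v \<in> D" and G: "open G"
  shows "en G (\<lambda>x. u x + v x) + en G (\<lambda>x. u x - v x) = 2 * en G u + 2 * en G v"
proof -
  have "AE x in m. bq u x + bq v x = u x + v x" "AE x in m. bq u x - bq v x = u x - v x"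
    using bqD(3)[OF u] bqD(3)[OF v] by (eventually_elim; simp)+
  then have 1: "en G (\<lambda>x. u x + v x) = emeasure (mu (\<lambda>x. u x + v x)) G + jk G (\<lambda>x. bq u x + bq v x)"
      "en G (\<lambda>x. u x - v x) = emeasure (mu (\<lambda>x. u x - v x)) G + jk G (\<lambda>x. bq u x - bq v x)"
    using bqD(2)[OF u] bqD(2)[OF v] u v G by (auto intro!: en_version add_mem diff_mem qc_add qc_diff)
  have 2: "emeasure (mu (\<lambda>x. u x + v x)) G + emeasure (mu (\<lambda>x. u x - v x)) G = 2 * emeasure (mu u) G + 2 * emeasure (mu v) G"
    using mu_par u v G by auto
  have 3: "jk G (\<lambda>x. bq u x + bq v x) + jk G (\<lambda>x. bq u x - bq v x) = 2 * jk G (bq u) + 2 * jk G (bq v)"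
    by (rule jk_par[OF bqD(1)[OF u] bqD(1)[OF v]]) (use G in auto)
  have "en G (\<lambda>x. u x + v x) + en G (\<lambda>x. u x - v x)
    = (emeasure (mu (\<lambda>x. u x + v x)) G + emeasure (mu (\<lambda>x. u x - v x)) G)
      + (jk G (\<lambda>x. bq u x + bq v x) + jk G (\<lambda>x. bq u x - bq v x))"
    unfolding 1 by (simp add: ac_simps)
  also have "\<dots> = 2 * en G u + 2 * en G v" unfolding 2 3 en_def by (simp add: distrib_left ac_simps)
  finally show ?thesis .
qed

lemma en_scale:
  assumes u: "u \<in> D" and G: "open G"
  shows "en G (\<lambda>x. c * u x) = ennreal (c\<^sup>2) * en G u"
proof -
  have "AE x in m. c * bq u x = c * u x" using bqD(3)[OF u] by eventually_elim simp
  then have 1: "en G (\<lambda>x. c * u x) = emeasure (mu (\<lambda>x. c * u x)) G + jk G (\<lambda>x. c * bq u x)"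
    by (rule en_version[OF scale_mem[OF u] qc_scale[OF bqD(2)[OF u]] G])
  have 2: "emeasure (mu (\<lambda>x. c * u x)) G = ennreal (c\<^sup>2) * emeasure (mu u) G" using mu_hom u G by auto
  have 3: "jk G (\<lambda>x. c * bq u x) = ennreal (c\<^sup>2) * jk G (bq u)"
    by (rule jk_hom[OF bqD(1)[OF u]]) (use G in auto)
  show ?thesis unfolding 1 2 3 by (simp add: en_def distrib_left)
qed

lemma en_quad:
  assumes G: "open G"
  shows "quad_form D (\<lambda>u. enn2real (en G u))"
proof (rule quad_form_ennreal[OF fun_space_axioms])
  show "en G u < \<infinity>" if "u \<in> D" for u
    using en_le_Q[OF that, of G] ennreal_less_top[of "Q u u"] by (simp add: le_less_trans)
qed (use en_add_par en_scale G in auto)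

lemma en_sym_clip:
  assumes u: "u \<in> D" and a: "0 \<le> a" and G: "open G"
  shows "en G (\<lambda>x. max (- a) (min a (u x))) \<le> en G u"
proof -
  let ?c = "\<lambda>x. max (- a) (min a (u x))" and ?f = "\<lambda>x. max (- a) (min a (bq u x))"
  have c: "?c \<in> D" by (rule sym_clip_mem[OF u a])
  have "AE x in m. ?f x = ?c x" using bqD(3)[OF u] by eventually_elim simp
  moreover have "qc ?f" by (intro qc_max qc_min qc_cont bqD(2)[OF u] continuous_intros)
  ultimately have "en G ?c = emeasure (mu ?c) G + jk G ?f" by (intro en_version[OF c _ G])
  also have "\<dots> \<le> emeasure (mu u) G + jk G (bq u)"
  proof (rule add_mono)
    show "emeasure (mu ?c) G \<le> emeasure (mu u) G"
      unfolding mu_measure[OF u] mu_measure[OF c] by (intro ennreal_leI em_sym_clip[OF u a]) (use G in auto)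
    show "jk G ?f \<le> jk G (bq u)" by (rule jk_contraction) (use a in auto)
  qed
  finally show ?thesis by (simp add: en_def)
qed

lemma max_diff_sq: "(max a b - max c d)\<^sup>2 \<le> (a - c)\<^sup>2 + (b - d)\<^sup>2" for a b c d :: real
proof -
  have "\<bar>max a b - max c d\<bar> \<le> \<bar>a - c\<bar> \<or> \<bar>max a b - max c d\<bar> \<le> \<bar>b - d\<bar>" by linarith
  then have "(max a b - max c d)\<^sup>2 \<le> (a - c)\<^sup>2 \<or> (max a b - max c d)\<^sup>2 \<le> (b - d)\<^sup>2"
    by (simp only: abs_le_square_iff)
  then show ?thesis using zero_le_power2[of "a - c"] zero_le_power2[of "b - d"] by linarith
qed

lemma en_max:
  assumes u: "u \<in> D" and v: "v \<in> D" and G: "open G"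
  shows "en G (\<lambda>x. max (u x) (v x)) \<le> en G u + en G v"
proof -
  let ?c = "\<lambda>x. max (u x) (v x)" and ?f = "\<lambda>x. max (bq u x) (bq v x)"
  have c: "?c \<in> D" by (rule max_mem[OF u v])
  have Gs: "G \<in> sets borel" using G by auto
  have "AE x in m. ?f x = ?c x" using bqD(3)[OF u] bqD(3)[OF v] by eventually_elim simp
  moreover have "qc ?f" by (intro qc_max bqD(2) u v)
  ultimately have "en G ?c = emeasure (mu ?c) G + jk G ?f" by (intro en_version[OF c _ G])
  also have "\<dots> \<le> (emeasure (mu u) G + emeasure (mu v) G) + (jk G (bq u) + jk G (bq v))"
  proof (rule add_mono)
    show "emeasure (mu ?c) G \<le> emeasure (mu u) G + emeasure (mu v) G"
      unfolding mu_measure[OF u] mu_measure[OF v] mu_measure[OF c]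
      using em_max_le[OF u v Gs] by (simp add: ennreal_plus[symmetric] del: ennreal_plus)
    show "jk G ?f \<le> jk G (bq u) + jk G (bq v)"
    proof (rule jk_le_add[OF bqD(1)[OF u] bqD(1)[OF v] Gs])
      show "(?f x - ?f y)\<^sup>2 \<le> (bq u x - bq u y)\<^sup>2 + (bq v x - bq v y)\<^sup>2" for x y by (rule max_diff_sq)
      show "(?f x)\<^sup>2 \<le> (bq u x)\<^sup>2 + (bq v x)\<^sup>2" for x by (simp add: max_def)
    qed
  qed
  finally show ?thesis by (simp add: en_def ac_simps)
qed

abbreviation "QL \<equiv> Qloc m Q D mu J k"

text \<open>Local and nonlocal parts depend only on w on the set considered, so any choice of
  representatives may be used. Every relatively compact open set lies in some \<open>exh n\<close>,
  which reduces the supremum in \<open>mu_loc_mass\<close> to the exhaustion; monotonicity in n then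
  lets the suprema of the two parts be added.\<close>

lemma Qloc_SUP:
  assumes w: "w \<in> Dloc m D" and v: "\<And>n. v n \<in> D" and ae: "\<And>n. AE x in m. x \<in> exh n \<longrightarrow> w x = v n x"
  shows "QL w = (SUP n. en (exh n) (v n))" and "incseq (\<lambda>n. en (exh n) (v n))"
proof -
  have sub: "exh i \<subseteq> exh j" if "i \<le> j" for i j using exh_inc that by (auto simp: incseq_def)
  have vv: "AE x in m. x \<in> exh i \<longrightarrow> v i x = v j x" if "i \<le> j" for i j
    using ae[of i] ae[of j] by eventually_elim (use sub[OF that] in auto)
  have inc_mu: "incseq (\<lambda>n. emeasure (mu (v n)) (exh n))"
    unfolding incseq_def
  proof (intro allI impI)
    fix i j :: nat assume ij: "i \<le> j"
    have "em (v i) (exh i) = em (v j) (exh i)"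
      by (rule em_cong[OF v v exh_open vv[OF ij]]) (use exh_open in auto)
    also have "\<dots> \<le> em (v j) (exh j)" by (rule em_mono[OF v sub[OF ij]]) (use exh_open in auto)
    finally show "emeasure (mu (v i)) (exh i) \<le> emeasure (mu (v j)) (exh j)"
      unfolding mu_measure[OF v] by (rule ennreal_leI)
  qed
  have jv: "jk (exh n) (bq (v n)) = jk (exh n) (bq w)" for n
  proof (rule jk_cong[OF bqD(2)[OF v] bq(2)[OF w] exh_open])
    show "AE x in m. x \<in> exh n \<longrightarrow> bq (v n) x = bq w x"
      using bqD(3)[OF v, of n] bq(3)[OF w] ae[of n] by eventually_elim auto
  qed
  have inc_jk: "incseq (\<lambda>n. jk (exh n) (bq (v n)))"
    unfolding jv incseq_def using jk_mono sub by blast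
  show "incseq (\<lambda>n. en (exh n) (v n))"
    using inc_mu inc_jk unfolding en_def incseq_def by (blast intro: add_mono)
  have mass: "mu_loc_mass m D mu w = (SUP n. emeasure (mu (v n)) (exh n))"
    unfolding mu_loc_mass_def
  proof (rule antisym)
    let ?P = "{(G, v). open G \<and> compact (closure G) \<and> v \<in> D \<and> (AE x in m. x \<in> G \<longrightarrow> w x = v x)}"
    show "(SUP p\<in>?P. emeasure (mu (snd p)) (fst p)) \<le> (SUP n. emeasure (mu (v n)) (exh n))"
    proof (rule SUP_least)
      fix p assume "p \<in> ?P"
      then obtain G u where p: "p = (G, u)" "open G" "compact (closure G)" "u \<in> D"
        "AE x in m. x \<in> G \<longrightarrow> w x = u x" by auto
      obtain n where n: "closure G \<subseteq> exh n" using exh_cover[OF p(3)] by blast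
      then have Gn: "G \<subseteq> exh n" using closure_subset[of G] by blast
      have "AE x in m. x \<in> G \<longrightarrow> u x = v n x"
        using p(5) ae[of n] by eventually_elim (use Gn in auto)
      then have "em u G = em (v n) G"
        by (rule em_cong[OF p(4) v p(2)]) (use p(2) in auto)
      also have "\<dots> \<le> em (v n) (exh n)" by (rule em_mono[OF v Gn]) (use exh_open in auto)
      finally have "emeasure (mu u) G \<le> emeasure (mu (v n)) (exh n)"
        unfolding mu_measure[OF v] mu_measure[OF p(4)] by (rule ennreal_leI)
      then show "emeasure (mu (snd p)) (fst p) \<le> (SUP n. emeasure (mu (v n)) (exh n))"
        unfolding p(1) fst_conv snd_conv by (rule SUP_upper2[OF UNIV_I])
    qed
    show "(SUP n. emeasure (mu (v n)) (exh n)) \<le> (SUP p\<in>?P. emeasure (mu (snd p)) (fst p))"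
    proof (rule SUP_least)
      fix n
      have "(exh n, v n) \<in> ?P" using exh_open exh_compact v ae by auto
      then show "emeasure (mu (v n)) (exh n) \<le> (SUP p\<in>?P. emeasure (mu (snd p)) (fst p))"
        by (rule SUP_upper2) simp
    qed
  qed
  \<comment> \<open>The version that \<open>Qloc\<close> picks; uniqueness quasi-everywhere replaces
    it by \<open>bq w\<close>.\<close>
  define f where "f = (SOME f. qc f \<and> (AE x in m. f x = w x))"
  have "\<exists>f. qc f \<and> (AE x in m. f x = w x)" using bq(2,3)[OF w] by blast
  then have f: "qc f" "AE x in m. f x = w x" unfolding f_def using someI_ex[of "\<lambda>f. qc f \<and> (AE x in m. f x = w x)"] by auto
  have "QL w = mu_loc_mass m D mu w + jk UNIV f"
    unfolding Qloc_def f_def[symmetric] Let_def jk_def by (simp add: add.assoc)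
  also have "jk UNIV f = jk UNIV (bq w)"
  proof (rule jk_cong[OF f(1) bq(2)[OF w] open_UNIV])
    show "AE x in m. x \<in> UNIV \<longrightarrow> f x = bq w x" using f(2) bq(3)[OF w] by eventually_elim simp
  qed
  also have "\<dots> = (SUP n. jk (exh n) (bq (v n)))" unfolding jv by (rule jk_SUP[OF bq(1)[OF w]])
  also have "mu_loc_mass m D mu w + (SUP n. jk (exh n) (bq (v n))) = (SUP n. en (exh n) (v n))"
    unfolding mass en_def by (rule ennreal_SUP_add[OF inc_mu inc_jk, symmetric])
  finally show "QL w = (SUP n. en (exh n) (v n))" .
qed

lemma Qloc_D:
  assumes u: "u \<in> D"
  shows "QL u = ennreal (Q u u)"
proof -
  have "QL u = (SUP n. en (exh n) u)" by (rule Qloc_SUP(1)[OF D_Dloc[OF u]]) (use u in auto)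
  also have "\<dots> = (SUP n. emeasure (mu u) (exh n)) + (SUP n. jk (exh n) (bq u))"
    unfolding en_def
  proof (rule ennreal_SUP_add)
    show "incseq (\<lambda>n. emeasure (mu u) (exh n))" "incseq (\<lambda>n. jk (exh n) (bq u))"
      using exh_inc exh_open sets_mu[OF u] by (auto simp: incseq_def intro!: emeasure_mono jk_mono)
  qed
  also have "(SUP n. emeasure (mu u) (exh n)) = emeasure (mu u) (\<Union>n. exh n)"
    by (rule SUP_emeasure_incseq) (use exh_inc exh_open sets_mu[OF u] in auto)
  also have "(SUP n. jk (exh n) (bq u)) = jk UNIV (bq u)" by (rule jk_SUP[OF bqD(1)[OF u], symmetric])
  finally show ?thesis using en_UNIV[OF u] by (simp add: exh_UN en_def)
qed

section \<open>Linear and lattice operations on D(Q)loc and their energies\<close>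

lemma Dloc_comp2:
  assumes w: "w \<in> Dloc m D" and z: "z \<in> Dloc m D"
    and h: "continuous_on UNIV (\<lambda>p. h (fst p) (snd p))"
    and hD: "\<And>u v. u \<in> D \<Longrightarrow> v \<in> D \<Longrightarrow> (\<lambda>x. h (u x) (v x)) \<in> D"
  shows "(\<lambda>x. h (w x) (z x)) \<in> Dloc m D"
proof (rule DlocI)
  have "(\<lambda>x. (w x, z x)) \<in> borel_measurable m"
    using Dloc_meas[OF w] Dloc_meas[OF z] by (rule borel_measurable_Pair)
  from measurable_compose[OF this borel_measurable_continuous_onI[OF h]]
  show "(\<lambda>x. h (w x) (z x)) \<in> borel_measurable m" by simp
  fix n
  obtain u where u: "\<And>n. u n \<in> D" "\<And>n. AE x in m. x \<in> exh n \<longrightarrow> w x = u n x" using Dloc_seq[OF w] by blast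
  obtain v where v: "\<And>n. v n \<in> D" "\<And>n. AE x in m. x \<in> exh n \<longrightarrow> z x = v n x" using Dloc_seq[OF z] by blast
  have "AE x in m. x \<in> exh n \<longrightarrow> h (w x) (z x) = h (u n x) (v n x)"
    using u(2)[of n] v(2)[of n] by eventually_elim auto
  then show "\<exists>v\<in>D. AE x in m. x \<in> exh n \<longrightarrow> h (w x) (z x) = v x"
    by (rule bexI[OF _ hD[OF u(1)[of n] v(1)[of n]]])
qed

lemma Dloc_add: "w \<in> Dloc m D \<Longrightarrow> z \<in> Dloc m D \<Longrightarrow> (\<lambda>x. w x + z x) \<in> Dloc m D"
  by (rule Dloc_comp2[where h = "\<lambda>a b. a + b"]) (auto intro!: continuous_intros add_mem)

lemma Dloc_diff: "w \<in> Dloc m D \<Longrightarrow> z \<in> Dloc m D \<Longrightarrow> (\<lambda>x. w x - z x) \<in> Dloc m D"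
  by (rule Dloc_comp2[where h = "\<lambda>a b. a - b"]) (auto intro!: continuous_intros diff_mem)

lemma Dloc_max: "w \<in> Dloc m D \<Longrightarrow> z \<in> Dloc m D \<Longrightarrow> (\<lambda>x. max (w x) (z x)) \<in> Dloc m D"
  by (rule Dloc_comp2[where h = max]) (auto intro!: continuous_intros max_mem)

lemma Dloc_scale: "w \<in> Dloc m D \<Longrightarrow> (\<lambda>x. c * w x) \<in> Dloc m D"
  by (rule Dloc_comp2[where h = "\<lambda>a b. c * a" and z = w]) (auto intro!: continuous_intros scale_mem)

lemma Dloc_clip: "w \<in> Dloc m D \<Longrightarrow> 0 \<le> a \<Longrightarrow> (\<lambda>x. max (- a) (min a (w x))) \<in> Dloc m D"
  by (rule Dloc_comp2[where h = "\<lambda>y b. max (- a) (min a y)" and z = w])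
     (auto intro!: continuous_intros sym_clip_mem)

lemma Qloc_par:
  assumes w: "w \<in> Dloc m D" and z: "z \<in> Dloc m D"
  shows "QL (\<lambda>x. w x + z x) + QL (\<lambda>x. w x - z x) = 2 * QL w + 2 * QL z"
proof -
  obtain u where u: "\<And>n. u n \<in> D" "\<And>n. AE x in m. x \<in> exh n \<longrightarrow> w x = u n x" using Dloc_seq[OF w] by blast
  obtain v where v: "\<And>n. v n \<in> D" "\<And>n. AE x in m. x \<in> exh n \<longrightarrow> z x = v n x" using Dloc_seq[OF z] by blast
  have p: "AE x in m. x \<in> exh n \<longrightarrow> w x + z x = u n x + v n x"
    and d: "AE x in m. x \<in> exh n \<longrightarrow> w x - z x = u n x - v n x" for n
    using u(2)[of n] v(2)[of n] by (eventually_elim; simp)+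
  note P = Qloc_SUP[OF Dloc_add[OF w z] add_mem[OF u(1) v(1)] p]
  note M = Qloc_SUP[OF Dloc_diff[OF w z] diff_mem[OF u(1) v(1)] d]
  note U = Qloc_SUP[OF w u] and V = Qloc_SUP[OF z v]
  have dbl: "incseq (\<lambda>n. 2 * f n)" "2 * (SUP n. f n) = (SUP n. 2 * f n)" if "incseq f" for f :: "nat \<Rightarrow> ennreal"
    using that by (auto simp: incseq_def SUP_mult_left_ennreal intro: mult_left_mono)
  have "QL (\<lambda>x. w x + z x) + QL (\<lambda>x. w x - z x)
    = (SUP n. en (exh n) (\<lambda>x. u n x + v n x) + en (exh n) (\<lambda>x. u n x - v n x))"
    unfolding P(1) M(1) by (rule ennreal_SUP_add[OF P(2) M(2), symmetric])
  also have "\<dots> = (SUP n. 2 * en (exh n) (u n) + 2 * en (exh n) (v n))"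
    by (simp only: en_add_par[OF u(1) v(1) exh_open])
  also have "\<dots> = 2 * QL w + 2 * QL z"
    unfolding U(1) V(1) dbl(2)[OF U(2)] dbl(2)[OF V(2)]
    by (rule ennreal_SUP_add[OF dbl(1)[OF U(2)] dbl(1)[OF V(2)]])
  finally show ?thesis .
qed

lemma Qloc_hom:
  assumes w: "w \<in> Dloc m D"
  shows "QL (\<lambda>x. c * w x) = ennreal (c\<^sup>2) * QL w"
proof -
  obtain u where u: "\<And>n. u n \<in> D" "\<And>n. AE x in m. x \<in> exh n \<longrightarrow> w x = u n x" using Dloc_seq[OF w] by blast
  have s: "AE x in m. x \<in> exh n \<longrightarrow> c * w x = c * u n x" for n using u(2)[of n] by eventually_elim simp
  show ?thesis
    unfolding Qloc_SUP(1)[OF Dloc_scale[OF w] scale_mem[OF u(1)] s] Qloc_SUP(1)[OF w u]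
      en_scale[OF u(1) exh_open] SUP_mult_left_ennreal ..
qed

lemma Qloc_clip:
  assumes w: "w \<in> Dloc m D" and a: "0 \<le> a"
  shows "QL (\<lambda>x. max (- a) (min a (w x))) \<le> QL w"
proof -
  obtain u where u: "\<And>n. u n \<in> D" "\<And>n. AE x in m. x \<in> exh n \<longrightarrow> w x = u n x" using Dloc_seq[OF w] by blast
  have s: "AE x in m. x \<in> exh n \<longrightarrow> max (- a) (min a (w x)) = max (- a) (min a (u n x))" for n
    using u(2)[of n] by eventually_elim simp
  show ?thesis
    unfolding Qloc_SUP(1)[OF Dloc_clip[OF w a] sym_clip_mem[OF u(1) a] s] Qloc_SUP(1)[OF w u]
    by (rule SUP_mono') (rule en_sym_clip[OF u(1) a exh_open])
qed

lemma Qloc_max: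
  assumes w: "w \<in> Dloc m D" and z: "z \<in> Dloc m D"
  shows "QL (\<lambda>x. max (w x) (z x)) \<le> QL w + QL z"
proof -
  obtain u where u: "\<And>n. u n \<in> D" "\<And>n. AE x in m. x \<in> exh n \<longrightarrow> w x = u n x" using Dloc_seq[OF w] by blast
  obtain v where v: "\<And>n. v n \<in> D" "\<And>n. AE x in m. x \<in> exh n \<longrightarrow> z x = v n x" using Dloc_seq[OF z] by blast
  have s: "AE x in m. x \<in> exh n \<longrightarrow> max (w x) (z x) = max (u n x) (v n x)" for n
    using u(2)[of n] v(2)[of n] by eventually_elim simp
  show ?thesis
    unfolding Qloc_SUP(1)[OF Dloc_max[OF w z] max_mem[OF u(1) v(1)] s] Qloc_SUP(1)[OF w u] Qloc_SUP(1)[OF z v]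
  proof (rule SUP_least)
    fix n
    have "en (exh n) (\<lambda>x. max (u n x) (v n x)) \<le> en (exh n) (u n) + en (exh n) (v n)"
      by (rule en_max[OF u(1) v(1) exh_open])
    also have "\<dots> \<le> (SUP n. en (exh n) (u n)) + (SUP n. en (exh n) (v n))"
      by (intro add_mono SUP_upper UNIV_I)
    finally show "en (exh n) (\<lambda>x. max (u n x) (v n x)) \<le> (SUP n. en (exh n) (u n)) + (SUP n. en (exh n) (v n))" .
  qed
qed

lemma Qloc_minus: "w \<in> Dloc m D \<Longrightarrow> QL (\<lambda>x. - w x) = QL w"
  using Qloc_hom[of w "-1"] by simp

lemma Dloc_minus: "w \<in> Dloc m D \<Longrightarrow> (\<lambda>x. - w x) \<in> Dloc m D"
  using Dloc_scale[of w "-1"] by simp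

lemma
  assumes w: "w \<in> Dloc m D" and z: "z \<in> Dloc m D"
  shows Dloc_min: "(\<lambda>x. min (w x) (z x)) \<in> Dloc m D"
    and Qloc_min: "QL (\<lambda>x. min (w x) (z x)) \<le> QL w + QL z"
proof -
  have eq: "(\<lambda>x. min (w x) (z x)) = (\<lambda>x. - max (- w x) (- z x))" by (auto simp: fun_eq_iff)
  note M = Dloc_max[OF Dloc_minus[OF w] Dloc_minus[OF z]]
  show "(\<lambda>x. min (w x) (z x)) \<in> Dloc m D" unfolding eq by (rule Dloc_minus[OF M])
  show "QL (\<lambda>x. min (w x) (z x)) \<le> QL w + QL z"
    unfolding eq Qloc_minus[OF M]
    using Qloc_max[OF Dloc_minus[OF w] Dloc_minus[OF z]] unfolding Qloc_minus[OF w] Qloc_minus[OF z] .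
qed

text \<open>Lower semicontinuity is reduced to the Hilbert space D by the lattice cutoff
  \<open>max (- a \<phi>) (min (a \<phi>) w)\<close>, whose energy is controlled without a Leibniz rule.\<close>

lemma Qloc_lsc:
  assumes ws: "\<And>j. ws j \<in> Dloc m D" and a: "0 \<le> a" and bd: "\<And>j x. \<bar>ws j x\<bar> \<le> a"
    and w: "w \<in> borel_measurable m" and lim: "\<And>x. (\<lambda>j. ws j x) \<longlonglongrightarrow> w x"
    and B: "\<And>j. QL (ws j) \<le> ennreal B" "0 \<le> B"
  shows "w \<in> Dloc m D" "QL w \<le> ennreal B"
proof -
  have wa: "\<bar>w x\<bar> \<le> a" for x
    using tendsto_rabs[OF lim[of x]] bd by (intro LIMSEQ_le_const2) auto
  have key: "\<exists>v\<in>D. (\<forall>x\<in>exh n. w x = v x) \<and> en (exh n) v \<le> ennreal B" for n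
  proof -
    obtain phi V where p: "phi \<in> D" "phi \<in> Cc" "\<forall>x. 0 \<le> phi x" "\<forall>x. phi x \<le> 1" "open V" "closure (exh n) \<subseteq> V"
        "\<forall>x\<in>V. phi x = 1" "closure {x. phi x \<noteq> 0} \<subseteq> UNIV"
      by (rule cutoff[OF exh_compact[of n] open_UNIV subset_UNIV])
    have p1: "phi x = 1" if "x \<in> exh n" for x
      using p(6,7) that closure_subset[of "exh n"] by blast
    have "compact (closure {x. phi x \<noteq> 0})" using p(2) by (simp add: Cc_def)
    from exh_cover[OF this] obtain N where N: "closure {x. phi x \<noteq> 0} \<subseteq> exh N" by blast
    have p0: "phi x = 0" if "x \<notin> exh N" for x using N that closure_subset[of "{x. phi x \<noteq> 0}"] by blast
    define c where "c g x = max (- a * phi x) (min (a * phi x) (g x))" for g :: "'a \<Rightarrow> real" and x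
    have cD: "c v \<in> D" if "v \<in> D" for v
      unfolding c_def by (intro max_mem min_mem scale_mem p that)
    have cm: "c g \<in> borel_measurable m" if "g \<in> borel_measurable m" for g
      unfolding c_def using D_meas[OF p(1)] that by measurable
    have c1: "c g x = g x" if "x \<in> exh n" "\<bar>g x\<bar> \<le> a" for g x
      using that p1[OF that(1)] by (auto simp: c_def)
    have cb: "\<bar>c g x\<bar> \<le> a * phi x" for g x
    proof -
      have "0 \<le> a * phi x" using a p(3) by simp
      then show ?thesis unfolding c_def by auto
    qed
    have aL: "L2 m (\<lambda>x. a * phi x)" by (rule D_L2[OF scale_mem[OF p(1)]])
    \<comment> \<open>The cutoff vanishes off \<open>exh N\<close>, so only the local representative
      on that set enters, and the result lies in D itself.\<close>
    have cws: "c (ws j) \<in> D" for j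
    proof -
      obtain v where v: "\<And>n. v n \<in> D" "\<And>n. AE x in m. x \<in> exh n \<longrightarrow> ws j x = v n x" using Dloc_seq[OF ws[of j]] by blast
      have "AE x in m. c (v N) x = c (ws j) x"
        using v(2)[of N] by eventually_elim (use p0 in \<open>auto simp: c_def\<close>)
      then show ?thesis by (rule D_AE[OF cD[OF v(1)] cm[OF Dloc_meas[OF ws]]])
    qed
    \<comment> \<open>This bound contains the energy of the cutoff and serves only to keep the
      sequence bounded in energy.\<close>
    have Qc: "Q (c (ws j)) (c (ws j)) \<le> (a\<^sup>2 * Q phi phi) + ((a\<^sup>2 * Q phi phi) + B)" for j
    proof -
      have ap: "(\<lambda>x. b * phi x) \<in> Dloc m D" for b by (rule D_Dloc[OF scale_mem[OF p(1)]])
      have Qap: "QL (\<lambda>x. b * phi x) = ennreal (b\<^sup>2 * Q phi phi)" for b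
        using Qloc_D[OF scale_mem[OF p(1)], of b] Q.hom[OF p(1), of b] by simp
      have pos: "0 \<le> b\<^sup>2 * Q phi phi" for b using Q.nonneg[OF p(1)] by simp
      have "ennreal (Q (c (ws j)) (c (ws j))) = QL (c (ws j))" by (rule Qloc_D[OF cws, symmetric])
      also have "\<dots> \<le> QL (\<lambda>x. - a * phi x) + QL (\<lambda>x. min (a * phi x) (ws j x))"
        unfolding c_def by (rule Qloc_max[OF ap Dloc_min[OF ap ws]])
      also have "\<dots> \<le> QL (\<lambda>x. - a * phi x) + (QL (\<lambda>x. a * phi x) + QL (ws j))"
        by (rule add_left_mono[OF Qloc_min[OF ap ws]])
      also have "\<dots> \<le> ennreal ((- a)\<^sup>2 * Q phi phi) + (ennreal (a\<^sup>2 * Q phi phi) + ennreal B)"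
        unfolding Qap by (intro add_left_mono B)
      also have "\<dots> = ennreal ((a\<^sup>2 * Q phi phi) + ((a\<^sup>2 * Q phi phi) + B))"
        using pos[of a] B(2) by (simp only: ennreal_plus add_nonneg_nonneg power2_minus)
      finally show ?thesis using pos[of a] B(2) by (simp only: ennreal_le_iff add_nonneg_nonneg)
    qed
    have cl: "(\<lambda>j. \<integral>x. (c (ws j) x - c w x)\<^sup>2 \<partial>m) \<longlonglongrightarrow> 0"
    proof (rule L2_dominated_convergence[OF aL])
      show "AE x in m. (\<lambda>j. c (ws j) x) \<longlonglongrightarrow> c w x"
        unfolding c_def by (intro AE_I2 tendsto_intros lim)
    qed (use cm[OF Dloc_meas[OF ws]] cm[OF w] cb in auto)
    have cwL: "L2 m (c w)"
      by (rule L2_dominated[OF aL cm[OF w]]) (intro AE_I2 order_trans[OF cb abs_ge_self])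
    \<comment> \<open>On \<open>exh n\<close> the cutoff is inactive, because phi = 1 and the
      functions are bounded by a. The energy inside \<open>exh n\<close> is therefore that of
      \<open>ws j\<close>, which gives the bound B without a contribution of phi.\<close>
    have enb: "en (exh n) (c (ws j)) \<le> ennreal B" for j
    proof -
      obtain v where v: "\<And>n. v n \<in> D" "\<And>n. AE x in m. x \<in> exh n \<longrightarrow> ws j x = v n x" using Dloc_seq[OF ws[of j]] by blast
      have "AE x in m. x \<in> exh n \<longrightarrow> c (ws j) x = v n x"
        using v(2)[of n] by eventually_elim (use c1[of _ "ws j"] bd in auto)
      then have "en (exh n) (c (ws j)) = en (exh n) (v n)" by (rule en_cong[OF cws v(1) exh_open])
      also have "\<dots> \<le> QL (ws j)" unfolding Qloc_SUP(1)[OF ws v] by (rule SUP_upper) simp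
      finally show ?thesis using B(1)[of j] by (rule order_trans)
    qed
    have fin: "en (exh n) v \<noteq> top" if "v \<in> D" for v
      using en_le_Q[OF that, of "exh n"] by (auto simp: top_unique)
    have le1: "enn2real (en (exh n) v) \<le> Q1 m Q v" if "v \<in> D" for v
    proof -
      have "enn2real (en (exh n) v) \<le> Q v v"
        using en_le_Q[OF that, of "exh n"] Q.nonneg[OF that] by (simp add: enn2real_leI)
      then show ?thesis using Q_le_Q1[of v] by linarith
    qed
    have eb: "enn2real (en (exh n) (c (ws j))) \<le> B" for j
      using enb[of j] B(2) by (rule enn2real_leI[rotated])
    note r = weak_lsc[OF en_quad[OF exh_open[of n]] le1 cws Qc cwL cl eb]
    have "en (exh n) (c w) = ennreal (enn2real (en (exh n) (c w)))" using fin[OF r(1)] by (simp add: less_top)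
    also have "\<dots> \<le> ennreal B" using r(2) by (rule ennreal_leI)
    finally have "en (exh n) (c w) \<le> ennreal B" .
    then show ?thesis using r(1) c1[of _ w] wa by (intro bexI[of _ "c w"]) auto
  qed
  then obtain v where v: "\<And>n. v n \<in> D" "\<And>n x. x \<in> exh n \<Longrightarrow> w x = v n x" "\<And>n. en (exh n) (v n) \<le> ennreal B"
    by metis
  have ae: "AE x in m. x \<in> exh n \<longrightarrow> w x = v n x" for n using v(2) by auto
  show wD: "w \<in> Dloc m D" by (rule DlocI[OF w]) (use v(1) ae in blast)
  show "QL w \<le> ennreal B" unfolding Qloc_SUP(1)[OF wD v(1) ae] by (rule SUP_least) (rule v(3))
qed

end

section \<open>The form on the extended domain\<close>

lemma trunc_eq: "trunc n u = (\<lambda>x. max (- real n) (min (real n) (u x)))"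
  by (auto simp: trunc_def)

lemma trunc_tendsto: "(\<lambda>n. trunc n u x) \<longlonglongrightarrow> u x"
proof -
  obtain N :: nat where N: "\<bar>u x\<bar> \<le> real N" using real_arch_simple by blast
  have "\<forall>\<^sub>F n in sequentially. trunc n u x = u x"
    using eventually_ge_at_top[of N]
  proof eventually_elim
    case (elim n)
    then have "\<bar>u x\<bar> \<le> real n" using N by simp
    then show ?case by (auto simp: trunc_def)
  qed
  then show ?thesis by (rule tendsto_eventually)
qed

context bform
begin

abbreviation "QT \<equiv> Qtilde m Q D mu J k"
abbreviation "DT \<equiv> Dtilde m Q D mu J k"

lemma trunc_meas: "u \<in> borel_measurable m \<Longrightarrow> trunc n u \<in> borel_measurable m"
  unfolding trunc_eq by auto

lemma DTD:
  assumes "u \<in> DT"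
  shows "u \<in> borel_measurable m" "trunc n u \<in> Dloc m D" "QT u = (SUP n. QL (trunc n u))" "QT u < \<infinity>"
  using assms by (auto simp: Dtilde_def Qtilde_def split: if_splits)

lemma QT_upper: "u \<in> DT \<Longrightarrow> QL (trunc n u) \<le> QT u"
  unfolding DTD(3) by (rule SUP_upper) simp

lemma DTI:
  assumes u: "u \<in> borel_measurable m" and "\<And>n. trunc n u \<in> Dloc m D" "\<And>n. QL (trunc n u) \<le> B" "B < \<infinity>"
  shows "u \<in> DT" "QT u \<le> B"
proof -
  show "QT u \<le> B" using assms by (auto simp: Qtilde_def intro: SUP_least)
  then show "u \<in> DT" using u assms(4) by (auto simp: Dtilde_def intro: le_less_trans)
qed

text \<open>Truncation contracts the energy, which gives one inequality; the truncations converge to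
  u in L2, and lower semicontinuity of Q gives the other.\<close>

lemma
  assumes u: "u \<in> D"
  shows D_DT: "u \<in> DT" and QT_D: "QT u = ennreal (Q u u)"
proof -
  have t: "trunc n u \<in> D" for n unfolding trunc_eq by (rule sym_clip_mem[OF u]) simp
  have le: "QL (trunc n u) \<le> ennreal (Q u u)" for n
    using Qloc_clip[OF D_Dloc[OF u], of "real n"] Qloc_D[OF u] by (simp add: trunc_eq)
  show uT: "u \<in> DT" using DTI(1)[OF D_meas[OF u] D_Dloc[OF t] le] by (simp add: ennreal_less_top)
  have QTle: "QT u \<le> ennreal (Q u u)"
    using DTI(2)[OF D_meas[OF u] D_Dloc[OF t] le] by (simp add: ennreal_less_top)
  define s where "s = enn2real (QT u)"
  have s: "QT u = ennreal s" "0 \<le> s" using DTD(4)[OF uT] by (auto simp: s_def)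
  have Qt: "Q (trunc n u) (trunc n u) \<le> s" for n
    using QT_upper[OF uT, of n] unfolding Qloc_D[OF t] s(1) using s(2) by simp
  have lim: "(\<lambda>n. \<integral>x. (trunc n u x - u x)\<^sup>2 \<partial>m) \<longlonglongrightarrow> 0"
  proof (rule L2_dominated_convergence[OF D_L2[OF abs_mem[OF u]]])
    show "AE x in m. (\<lambda>n. trunc n u x) \<longlonglongrightarrow> u x" by (intro AE_I2 trunc_tendsto)
  qed (use D_meas[OF t] D_meas[OF u] in \<open>auto simp: trunc_def\<close>)
  have "Q u u \<le> s" by (rule weak_lsc_Q(2)[OF t Qt D_L2[OF u] lim])
  then show "QT u = ennreal (Q u u)" using QTle s by (intro antisym) (auto intro: ennreal_leI)
qed

text \<open>Truncating at a fixed level makes the sequence uniformly bounded, as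
  \<open>Qloc_lsc\<close> demands, without raising energies. Since a subsequence may be taken, the
  bound is asked for infinitely many indices; the statement is thus one about the limes
  inferior.\<close>

lemma QT_lsc:
  assumes s: "s \<in> borel_measurable m" and sk: "\<And>j. sk j \<in> Dloc m D" and lim: "\<And>x. (\<lambda>j. sk j x) \<longlonglongrightarrow> s x"
    and inf: "infinite {j. QL (sk j) \<le> ennreal B}" and B: "0 \<le> B"
  shows "s \<in> DT" "QT s \<le> ennreal B"
proof -
  obtain r :: "nat \<Rightarrow> nat" where r: "strict_mono r" "\<And>j. QL (sk (r j)) \<le> ennreal B"
    using infinite_enumerate[OF inf] by blast
  have "trunc n s \<in> Dloc m D \<and> QL (trunc n s) \<le> ennreal B" for n
  proof -
    have tD: "trunc n (sk (r j)) \<in> Dloc m D" for j unfolding trunc_eq by (rule Dloc_clip[OF sk]) simp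
    have tb: "\<bar>trunc n (sk (r j)) x\<bar> \<le> real n" for j x by (simp add: trunc_def)
    have tl: "(\<lambda>j. trunc n (sk (r j)) x) \<longlonglongrightarrow> trunc n s x" for x
      unfolding trunc_def using LIMSEQ_subseq_LIMSEQ[OF lim[of x] r(1)] by (intro tendsto_intros) (simp add: o_def)
    have tQ: "QL (trunc n (sk (r j))) \<le> ennreal B" for j
      using Qloc_clip[OF sk[of "r j"], of "real n"] r(2)[of j] by (simp add: trunc_eq)
    show ?thesis using Qloc_lsc[OF tD _ tb trunc_meas[OF s] tl tQ B] by simp
  qed
  then show "s \<in> DT" "QT s \<le> ennreal B" using DTI[OF s, of "ennreal B"] by (auto simp: ennreal_less_top)
qed

text \<open>The contrapositive of \<open>QT_lsc\<close>, in real numbers. Eventual bounds, unlike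
  bounds along subsequences, can be combined for two sequences at one index.\<close>

lemma QT_lower_eventually:
  assumes s: "s \<in> DT" and sk: "\<And>j. sk j \<in> Dloc m D" and lim: "\<And>x. (\<lambda>j. sk j x) \<longlonglongrightarrow> s x"
    and fin: "\<And>j. QL (sk j) < \<infinity>" and e: "0 < e"
  shows "\<exists>N. \<forall>j\<ge>N. enn2real (QT s) - e \<le> enn2real (QL (sk j))"
proof (rule ccontr)
  assume "\<not> ?thesis"
  then have inf: "infinite {j. enn2real (QL (sk j)) < enn2real (QT s) - e}"
    unfolding infinite_nat_iff_unbounded_le by (auto simp: not_le)
  \<comment> \<open>One such index already shows that the lowered bound is nonnegative, as
    \<open>QT_lsc\<close> requires.\<close>
  then obtain i where "enn2real (QL (sk i)) < enn2real (QT s) - e"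
    using not_finite_existsD by auto
  then have pos: "0 \<le> enn2real (QT s) - e" using enn2real_nonneg[of "QL (sk i)"] by linarith
  have "{j. enn2real (QL (sk j)) < enn2real (QT s) - e} \<subseteq> {j. QL (sk j) \<le> ennreal (enn2real (QT s) - e)}"
  proof safe
    fix j assume "enn2real (QL (sk j)) < enn2real (QT s) - e"
    then have "ennreal (enn2real (QL (sk j))) \<le> ennreal (enn2real (QT s) - e)" by (intro ennreal_leI) simp
    then show "QL (sk j) \<le> ennreal (enn2real (QT s) - e)" using fin[of j] by simp
  qed
  then have "infinite {j. QL (sk j) \<le> ennreal (enn2real (QT s) - e)}" using inf by (rule infinite_super)
  then have "QT s \<le> ennreal (enn2real (QT s) - e)"
    by (rule QT_lsc(2)[OF DTD(1)[OF s] sk lim _ pos])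
  then have "enn2real (QT s) \<le> enn2real (QT s) - e" using pos by (rule enn2real_leI[rotated])
  then show False using e by simp
qed

text \<open>The sums and differences of the truncations satisfy the parallelogram law in D(Q)loc and
  converge pointwise to u + v and u - v. Lower semicontinuity of both energies at a common index
  then bounds the sum of the two limits.\<close>

lemma
  assumes u: "u \<in> DT" and v: "v \<in> DT"
  shows DT_add: "(\<lambda>x. u x + v x) \<in> DT" and DT_diff: "(\<lambda>x. u x - v x) \<in> DT"
    and QT_par_le: "QT (\<lambda>x. u x + v x) + QT (\<lambda>x. u x - v x) \<le> 2 * QT u + 2 * QT v"
proof -
  define a where "a j = (\<lambda>x. trunc j u x + trunc j v x)" for j
  define b where "b j = (\<lambda>x. trunc j u x - trunc j v x)" for j
  have aD: "a j \<in> Dloc m D" and bD: "b j \<in> Dloc m D" for j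
    unfolding a_def b_def by (intro Dloc_add Dloc_diff DTD(2) u v)+
  have al: "(\<lambda>j. a j x) \<longlonglongrightarrow> u x + v x" and bl: "(\<lambda>j. b j x) \<longlonglongrightarrow> u x - v x" for x
    unfolding a_def b_def by (intro tendsto_intros trunc_tendsto)+
  define c where "c = enn2real (2 * QT u + 2 * QT v)"
  have "2 * QT u + 2 * QT v < \<infinity>"
    using DTD(4)[OF u] DTD(4)[OF v] by (simp add: ennreal_mult_less_top)
  then have c: "2 * QT u + 2 * QT v = ennreal c" "0 \<le> c" by (simp_all add: c_def)
  have ab: "QL (a j) + QL (b j) \<le> ennreal c" for j
  proof -
    have "QL (a j) + QL (b j) = 2 * QL (trunc j u) + 2 * QL (trunc j v)"
      unfolding a_def b_def by (rule Qloc_par[OF DTD(2)[OF u] DTD(2)[OF v]])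
    also have "\<dots> \<le> 2 * QT u + 2 * QT v" by (intro add_mono mult_left_mono QT_upper u v) auto
    finally show ?thesis unfolding c(1) .
  qed
  have qa: "QL (a j) \<le> ennreal c" for j using order_trans[OF _ ab[of j], of "QL (a j)"] by simp
  have qb: "QL (b j) \<le> ennreal c" for j using order_trans[OF _ ab[of j], of "QL (b j)"] by simp
  have fa: "QL (a j) < \<infinity>" and fb: "QL (b j) < \<infinity>" for j
    using qa[of j] qb[of j] by (auto simp: less_top[symmetric] top_unique)
  have sm: "(\<lambda>x. u x + v x) \<in> borel_measurable m" "(\<lambda>x. u x - v x) \<in> borel_measurable m"
    using DTD(1)[OF u] DTD(1)[OF v] by auto
  show s: "(\<lambda>x. u x + v x) \<in> DT" by (rule QT_lsc(1)[OF sm(1) aD al _ c(2)]) (simp add: qa)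
  show d: "(\<lambda>x. u x - v x) \<in> DT" by (rule QT_lsc(1)[OF sm(2) bD bl _ c(2)]) (simp add: qb)
  let ?s = "enn2real (QT (\<lambda>x. u x + v x))" and ?d = "enn2real (QT (\<lambda>x. u x - v x))"
  have "?s + ?d \<le> c"
  proof (rule field_le_epsilon)
    fix e :: real assume "0 < e"
    then have e2: "0 < e / 2" by simp
    obtain N1 where N1: "\<forall>j\<ge>N1. ?s - e / 2 \<le> enn2real (QL (a j))"
      using QT_lower_eventually[OF s aD al fa e2] by blast
    obtain N2 where N2: "\<forall>j\<ge>N2. ?d - e / 2 \<le> enn2real (QL (b j))"
      using QT_lower_eventually[OF d bD bl fb e2] by blast
    let ?j = "max N1 N2"
    have "enn2real (QL (a ?j)) + enn2real (QL (b ?j)) = enn2real (QL (a ?j) + QL (b ?j))"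
      using fa[of ?j] fb[of ?j] by (simp add: enn2real_plus)
    also have "\<dots> \<le> c" using ab[of ?j] c(2) by (rule enn2real_leI[rotated])
    finally show "?s + ?d \<le> c + e"
      using N1[rule_format, of ?j] N2[rule_format, of ?j] by simp
  qed
  then have "ennreal (?s + ?d) \<le> ennreal c" by (rule ennreal_leI)
  then show "QT (\<lambda>x. u x + v x) + QT (\<lambda>x. u x - v x) \<le> 2 * QT u + 2 * QT v"
    unfolding c(1) using DTD(4)[OF s] DTD(4)[OF d] by (simp add: ennreal_plus)
qed

lemma DT_scale_le:
  assumes u: "u \<in> DT" and c: "c \<noteq> 0"
  shows "(\<lambda>x. c * u x) \<in> DT \<and> QT (\<lambda>x. c * u x) \<le> ennreal (c\<^sup>2) * QT u"
proof -
  have "trunc n (\<lambda>x. c * u x) \<in> Dloc m D \<and> QL (trunc n (\<lambda>x. c * u x)) \<le> ennreal (c\<^sup>2) * QT u" for n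
  proof -
    \<comment> \<open>Truncating c u at n is c times truncating u at n / |c|. This level need not be
      a natural number, so it is applied after truncation at a larger natural number N.\<close>
    define a where "a = real n / \<bar>c\<bar>"
    have a: "0 \<le> a" by (simp add: a_def)
    obtain N :: nat where N: "a \<le> real N" using real_arch_simple by blast
    have "max (- real n) (min (real n) (c * y)) = c * max (- a) (min a (max (- real N) (min (real N) y)))" for y
    proof -
      have "max (- a) (min a (max (- real N) (min (real N) y))) = max (- a) (min a y)" using a N by auto
      moreover have "max (- real n) (min (real n) (c * y)) = c * max (- a) (min a y)"
      proof (cases "0 < c")
        case True
        then show ?thesis unfolding a_def by (auto simp: max_def min_def field_simps)
      next
        case False
        then have "c < 0" using c by simp
        then show ?thesis unfolding a_def by (auto simp: max_def min_def field_simps)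
      qed
      ultimately show ?thesis by simp
    qed
    then have eq: "trunc n (\<lambda>x. c * u x) = (\<lambda>x. c * max (- a) (min a (trunc N u x)))"
      by (simp add: trunc_def fun_eq_iff)
    note t = DTD(2)[OF u, of N]
    have "QL (trunc n (\<lambda>x. c * u x)) \<le> ennreal (c\<^sup>2) * QT u"
      unfolding eq Qloc_hom[OF Dloc_clip[OF t a]]
      by (intro mult_left_mono order_trans[OF Qloc_clip[OF t a] QT_upper[OF u]]) simp
    then show ?thesis unfolding eq using Dloc_scale[OF Dloc_clip[OF t a]] by simp
  qed
  moreover have "ennreal (c\<^sup>2) * QT u < \<infinity>" using DTD(4)[OF u] by (simp add: ennreal_mult_less_top)
  moreover have "(\<lambda>x. c * u x) \<in> borel_measurable m" using DTD(1)[OF u] by auto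
  ultimately show ?thesis using DTI[of "\<lambda>x. c * u x" "ennreal (c\<^sup>2) * QT u"] by blast
qed

lemma
  assumes u: "u \<in> DT"
  shows DT_scale: "(\<lambda>x. c * u x) \<in> DT" and QT_hom: "QT (\<lambda>x. c * u x) = ennreal (c\<^sup>2) * QT u"
proof -
  have "(\<lambda>x. c * u x) \<in> DT \<and> QT (\<lambda>x. c * u x) = ennreal (c\<^sup>2) * QT u"
  proof (cases "c = 0")
    case True
    then show ?thesis using D_DT[OF zero_mem] QT_D[OF zero_mem] Q.q_zero by simp
  next
    case False
    note 1 = DT_scale_le[OF u False]
    have "ennreal (c\<^sup>2) * QT u \<le> ennreal (c\<^sup>2) * (ennreal ((1/c)\<^sup>2) * QT (\<lambda>x. c * u x))"
      using DT_scale_le[of "\<lambda>x. c * u x" "1/c"] 1 False by (intro mult_left_mono) auto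
    also have "\<dots> = ennreal (c\<^sup>2 * (1/c)\<^sup>2) * QT (\<lambda>x. c * u x)"
      by (simp add: ennreal_mult' mult.assoc)
    also have "c\<^sup>2 * (1/c)\<^sup>2 = 1" using False by (simp add: power_divide)
    finally show ?thesis using 1 by (auto intro: antisym)
  qed
  then show "(\<lambda>x. c * u x) \<in> DT" "QT (\<lambda>x. c * u x) = ennreal (c\<^sup>2) * QT u" by auto
qed

lemma QT_par:
  assumes u: "u \<in> DT" and v: "v \<in> DT"
  shows "QT (\<lambda>x. u x + v x) + QT (\<lambda>x. u x - v x) = 2 * QT u + 2 * QT v"
proof (rule antisym[OF QT_par_le[OF u v]])
  have "2 * (2 * QT u + 2 * QT v) = QT (\<lambda>x. 2 * u x) + QT (\<lambda>x. 2 * v x)"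
    unfolding QT_hom[OF u] QT_hom[OF v] by (simp add: distrib_left mult.assoc[symmetric])
  also have "\<dots> \<le> 2 * QT (\<lambda>x. u x + v x) + 2 * QT (\<lambda>x. u x - v x)"
    using QT_par_le[OF DT_add[OF u v] DT_diff[OF u v]] by simp
  finally have "2 * (2 * QT u + 2 * QT v) \<le> 2 * (QT (\<lambda>x. u x + v x) + QT (\<lambda>x. u x - v x))"
    by (simp add: distrib_left)
  then show "2 * QT u + 2 * QT v \<le> QT (\<lambda>x. u x + v x) + QT (\<lambda>x. u x - v x)"
    by (subst (asm) ennreal_mult_le_mult_iff) auto
qed

lemma QT_quad: "quad_form DT (\<lambda>u. enn2real (QT u))"
  by (rule quad_form_ennreal) (use D_DT[OF zero_mem] DT_add DT_scale QT_par QT_hom DTD(4) in \<open>auto simp: fun_space_def\<close>)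

lemma bil_polar: "Qtilde_bil m Q D mu J k = polar (\<lambda>u. enn2real (QT u))"
  by (auto simp: Qtilde_bil_def polar_def fun_eq_iff)

lemma bil_D: "u \<in> D \<Longrightarrow> v \<in> D \<Longrightarrow> Qtilde_bil m Q D mu J k u v = Q u v"
  using polar_Q[of u v] Q.nonneg[OF add_mem, of u v] Q.nonneg[OF diff_mem, of u v]
  by (simp add: bil_polar polar_def QT_D add_mem diff_mem)

end

section \<open>The equivalences\<close>

lemma linear_term_zero:
  fixes b c :: real
  assumes pos: "\<And>t. 0 \<le> 2 * (t * b) + t\<^sup>2 * c" and c: "0 \<le> c"
  shows "b = 0"
proof -
  \<comment> \<open>The minimiser would be - b / c; the added 1 covers c = 0 and still makes the
    expression equal to - (c + 2) t^2.\<close>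
  define t where "t = - b / (c + 1)"
  have b: "b = - (t * (c + 1))" using c by (simp add: t_def)
  have "0 \<le> - (t\<^sup>2 * (c + 2))" using pos[of t] unfolding b by (simp add: power2_eq_square algebra_simps)
  then have "t = 0" using c by (simp add: mult_le_0_iff)
  then show ?thesis using b by simp
qed

context bform
begin

lemma fun_space_DT_L2: "fun_space (DT \<inter> {u. L2 m u})"
  by (rule fun_space.intro)
     (use quad_form.axioms(1)[OF QT_quad] D_DT[OF zero_mem] D_L2[OF zero_mem] DT_add DT_scale L2_add L2.scale_mem in auto)

lemma L2_L1loc: "L2 m f \<Longrightarrow> L1loc m f"
  unfolding L1loc_def
proof (intro conjI allI impI)
  fix K :: "'a set" assume f: "L2 m f" and K: "compact K"
  have Ks: "K \<in> sets m" using K by (simp add: sets_m borel_compact)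
  have iK: "integrable m (indicator K :: 'a \<Rightarrow> real)"
    using compact_finite[OF K] Ks by simp
  show "integrable m (\<lambda>x. indicator K x * f x)"
  proof (rule Bochner_Integration.integrable_bound)
    show "integrable m (\<lambda>x. indicator K x + (f x)\<^sup>2)" using iK L2_integrable[OF f] by simp
    have "\<bar>y\<bar> \<le> 1 + y\<^sup>2" for y :: real
    proof (cases "\<bar>y\<bar> \<le> 1")
      case True
      then show ?thesis using zero_le_power2[of y] by linarith
    next
      case False
      then have "\<bar>y\<bar> * 1 \<le> \<bar>y\<bar> * \<bar>y\<bar>" by (intro mult_left_mono) auto
      then show ?thesis by (simp add: power2_eq_square)
    qed
    then show "AE x in m. norm (indicator K x * f x) \<le> norm (indicator K x + (f x)\<^sup>2)"
      by (auto simp: indicator_def)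
    show "(\<lambda>x. indicator K x * f x) \<in> borel_measurable m" using L2_measurable[OF f] Ks by measurable
  qed
qed (rule L2_measurable)

text \<open>v0 is the orthogonal projection of v onto D for the inner product \<open>Qmax + \<langle>_, _\<rangle>\<close>; its existence
  needs completeness of D only.\<close>

lemma DT_decomposition:
  assumes v: "v \<in> DT" "L2 m v"
  obtains v0 where "v0 \<in> D" "(\<lambda>x. v x - v0 x) \<in> DT" "L2 m (\<lambda>x. v x - v0 x)"
    "\<And>w. w \<in> D \<Longrightarrow> Qtilde_bil m Q D mu J k (\<lambda>x. v x - v0 x) w = - (\<integral>x. (v x - v0 x) * w x \<partial>m)"
proof -
  define V where "V = DT \<inter> {u. L2 m u}"
  define q where "q u = enn2real (QT u) + (\<integral>x. (u x)\<^sup>2 \<partial>m)" for u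
  have "quad_form V q"
    unfolding q_def
    by (rule quad_form_add) (rule quad_form_mono[OF QT_quad] quad_form_mono[OF L2.quad_form_axioms],
        use fun_space_DT_L2 in \<open>auto simp: V_def\<close>)+
  then interpret q: quad_form V q .
  have vV: "v \<in> V" using v by (simp add: V_def)
  have DV: "w \<in> V" if "w \<in> D" for w using D_DT[OF that] D_L2[OF that] by (simp add: V_def)
  have qD: "q w = Q1 m Q w" if "w \<in> D" for w
    using QT_D[OF that] Q.nonneg[OF that] by (simp add: q_def Q1_def)
  have dV: "(\<lambda>x. v x - w x) \<in> V" if "w \<in> D" for w by (rule q.diff_mem[OF vV DV[OF that]])
  define d where "d = Inf ((\<lambda>w. q (\<lambda>x. v x - w x)) ` D)"
  have bb: "bdd_below ((\<lambda>w. q (\<lambda>x. v x - w x)) ` D)"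
    using q.nonneg[OF dV] by (intro bdd_belowI[of _ 0]) auto
  have d_le: "d \<le> q (\<lambda>x. v x - w x)" if "w \<in> D" for w
    unfolding d_def by (rule cInf_lower[OF _ bb]) (use that in auto)
  define r where "r n = inverse (real (Suc n))" for n
  have r0: "0 < r n" for n by (simp add: r_def)
  have rlim: "r \<longlonglongrightarrow> 0" unfolding r_def by (rule LIMSEQ_inverse_real_of_nat)
  have "\<exists>w\<in>D. q (\<lambda>x. v x - w x) < d + r n" for n
  proof -
    have "d < d + r n" using r0[of n] by simp
    then show ?thesis unfolding d_def
      using cInf_lessD[of "(\<lambda>w. q (\<lambda>x. v x - w x)) ` D"] zero_mem by blast
  qed
  then obtain w where w: "\<And>n. w n \<in> D" "\<And>n. q (\<lambda>x. v x - w n x) < d + r n" by metis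
  \<comment> \<open>The midpoint of two near-minimisers is again a competitor, so the parallelogram
    law bounds their distance; as both lie in D, this distance is measured by
    \<open>Q1\<close>.\<close>
  have close: "Q1 m Q (\<lambda>x. w n x - w j x) \<le> 2 * r n + 2 * r j" for n j
  proof -
    have "(\<lambda>x. (v x - w n x) + (v x - w j x)) = (\<lambda>x. 2 * (v x - (w n x + w j x) / 2))"
      by (auto simp: field_simps)
    then have 1: "q (\<lambda>x. (v x - w n x) + (v x - w j x)) = 4 * q (\<lambda>x. v x - (w n x + w j x) / 2)"
      using q.hom[OF dV[OF divide_mem[OF add_mem[OF w(1)[of n] w(1)[of j]]]], of 2] by simp
    have "d \<le> q (\<lambda>x. v x - (w n x + w j x) / 2)" by (rule d_le[OF divide_mem[OF add_mem[OF w(1) w(1)]]])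
    moreover have "q (\<lambda>x. (v x - w n x) - (v x - w j x)) = Q1 m Q (\<lambda>x. w n x - w j x)"
      using q.q_diff_commute[OF dV[OF w(1)[of n]] dV[OF w(1)[of j]]] qD[OF diff_mem[OF w(1)[of n] w(1)[of j]]] by simp
    ultimately show ?thesis
      using q.par[OF dV[OF w(1)[of n]] dV[OF w(1)[of j]]] 1 w(2)[of n] w(2)[of j] by linarith
  qed
  have cau: "\<exists>N. \<forall>n\<ge>N. \<forall>j\<ge>N. Q1 m Q (\<lambda>x. w n x - w j x) < e" if "0 < e" for e
  proof -
    have "\<forall>\<^sub>F n in sequentially. r n < e / 4" using order_tendstoD(2)[OF rlim, of "e/4"] that by simp
    then obtain N where N: "\<And>n. N \<le> n \<Longrightarrow> r n < e / 4" unfolding eventually_sequentially by blast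
    show ?thesis
    proof (intro exI[of _ N] allI impI)
      fix n j assume "N \<le> n" "N \<le> j"
      then show "Q1 m Q (\<lambda>x. w n x - w j x) < e" using close[of n j] N[of n] N[of j] by linarith
    qed
  qed
  obtain v0 where v0: "v0 \<in> D" and lim: "(\<lambda>n. Q1 m Q (\<lambda>x. w n x - v0 x)) \<longlonglongrightarrow> 0"
    using D_complete[OF w(1) cau] by blast
  let ?h = "\<lambda>x. v x - v0 x"
  have h: "?h \<in> V" by (rule dV[OF v0])
  have "sqrt (q ?h) \<le> sqrt (d + r n) + sqrt (Q1 m Q (\<lambda>x. w n x - v0 x))" for n
  proof -
    have "sqrt (q ?h) \<le> sqrt (q (\<lambda>x. v x - w n x)) + sqrt (q (\<lambda>x. ?h x - (v x - w n x)))"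
      by (rule q.triangle_sub[OF h dV[OF w(1)]])
    also have "q (\<lambda>x. ?h x - (v x - w n x)) = Q1 m Q (\<lambda>x. w n x - v0 x)"
      using qD[OF diff_mem[OF w(1)[of n] v0]] by simp
    finally show ?thesis using real_sqrt_le_mono[OF less_imp_le[OF w(2)[of n]]] by linarith
  qed
  moreover have "(\<lambda>n. sqrt (d + r n) + sqrt (Q1 m Q (\<lambda>x. w n x - v0 x))) \<longlonglongrightarrow> sqrt (d + 0) + sqrt 0"
    by (intro tendsto_intros rlim lim)
  ultimately have "sqrt (q ?h) \<le> sqrt (d + 0) + sqrt 0" by (intro LIMSEQ_le_const) auto
  then have qh: "q ?h \<le> d" by simp
  \<comment> \<open>First-order condition at the minimiser: the variations v0 - t z stay in D, so
    the coefficient linear in t vanishes.\<close>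
  have orth: "polar q ?h z = 0" if z: "z \<in> D" for z
  proof -
    let ?b = "polar q ?h z" and ?c = "q z"
    have "d \<le> q (\<lambda>x. v x - (v0 x - t * z x))" for t by (rule d_le[OF diff_mem[OF v0 scale_mem[OF z]]])
    moreover have "q (\<lambda>x. v x - (v0 x - t * z x)) = q ?h + 2 * (t * ?b) + t\<^sup>2 * ?c" for t
      using q.q_add[OF h q.scale_mem[OF DV[OF z]], of t] q.polar_scale_right[OF DV[OF z] h, of t]
        q.hom[OF DV[OF z], of t] by (simp add: algebra_simps)
    ultimately have "d \<le> q ?h + 2 * (t * ?b) + t\<^sup>2 * ?c" for t by simp
    then have "0 \<le> 2 * (t * ?b) + t\<^sup>2 * ?c" for t using qh by (smt (verit))
    then show ?thesis using q.nonneg[OF DV[OF z]] by (rule linear_term_zero)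
  qed
  have hL: "L2 m ?h" and hDT: "?h \<in> DT" using h by (auto simp: V_def)
  show ?thesis
  proof
    show "v0 \<in> D" "?h \<in> DT" "L2 m ?h" by fact+
    fix z assume z: "z \<in> D"
    have "polar q ?h z = Qtilde_bil m Q D mu J k ?h z + polar (\<lambda>u. \<integral>x. (u x)\<^sup>2 \<partial>m) ?h z"
      unfolding bil_polar by (simp add: polar_def q_def add_divide_distrib diff_divide_distrib)
    then show "Qtilde_bil m Q D mu J k ?h z = - (\<integral>x. ?h x * z x \<partial>m)"
      using orth[OF z] polar_L2[OF hL D_L2[OF z]] by simp
  qed
qed

lemma Q_eq_Qmax_iff: "Q_eq_Qmax m Q D mu J k \<longleftrightarrow> DT \<inter> {u. L2 m u} \<subseteq> D"
  unfolding Q_eq_Qmax_def using D_DT D_L2 QT_D by auto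

text \<open>Shared by (ii) and (iii). The difference h comes with its equation in two strengths:
  against D \<inter> Cc, as the definition of \<L> asks, and against all of D, so that membership of
  h in D already allows testing with h.\<close>

lemma Q_eq_QmaxI:
  assumes null: "\<And>h. h \<in> DT \<Longrightarrow> L2 m h \<Longrightarrow> Lcal_rel m Q D mu J k h (\<lambda>x. - h x) \<Longrightarrow>
      (\<And>w. w \<in> D \<Longrightarrow> Qtilde_bil m Q D mu J k h w = - (\<integral>x. h x * w x \<partial>m)) \<Longrightarrow>
      Qtilde_bil m Q D mu J k h h = - (\<integral>x. h x * h x \<partial>m)"
  shows "Q_eq_Qmax m Q D mu J k"
  unfolding Q_eq_Qmax_iff
proof
  fix v assume "v \<in> DT \<inter> {u. L2 m u}"
  then have v: "v \<in> DT" "L2 m v" by auto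
  obtain v0 where v0: "v0 \<in> D" "(\<lambda>x. v x - v0 x) \<in> DT" "L2 m (\<lambda>x. v x - v0 x)"
    and o: "\<And>w. w \<in> D \<Longrightarrow> Qtilde_bil m Q D mu J k (\<lambda>x. v x - v0 x) w = - (\<integral>x. (v x - v0 x) * w x \<partial>m)"
    using DT_decomposition[OF v] by blast
  interpret E: quad_form DT "\<lambda>u. enn2real (QT u)" by (rule QT_quad)
  let ?h = "\<lambda>x. v x - v0 x"
  have "L1loc m (\<lambda>x. - ?h x)" using L2_L1loc L2.minus_mem[of ?h m] v0(3) by auto
  then have "Lcal_rel m Q D mu J k ?h (\<lambda>x. - ?h x)"
    unfolding Lcal_rel_def using v0(2) o by (auto simp del: minus_diff_eq)
  from null[OF v0(2,3) this o] have "Qtilde_bil m Q D mu J k ?h ?h = - (\<integral>x. ?h x * ?h x \<partial>m)" .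
  moreover have "0 \<le> Qtilde_bil m Q D mu J k ?h ?h"
    unfolding bil_polar using E.polar_self[OF v0(2)] E.nonneg[OF v0(2)] by simp
  ultimately have "(\<integral>x. (?h x)\<^sup>2 \<partial>m) \<le> 0" by (simp add: power2_eq_square)
  then have "AE x in m. ?h x = 0" by (rule L2_eq_zero_AE[OF v0(3)])
  then have "AE x in m. v0 x = v x" by eventually_elim simp
  then show "v \<in> D" by (rule D_AE[OF v0(1) DTD(1)[OF v(1)]])
qed

text \<open>Both sides are continuous in v for the norm of \<open>Q1\<close>, by the Cauchy-Schwarz
  inequalities for Q and for L2, and D \<inter> Cc is dense in D for that norm.\<close>

lemma weak_equation_extends:
  assumes u: "u \<in> D" and f: "L2 m f" and eq: "\<And>v. v \<in> D \<inter> Cc \<Longrightarrow> Q u v = (\<integral>x. f x * v x \<partial>m)" and v: "v \<in> D"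
  shows "Q u v = (\<integral>x. f x * v x \<partial>m)"
proof -
  obtain vs where vs: "\<And>n. vs n \<in> D" "\<And>n. vs n \<in> Cc" and lim: "(\<lambda>n. Q1 m Q (\<lambda>x. vs n x - v x)) \<longlonglongrightarrow> 0"
    using approx_seq[OF v] by blast
  define C where "C = sqrt (Q u u) + sqrt (\<integral>x. (f x)\<^sup>2 \<partial>m)"
  have "\<bar>Q u v - (\<integral>x. f x * v x \<partial>m)\<bar> \<le> C * sqrt (Q1 m Q (\<lambda>x. vs n x - v x))" for n
  proof -
    let ?d = "\<lambda>x. vs n x - v x"
    have d: "?d \<in> D" by (rule diff_mem[OF vs(1) v])
    have "Q u (vs n) = Q u v + Q u ?d"
      using Q_add[OF v d u] Q_sym[OF u v] Q_sym[OF u d] Q_sym[OF u vs(1)[of n]] by simp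
    moreover have "(\<integral>x. f x * vs n x \<partial>m) = (\<integral>x. f x * v x \<partial>m) + (\<integral>x. f x * ?d x \<partial>m)"
      using L2_prod_integrable[OF f D_L2[OF v]] L2_prod_integrable[OF f D_L2[OF d]]
      by (subst Bochner_Integration.integral_add[symmetric]) (auto simp: algebra_simps)
    ultimately have "Q u v - (\<integral>x. f x * v x \<partial>m) = (\<integral>x. f x * ?d x \<partial>m) - Q u ?d"
      using eq[of "vs n"] vs[of n] by simp
    also have "\<bar>\<dots>\<bar> \<le> sqrt (\<integral>x. (f x)\<^sup>2 \<partial>m) * sqrt (\<integral>x. (?d x)\<^sup>2 \<partial>m) + sqrt (Q u u) * sqrt (Q ?d ?d)"
      using L2_holder[OF f D_L2[OF d]] Q.cauchy_schwarz[OF u d] polar_Q[OF u d] by linarith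
    also have "\<dots> \<le> sqrt (\<integral>x. (f x)\<^sup>2 \<partial>m) * sqrt (Q1 m Q ?d) + sqrt (Q u u) * sqrt (Q1 m Q ?d)"
      using L2_le_Q1[OF d] Q_le_Q1[of ?d] Q.nonneg[OF u] by (intro add_mono mult_left_mono) auto
    finally show ?thesis by (simp add: C_def algebra_simps)
  qed
  moreover have "(\<lambda>n. C * sqrt (Q1 m Q (\<lambda>x. vs n x - v x))) \<longlonglongrightarrow> C * sqrt 0"
    by (intro tendsto_intros lim)
  ultimately have "\<bar>Q u v - (\<integral>x. f x * v x \<partial>m)\<bar> \<le> C * sqrt 0" by (intro LIMSEQ_le_const) auto
  then show ?thesis by simp
qed

lemma Qmax_imp_domL:
  assumes "Q_eq_Qmax m Q D mu J k"
  shows "domL m Q D = {u \<in> domLcal m Q D mu J k. L2 m u \<and> (\<exists>f. Lcal_rel m Q D mu J k u f \<and> L2 m f)}"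
proof (intro set_eqI iffI)
  fix u assume "u \<in> domL m Q D"
  then obtain f where u: "u \<in> D" "L2 m f" "\<And>v. v \<in> D \<Longrightarrow> Q u v = (\<integral>x. f x * v x \<partial>m)"
    by (auto simp: domL_def)
  have "Lcal_rel m Q D mu J k u f"
    unfolding Lcal_rel_def using D_DT[OF u(1)] L2_L1loc[OF u(2)] bil_D[OF u(1)] u(3) by auto
  then show "u \<in> {u \<in> domLcal m Q D mu J k. L2 m u \<and> (\<exists>f. Lcal_rel m Q D mu J k u f \<and> L2 m f)}"
    using D_L2[OF u(1)] u(2) by (auto simp: domLcal_def)
next
  fix u assume "u \<in> {u \<in> domLcal m Q D mu J k. L2 m u \<and> (\<exists>f. Lcal_rel m Q D mu J k u f \<and> L2 m f)}"
  then obtain f where L: "L2 m u" "L2 m f" "Lcal_rel m Q D mu J k u f" by blast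
  have u: "u \<in> D" using assms L(1,3) unfolding Q_eq_Qmax_iff Lcal_rel_def by auto
  have "Q u v = (\<integral>x. f x * v x \<partial>m)" if "v \<in> D \<inter> Cc" for v
    using L(3) that bil_D[OF u, of v] by (auto simp: Lcal_rel_def)
  then have "\<forall>v\<in>D. Q u v = (\<integral>x. f x * v x \<partial>m)" using weak_equation_extends[OF u L(2)] by blast
  then show "u \<in> domL m Q D" unfolding domL_def using u L(2) by blast
qed

lemma domL_imp_Qmax:
  assumes dom: "domL m Q D = {u \<in> domLcal m Q D mu J k. L2 m u \<and> (\<exists>f. Lcal_rel m Q D mu J k u f \<and> L2 m f)}"
  shows "Q_eq_Qmax m Q D mu J k"
proof (rule Q_eq_QmaxI)
  fix h assume h: "h \<in> DT" "L2 m h" "Lcal_rel m Q D mu J k h (\<lambda>x. - h x)"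
    and o: "\<And>w. w \<in> D \<Longrightarrow> Qtilde_bil m Q D mu J k h w = - (\<integral>x. h x * w x \<partial>m)"
  have "L2 m (\<lambda>x. - h x)" using L2.minus_mem[of h m] h(2) by auto
  then have "h \<in> domL m Q D" unfolding dom using h by (auto simp: domLcal_def)
  then have "h \<in> D" by (simp add: domL_def)
  then show "Qtilde_bil m Q D mu J k h h = - (\<integral>x. h x * h x \<partial>m)" by (rule o)
qed

lemma Qmax_imp_green:
  assumes "Q_eq_Qmax m Q D mu J k" and "Lcal_rel m Q D mu J k u f" "L2 m u" "L2 m f" "v \<in> DT" "L2 m v"
  shows "Qtilde_bil m Q D mu J k u v = (\<integral>x. f x * v x \<partial>m)"
proof -
  have u: "u \<in> D" and v: "v \<in> D"
    using assms unfolding Q_eq_Qmax_iff Lcal_rel_def by auto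
  have "Q u w = (\<integral>x. f x * w x \<partial>m)" if "w \<in> D \<inter> Cc" for w
    using assms(2) that bil_D[OF u, of w] by (auto simp: Lcal_rel_def)
  then show ?thesis using weak_equation_extends[OF u assms(4) _ v] bil_D[OF u v] by simp
qed

lemma green_imp_Qmax:
  assumes green: "\<And>u f v. Lcal_rel m Q D mu J k u f \<Longrightarrow> L2 m u \<Longrightarrow> L2 m f \<Longrightarrow> v \<in> DT \<Longrightarrow> L2 m v \<Longrightarrow>
    Qtilde_bil m Q D mu J k u v = (\<integral>x. f x * v x \<partial>m)"
  shows "Q_eq_Qmax m Q D mu J k"
proof (rule Q_eq_QmaxI)
  fix h assume h: "h \<in> DT" "L2 m h" "Lcal_rel m Q D mu J k h (\<lambda>x. - h x)"
  have "L2 m (\<lambda>x. - h x)" using L2.minus_mem[of h m] h(2) by auto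
  from green[OF h(3,2) this h(1,2)]
  show "Qtilde_bil m Q D mu J k h h = - (\<integral>x. h x * h x \<partial>m)" by simp
qed

end

theorem mainTheorem11:
  fixes m :: "'a::{metric_space, second_countable_topology} measure"
    and Q :: "('a \<Rightarrow> real) \<Rightarrow> ('a \<Rightarrow> real) \<Rightarrow> real"
    and D :: "('a \<Rightarrow> real) set"
    and mu :: "('a \<Rightarrow> real) \<Rightarrow> 'a measure"
    and J :: "('a \<times> 'a) measure"
    and k :: "'a measure"
  assumes "locally compact (UNIV :: 'a set)"
    and "radon_full_support m"
    and "regular_dirichlet_form m Q D"
    and "beurling_deny m Q D mu J k"
  shows "(Q_eq_Qmax m Q D mu J k
            \<longleftrightarrow> domL m Q D = {u \<in> domLcal m Q D mu J k. L2 m u \<and>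
                   (\<exists>f. Lcal_rel m Q D mu J k u f \<and> L2 m f)})
       \<and> (Q_eq_Qmax m Q D mu J k
            \<longleftrightarrow> (\<forall>u f v. Lcal_rel m Q D mu J k u f \<and> L2 m u \<and> L2 m f
                   \<and> v \<in> Dtilde m Q D mu J k \<and> L2 m v
                   \<longrightarrow> Qtilde_bil m Q D mu J k u v = (\<integral>x. f x * v x \<partial>m)))"
proof -
  interpret bform m Q D mu J k
    by unfold_locales (use assms in \<open>auto simp: regular_dirichlet_form_def\<close>)
  show ?thesis
    using Qmax_imp_domL domL_imp_Qmax Qmax_imp_green green_imp_Qmax by blast
qed

end
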